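(* Let $p\ge1$ be an integer and $Q>0$. For each $n\ge1$ let $N=N_n=\lceil(2Q/B_1^2)^{1/(2p)}\,n^{1/(2p+1)}\rceil$, let $\pi_N(\cdot)=\mu_N(\cdot\cap E_{p,N}(Q))/\mu_N(E_{p,N}(Q))$ be the restriction to $E_{p,N}(Q)$ of the Gaussian product measure $\mu_N$ defined in the context, and let $\Pi_n$ be the prior induced by $\pi_N$ on $\mathscr F_n=\{f_{\boldsymbol\theta_N}:\boldsymbol\theta_N\in E_{p,N}(Q)\}$. If $\boldsymbol\theta_0\in E_p(Q)$ and $P_0=P_{\boldsymbol\theta_0}$, then for a sufficiently large constant $M>0$, $$\Pi_n\big(\{P_{\boldsymbol\theta}:\ d_{\mathrm H}(P_0,P_{\boldsymbol\theta})>Mn^{-p/(2p+1)}\}\,\big|\,X_1,\dots,X_n\big)\to0\quad\text{as }n\to\infty,$$ $P_0^\infty$-almost surely.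
   Context: Trigonometric system on $[0,1]$: $\phi_0\equiv1$ and, for $k\ge1$, $\phi_{2k-1}(x)=\sqrt2\sin(2\pi kx)$, $\phi_{2k}(x)=\sqrt2\cos(2\pi kx)$. Put $v_0=0$ and, for $j\ge1$, $v_j=j+1$ if $j$ is odd, $v_j=j$ if $j$ is even. The Sobolev ellipsoid is $E_p(Q)=\{\boldsymbol\theta\in\ell_2:\sum_{j=0}^\infty v_j^{2p}\theta_j^2<Q\}$; for an integer $N\ge1$, $\boldsymbol\theta_N=(\theta_0,\dots,\theta_N,0,0,\dots)$ denotes a sequence whose coordinates of index $>N$ vanish, and $E_{p,N}(Q)=\{\boldsymbol\theta_N:\sum_{j=0}^Nv_j^{2p}\theta_j^2<Q\}\subseteq E_p(Q)$. Constants: $A=\sum_{j=1}^\infty v_j^{-2p}$, $B=\sqrt{2QA}$, $B_1^2=e^{-8B}$. For $\boldsymbol\theta\in E_p(Q)$, $P_{\boldsymbol\theta}$ is the probability measure on $[0,1]$ with Lebesgue density $$f_{\boldsymbol\theta}(x)=\frac{\exp\{\sum_{j=1}^\infty\theta_j\phi_j(x)\}}{\int_0^1\exp\{\sum_{j=1}^\infty\theta_j\phi_j(t)\}\,dt},\qquad x\in[0,1].$$ The Hellinger distance is $d_{\mathrm H}(P_{\boldsymbol\theta'},P_{\boldsymbol\theta})=\{\int_0^1(\sqrt{f_{\boldsymbol\theta'}}-\sqrt{f_{\boldsymbol\theta}})^2\,dx\}^{1/2}$. $\mu_N$ is the probability measure on sequences $(\theta_0,\theta_1,\dots)$ under which the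 coordinates are independent, $\theta_0\equiv0$, $\theta_j\sim N(0,v_j^{-(2p+1)})$ for $j=1,\dots,N$, and $\theta_j\equiv0$ for all $j>N$. The observations $X_1,X_2,\dots$ are i.i.d. from $P_0$; $P_0^\infty$ is the infinite product measure of $P_0$; the posterior is given by Bayes' formula: $\Pi_n(C\mid X_1,\dots,X_n)=\int_{\{\boldsymbol\theta:P_{\boldsymbol\theta}\in C\}}\prod_{i=1}^nf_{\boldsymbol\theta}(X_i)\,\pi_N(d\boldsymbol\theta)\big/\int\prod_{i=1}^nf_{\boldsymbol\theta}(X_i)\,\pi_N(d\boldsymbol\theta)$. *)

theory Defs
  imports "HOL-Probability.Probability"
begin

definition leb01 :: "real measure" where
  "leb01 = restrict_space lborel {0..1}"

definition phi :: "nat \<Rightarrow> real \<Rightarrow> real" where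
  "phi j x =
     (if j = 0 then 1
      else if odd j then sqrt 2 * sin (2 * pi * real ((j + 1) div 2) * x)
      else sqrt 2 * cos (2 * pi * real (j div 2) * x))"

definition vseq :: "nat \<Rightarrow> real" where
  "vseq j = (if odd j then real j + 1 else real j)"

definition ellipsoid :: "nat \<Rightarrow> real \<Rightarrow> (nat \<Rightarrow> real) set" where
  "ellipsoid p Q =
     {\<theta>. summable (\<lambda>j. (\<theta> j)\<^sup>2) \<and> summable (\<lambda>j. vseq j ^ (2 * p) * (\<theta> j)\<^sup>2) \<and>
         (\<Sum>j. vseq j ^ (2 * p) * (\<theta> j)\<^sup>2) < Q}"

definition sieve_ellipsoid :: "nat \<Rightarrow> nat \<Rightarrow> real \<Rightarrow> (nat \<Rightarrow> real) set" where
  "sieve_ellipsoid p N Q =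
     {\<theta>. (\<forall>j>N. \<theta> j = 0) \<and> (\<Sum>j\<le>N. vseq j ^ (2 * p) * (\<theta> j)\<^sup>2) < Q}"

definition const_A :: "nat \<Rightarrow> real" where
  "const_A p = (\<Sum>j. 1 / vseq (Suc j) ^ (2 * p))"

definition const_B :: "nat \<Rightarrow> real \<Rightarrow> real" where
  "const_B p Q = sqrt (2 * Q * const_A p)"

definition const_B1_sq :: "nat \<Rightarrow> real \<Rightarrow> real" where
  "const_B1_sq p Q = exp (- 8 * const_B p Q)"

definition sieve_dim :: "nat \<Rightarrow> real \<Rightarrow> nat \<Rightarrow> nat" where
  "sieve_dim p Q n =
     nat \<lceil>(2 * Q / const_B1_sq p Q) powr (1 / real (2 * p)) * real n powr (1 / real (2 * p + 1))\<rceil>"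

definition log_series :: "(nat \<Rightarrow> real) \<Rightarrow> real \<Rightarrow> real" where
  "log_series \<theta> x = (\<Sum>j. \<theta> (Suc j) * phi (Suc j) x)"

definition dens :: "(nat \<Rightarrow> real) \<Rightarrow> real \<Rightarrow> real" where
  "dens \<theta> x = exp (log_series \<theta> x) / (\<integral>t. exp (log_series \<theta> t) \<partial>leb01)"

definition Ptheta :: "(nat \<Rightarrow> real) \<Rightarrow> real measure" where
  "Ptheta \<theta> = density leb01 (\<lambda>x. ennreal (dens \<theta> x))"

text \<open>The arguments are Lebesgue densities on the unit interval.\<close>

definition hellinger_dist :: "(real \<Rightarrow> real) \<Rightarrow> (real \<Rightarrow> real) \<Rightarrow> real" where
  "hellinger_dist f g = sqrt (\<integral>x. (sqrt (f x) - sqrt (g x))\<^sup>2 \<partial>leb01)"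

text \<open>The second argument of \<^const>\<open>normal_density\<close> is the standard deviation, so the
  variance of coordinate \<open>j\<close> is \<open>1 / vseq j ^ (2 * p + 1)\<close>.\<close>

definition gauss_prior :: "nat \<Rightarrow> nat \<Rightarrow> (nat \<Rightarrow> real) measure" where
  "gauss_prior p N =
     Pi\<^sub>M UNIV (\<lambda>j. if 1 \<le> j \<and> j \<le> N
                    then density lborel (\<lambda>x. ennreal (normal_density 0 (sqrt (1 / vseq j ^ (2 * p + 1))) x))
                    else return borel 0)"

text \<open>\<^const>\<open>uniform_measure\<close> is conditioning: it maps a measurable \<open>S\<close> to
  \<open>\<mu> (S \<inter> E) / \<mu> E\<close>.\<close>

definition sieve_prior :: "nat \<Rightarrow> nat \<Rightarrow> real \<Rightarrow> (nat \<Rightarrow> real) measure" where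
  "sieve_prior p N Q = uniform_measure (gauss_prior p N) (sieve_ellipsoid p N Q)"

definition likelihood :: "nat \<Rightarrow> (nat \<Rightarrow> real) \<Rightarrow> (nat \<Rightarrow> real) \<Rightarrow> real" where
  "likelihood n X \<theta> = (\<Prod>i<n. dens \<theta> (X i))"

text \<open>The observations are indexed from \<open>0\<close>. The numerator ranges only over the sieve
  ellipsoid, which carries all the prior mass: elsewhere the series defining \<^const>\<open>dens\<close>
  may diverge, and its unspecified value could spoil measurability.\<close>

definition posterior ::
  "nat \<Rightarrow> real \<Rightarrow> nat \<Rightarrow> (nat \<Rightarrow> real) \<Rightarrow> real measure set \<Rightarrow> ennreal" where
  "posterior p Q n X C =
     (let N = sieve_dim p Q n; \<pi> = sieve_prior p N Q in
      (\<integral>\<^sup>+\<theta>\<in>{\<theta> \<in> sieve_ellipsoid p N Q. Ptheta \<theta> \<in> C}. ennreal (likelihood n X \<theta>) \<partial>\<pi>) /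
      (\<integral>\<^sup>+\<theta>. ennreal (likelihood n X \<theta>) \<partial>\<pi>))"

end

theory Submission
  imports Defs
begin

text \<open>
  Restricted to the sieve, the model is a finite-dimensional exponential family, and this makes the
  posterior mass computable up to constants on a single good event. Write
  \<open>\<epsilon> = n\<^sup>-\<^sup>p\<^sup>/\<^sup>(\<^sup>2\<^sup>p\<^sup>+\<^sup>1\<^sup>)\<close>, so that \<open>n \<epsilon>\<^sup>2\<close> and the sieve dimension \<open>N\<close> have the same order, and
  let \<open>\<eta>\<close> be the truncation of \<open>\<theta>\<^sub>0\<close> to the first \<open>N\<close> coordinates. For every \<open>\<theta>\<close> in the sieve
  (lemma \<open>likelihood_ratio\<close>)
  \[ \log \prod_{i<n} \frac{f_\theta(X_i)}{f_\eta(X_i)}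
       = n \bigl( \langle \theta - \eta, Z \rangle - K(\eta, \theta) \bigr), \]
  where \<open>Z\<close> is the vector of centred empirical means of \<open>\<phi>\<^sub>1, \<dots>, \<phi>\<^sub>N\<close> and \<open>K\<close> is the relative
  entropy. All log-densities over the ellipsoid are bounded by a common constant, so \<open>K(\<eta>, \<theta>)\<close> lies
  between two multiples of the squared coefficient distance (\<open>rel_entropy_bounds\<close>), and that distance
  dominates the squared Hellinger distance (\<open>hellinger_dist_sq_le\<close>).

  On the event that the norm of \<open>Z\<close> is at most a multiple of \<open>\<epsilon>\<close>, the quadratic term wins as soon as
  \<open>\<theta>\<close> is a large multiple \<open>m \<epsilon>\<close> away from \<open>\<eta>\<close>. The likelihood ratio is then at most
  \<open>exp (- c m\<^sup>2 n \<epsilon>\<^sup>2)\<close>, uniformly over the far part of the sieve (\<open>likelihood_upper\<close>). For \<open>\<theta>\<close> within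
  order \<open>\<epsilon>\<close> of \<open>\<eta>\<close> it is at least \<open>exp (- G n \<epsilon>\<^sup>2)\<close> (\<open>likelihood_lower\<close>), and the prior gives such \<open>\<theta>\<close> mass
  at least \<open>exp (- c N)\<close> (\<open>sieve_prior_mass\<close>). For \<open>m\<close> large the quotient of the two is at most
  \<open>exp (- n \<epsilon>\<^sup>2)\<close>, which tends to zero.

  The good event holds for all large \<open>n\<close> almost surely (\<open>noise_eventually_small\<close>): the norm of \<open>Z\<close>
  is controlled by its inner products with exponentially many (in \<open>N\<close>) lattice directions, each of
  these obeys a Bernstein bound \<open>exp (- c n \<epsilon>\<^sup>2)\<close> with \<open>c\<close> as large as desired, and the resulting
  probabilities are summable. The means under \<open>\<theta>\<^sub>0\<close> and under \<open>\<eta>\<close> differ by a multiple of \<open>\<epsilon>\<close>, by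
  Bessel's inequality.
\<close>

section \<open>The trigonometric system on the unit interval\<close>

lemma prob_space_leb01: "prob_space leb01"
  unfolding leb01_def
  by (intro prob_spaceI) (simp add: emeasure_restrict_space space_restrict_space)

interpretation leb01: prob_space leb01
  by (rule prob_space_leb01)

lemma borel_measurable_leb01 [measurable (raw)]:
  "f \<in> borel_measurable borel \<Longrightarrow> f \<in> borel_measurable leb01"
  unfolding leb01_def by (intro measurable_restrict_space1) simp

lemma integrable_leb01_bounded:
  fixes f :: "real \<Rightarrow> real"
  assumes "f \<in> borel_measurable borel" and "\<And>x. \<bar>f x\<bar> \<le> C"
  shows "integrable leb01 f"
  using assms by (intro leb01.integrable_const_bound[where B = C]) auto

lemma integrable_leb01_bounded_sq:
  fixes f :: "real \<Rightarrow> real"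
  assumes [measurable]: "f \<in> borel_measurable borel" and f: "\<And>x. \<bar>f x\<bar> \<le> C"
  shows "integrable leb01 (\<lambda>x. (f x)\<^sup>2)"
  using power_mono[OF f abs_ge_zero, of _ 2]
  by (intro integrable_leb01_bounded[where C = "C\<^sup>2"]) auto

lemma phi_borel [measurable]: "phi j \<in> borel_measurable borel"
  unfolding phi_def[abs_def] by (cases "j = 0"; cases "odd j") (auto simp: phi_def[abs_def])

lemma abs_phi_le: "\<bar>phi j x\<bar> \<le> sqrt 2"
  unfolding phi_def using real_sqrt_le_mono[of 1 2]
  by (auto simp: abs_mult intro: order_trans[OF mult_left_mono[OF abs_sin_le_one]]
      order_trans[OF mult_left_mono[OF abs_cos_le_one]])

lemma integral_leb01_FTC:
  fixes f F :: "real \<Rightarrow> real"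
  assumes "\<And>x. (F has_real_derivative f x) (at x)" and "continuous_on UNIV f"
  shows "(\<integral>x. f x \<partial>leb01) = F 1 - F 0"
proof -
  have "(\<integral>x. f x \<partial>leb01) = (\<integral>x. indicator {0..1} x *\<^sub>R f x \<partial>lborel)"
    unfolding leb01_def by (subst integral_restrict_space) auto
  also have "\<dots> = F 1 - F 0"
    using assms(1) continuous_on_subset[OF assms(2) subset_UNIV]
    by (intro integral_FTC_Icc[where f = f])
       (auto intro: has_field_derivative_at_within simp: has_real_derivative_iff_has_vector_derivative[symmetric])
  finally show ?thesis .
qed

lemma integral_cos_period:
  "(\<integral>x. cos (2 * pi * of_int m * x) \<partial>leb01) = (if m = 0 then 1 else 0)"
proof (cases "m = 0")
  case True
  then show ?thesis using leb01.prob_space by simp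
next
  case False
  then have "(\<integral>x. cos (2 * pi * of_int m * x) \<partial>leb01)
      = sin (2 * pi * of_int m * 1) / (2 * pi * of_int m) - sin (2 * pi * of_int m * 0) / (2 * pi * of_int m)"
    by (intro integral_leb01_FTC)
       (auto intro!: derivative_eq_intros continuous_intros simp: field_simps)
  also have "sin (2 * pi * of_int m * 1) = 0"
    using sin_int_2pin[of m] by (simp add: mult_ac)
  finally show ?thesis using False by simp
qed

lemma integral_sin_period: "(\<integral>x. sin (2 * pi * of_int m * x) \<partial>leb01) = 0"
proof (cases "m = 0")
  case False
  then have "(\<integral>x. sin (2 * pi * of_int m * x) \<partial>leb01)
      = - cos (2 * pi * of_int m * 1) / (2 * pi * of_int m) - - cos (2 * pi * of_int m * 0) / (2 * pi * of_int m)"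
    by (intro integral_leb01_FTC)
       (auto intro!: derivative_eq_intros continuous_intros simp: field_simps)
  also have "cos (2 * pi * of_int m * 1) = 1"
    using cos_int_2pin[of m] by (simp add: mult_ac)
  finally show ?thesis by simp
qed simp

lemma integrable_trig:
  "integrable leb01 (\<lambda>x. cos (c * x))" "integrable leb01 (\<lambda>x. sin (c * x))"
  by (rule integrable_leb01_bounded[where C = 1]; simp)+

text \<open>The integer-frequency form of \<^const>\<open>phi\<close> reduces every product of two basis functions
  to integrals of \<open>cos\<close> and \<open>sin\<close> over full periods.\<close>

lemma phi_Suc_cases:
  obtains k where "k \<ge> 1" "j = 2 * k - 2" "phi (Suc j) = (\<lambda>x. sqrt 2 * sin (2 * pi * of_int (int k) * x))"
  | k where "k \<ge> 1" "j = 2 * k - 1" "phi (Suc j) = (\<lambda>x. sqrt 2 * cos (2 * pi * of_int (int k) * x))"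
proof (cases "odd (Suc j)")
  case True
  then obtain k where "Suc j = 2 * k + 1" by (elim oddE)
  then have "phi (Suc j) = (\<lambda>x. sqrt 2 * sin (2 * pi * of_int (int (k + 1)) * x))"
    by (auto simp: phi_def fun_eq_iff)
  then show ?thesis using that(1)[of "k + 1"] \<open>Suc j = _\<close> by auto
next
  case False
  then obtain k where "Suc j = 2 * k" by (meson evenE)
  then have "phi (Suc j) = (\<lambda>x. sqrt 2 * cos (2 * pi * of_int (int k) * x))"
    by (auto simp: phi_def fun_eq_iff)
  then show ?thesis using that(2)[of k] \<open>Suc j = _\<close> by (cases k) auto
qed

lemma integral_phi: "(\<integral>x. phi (Suc j) x \<partial>leb01) = 0"
  by (rule phi_Suc_cases[of j]) (simp_all only: integral_mult_right_zero integral_cos_period integral_sin_period, auto)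

lemma phi_orthonormal:
  "(\<integral>x. phi (Suc i) x * phi (Suc j) x \<partial>leb01) = (if i = j then 1 else 0)"
proof -
  let ?c = "\<lambda>m x. cos (2 * pi * of_int m * x)" and ?s = "\<lambda>m x. sin (2 * pi * of_int m * x)"
  have s2: "sqrt 2 * a * (sqrt 2 * b) = 2 * (a * b)" for a b :: real
    by (simp add: algebra_simps)
  have arg: "2 * pi * of_int (k - l) * x = 2 * pi * of_int k * x - 2 * pi * of_int l * x"
    "2 * pi * of_int (k + l) * x = 2 * pi * of_int k * x + 2 * pi * of_int l * x" for k l x
    by (simp_all add: algebra_simps)
  have ss: "(\<integral>x. sqrt 2 * ?s k x * (sqrt 2 * ?s l x) \<partial>leb01) = (if k = l then 1 else 0) - (if k + l = 0 then 1 else 0)" for k l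
  proof -
    have "sqrt 2 * ?s k x * (sqrt 2 * ?s l x) = ?c (k - l) x - ?c (k + l) x" for x
      unfolding s2 arg by (simp add: sin_times_sin)
    then have "(\<integral>x. sqrt 2 * ?s k x * (sqrt 2 * ?s l x) \<partial>leb01) = (\<integral>x. ?c (k - l) x - ?c (k + l) x \<partial>leb01)"
      by simp
    also have "\<dots> = (\<integral>x. ?c (k - l) x \<partial>leb01) - (\<integral>x. ?c (k + l) x \<partial>leb01)"
      by (intro Bochner_Integration.integral_diff integrable_trig)
    finally show ?thesis by (simp only: integral_cos_period) auto
  qed
  have cc: "(\<integral>x. sqrt 2 * ?c k x * (sqrt 2 * ?c l x) \<partial>leb01) = (if k = l then 1 else 0) + (if k + l = 0 then 1 else 0)" for k l
  proof -
    have "sqrt 2 * ?c k x * (sqrt 2 * ?c l x) = ?c (k - l) x + ?c (k + l) x" for x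
      unfolding s2 arg by (simp add: cos_times_cos)
    then have "(\<integral>x. sqrt 2 * ?c k x * (sqrt 2 * ?c l x) \<partial>leb01) = (\<integral>x. ?c (k - l) x + ?c (k + l) x \<partial>leb01)"
      by simp
    also have "\<dots> = (\<integral>x. ?c (k - l) x \<partial>leb01) + (\<integral>x. ?c (k + l) x \<partial>leb01)"
      by (intro Bochner_Integration.integral_add integrable_trig)
    finally show ?thesis by (simp only: integral_cos_period) auto
  qed
  have sc: "(\<integral>x. sqrt 2 * ?s k x * (sqrt 2 * ?c l x) \<partial>leb01) = 0" for k l
  proof -
    have "sqrt 2 * ?s k x * (sqrt 2 * ?c l x) = ?s (k + l) x + ?s (k - l) x" for x
      unfolding s2 arg by (simp add: sin_times_cos)
    then have "(\<integral>x. sqrt 2 * ?s k x * (sqrt 2 * ?c l x) \<partial>leb01) = (\<integral>x. ?s (k + l) x + ?s (k - l) x \<partial>leb01)"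
      by simp
    also have "\<dots> = (\<integral>x. ?s (k + l) x \<partial>leb01) + (\<integral>x. ?s (k - l) x \<partial>leb01)"
      by (intro Bochner_Integration.integral_add integrable_trig)
    finally show ?thesis by (simp only: integral_sin_period)
  qed
  have cs: "(\<integral>x. sqrt 2 * ?c k x * (sqrt 2 * ?s l x) \<partial>leb01) = 0" for k l
    using sc[of l k] by (simp only: mult.commute)
  show ?thesis
  proof (cases rule: phi_Suc_cases[of i])
    case i: (1 k)
    show ?thesis
    proof (cases rule: phi_Suc_cases[of j])
      case j: (1 l)
      show ?thesis unfolding i(3) j(3) ss using i(1,2) j(1,2) by auto
    next
      case j: (2 l)
      have "i \<noteq> j" using i(1,2) j(1,2) by presburger
      then show ?thesis unfolding i(3) j(3) sc by simp
    qed
  next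
    case i: (2 k)
    show ?thesis
    proof (cases rule: phi_Suc_cases[of j])
      case j: (1 l)
      have "i \<noteq> j" using i(1,2) j(1,2) by presburger
      then show ?thesis unfolding i(3) j(3) cs by simp
    next
      case j: (2 l)
      show ?thesis unfolding i(3) j(3) cc using i(1,2) j(1,2) by auto
    qed
  qed
qed

section \<open>Absolutely convergent trigonometric series\<close>

text \<open>Only the coefficients from index \<open>1\<close> on enter \<^const>\<open>log_series\<close>; the constant function is
  absorbed by the normalisation of the density.\<close>

definition abs_summable_coeffs :: "(nat \<Rightarrow> real) \<Rightarrow> bool" where
  "abs_summable_coeffs a \<longleftrightarrow> summable (\<lambda>j. \<bar>a (Suc j)\<bar>)"

definition partial_series :: "(nat \<Rightarrow> real) \<Rightarrow> nat \<Rightarrow> real \<Rightarrow> real" where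
  "partial_series a n x = (\<Sum>j<n. a (Suc j) * phi (Suc j) x)"

lemma log_series_borel [measurable]: "log_series a \<in> borel_measurable borel"
  unfolding log_series_def[abs_def] by measurable

lemma partial_series_borel [measurable]: "partial_series a n \<in> borel_measurable borel"
  unfolding partial_series_def[abs_def] by measurable

lemma abs_partial_series_le:
  assumes "abs_summable_coeffs a"
  shows "\<bar>partial_series a n x\<bar> \<le> sqrt 2 * (\<Sum>j. \<bar>a (Suc j)\<bar>)"
proof -
  have "\<bar>partial_series a n x\<bar> \<le> (\<Sum>j<n. \<bar>a (Suc j)\<bar> * sqrt 2)"
    unfolding partial_series_def
    by (rule order_trans[OF sum_abs sum_mono]) (auto simp: abs_mult intro!: mult_left_mono abs_phi_le)
  also have "\<dots> = sqrt 2 * (\<Sum>j<n. \<bar>a (Suc j)\<bar>)" by (simp add: sum_distrib_left mult_ac)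
  also have "\<dots> \<le> sqrt 2 * (\<Sum>j. \<bar>a (Suc j)\<bar>)"
    using assms by (intro mult_left_mono sum_le_suminf) (auto simp: abs_summable_coeffs_def)
  finally show ?thesis .
qed

lemma summable_log_series:
  assumes "abs_summable_coeffs a"
  shows "summable (\<lambda>j. a (Suc j) * phi (Suc j) x)"
proof (rule summable_comparison_test')
  show "summable (\<lambda>j. sqrt 2 * \<bar>a (Suc j)\<bar>)"
    using assms by (intro summable_mult) (simp add: abs_summable_coeffs_def)
  show "norm (a (Suc j) * phi (Suc j) x) \<le> sqrt 2 * \<bar>a (Suc j)\<bar>" for j
    using mult_left_mono[OF abs_phi_le[of "Suc j" x], of "\<bar>a (Suc j)\<bar>"] by (simp add: abs_mult mult_ac)
qed

lemma partial_series_tendsto: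
  assumes "abs_summable_coeffs a"
  shows "(\<lambda>n. partial_series a n x) \<longlonglongrightarrow> log_series a x"
  unfolding partial_series_def log_series_def
  using summable_LIMSEQ[OF summable_log_series[OF assms]] .

lemma abs_log_series_le:
  assumes "abs_summable_coeffs a"
  shows "\<bar>log_series a x\<bar> \<le> sqrt 2 * (\<Sum>j. \<bar>a (Suc j)\<bar>)"
  by (rule LIMSEQ_le_const2[OF tendsto_rabs[OF partial_series_tendsto[OF assms]]])
     (auto intro: abs_partial_series_le assms)

lemma abs_summable_coeffs_diff:
  assumes "abs_summable_coeffs a" "abs_summable_coeffs b"
  shows "abs_summable_coeffs (\<lambda>j. a j - b j)"
  unfolding abs_summable_coeffs_def
  using summable_add[OF assms[unfolded abs_summable_coeffs_def]]
  by (rule summable_comparison_test') (simp add: abs_triangle_ineq4)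

lemma log_series_diff:
  assumes "abs_summable_coeffs a" "abs_summable_coeffs b"
  shows "log_series (\<lambda>j. a j - b j) x = log_series a x - log_series b x"
  unfolding log_series_def
  by (subst suminf_diff) (auto simp: summable_log_series assms algebra_simps)

lemma summable_sq_coeffs:
  assumes "abs_summable_coeffs a"
  shows "summable (\<lambda>j. (a (Suc j))\<^sup>2)"
proof -
  have "(\<lambda>j. \<bar>a (Suc j)\<bar>) \<longlonglongrightarrow> 0"
    using assms summable_LIMSEQ_zero by (auto simp: abs_summable_coeffs_def)
  then have "\<forall>\<^sub>F j in sequentially. \<bar>a (Suc j)\<bar> < 1"
    by (rule order_tendstoD) simp
  then have "\<forall>\<^sub>F j in sequentially. norm ((a (Suc j))\<^sup>2) \<le> \<bar>a (Suc j)\<bar>"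
  proof eventually_elim
    case (elim j)
    then have "\<bar>a (Suc j)\<bar> * \<bar>a (Suc j)\<bar> \<le> \<bar>a (Suc j)\<bar> * 1" by (intro mult_left_mono) auto
    then show ?case by (simp add: power2_eq_square abs_mult)
  qed
  then show ?thesis
    by (rule summable_comparison_test_ev) (rule assms[unfolded abs_summable_coeffs_def])
qed

lemma integral_partial_series_sq:
  "(\<integral>x. (partial_series a n x)\<^sup>2 \<partial>leb01) = (\<Sum>j<n. (a (Suc j))\<^sup>2)"
proof -
  have int: "integrable leb01 (\<lambda>x. (a (Suc i) * a (Suc j)) * (phi (Suc i) x * phi (Suc j) x))" for i j
    by (intro integrable_mult_right integrable_leb01_bounded[where C = "sqrt 2 * sqrt 2"])
       (auto simp: abs_mult intro!: mult_mono abs_phi_le simp del: real_sqrt_mult_self)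
  have interchange: "(a * x) * (b * y) = (a * b) * (x * y)" for a b x y :: real
    by (simp only: mult.assoc mult.left_commute)
  have "(partial_series a n x)\<^sup>2 = (\<Sum>i<n. \<Sum>j<n. (a (Suc i) * a (Suc j)) * (phi (Suc i) x * phi (Suc j) x))" for x
    unfolding partial_series_def power2_eq_square sum_product
    by (simp only: interchange)
  then have "(\<integral>x. (partial_series a n x)\<^sup>2 \<partial>leb01)
      = (\<integral>x. (\<Sum>i<n. \<Sum>j<n. (a (Suc i) * a (Suc j)) * (phi (Suc i) x * phi (Suc j) x)) \<partial>leb01)" by simp
  also have "\<dots> = (\<Sum>i<n. \<Sum>j<n. (a (Suc i) * a (Suc j)) * (\<integral>x. phi (Suc i) x * phi (Suc j) x \<partial>leb01))"
    using int by (simp only: Bochner_Integration.integral_sum Bochner_Integration.integrable_sum integral_mult_right_zero)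
  also have "\<dots> = (\<Sum>i<n. a (Suc i) * a (Suc i))"
    by (intro sum.cong) (auto simp: phi_orthonormal if_distrib[of "\<lambda>z. _ * z"] cong: if_cong)
  finally show ?thesis by (simp add: power2_eq_square)
qed

lemma integral_partial_series: "(\<integral>x. partial_series a n x \<partial>leb01) = 0"
proof -
  have int: "integrable leb01 (\<lambda>x. a (Suc j) * phi (Suc j) x)" for j
    by (intro integrable_mult_right integrable_leb01_bounded[where C = "sqrt 2"] abs_phi_le) auto
  show ?thesis
    unfolding partial_series_def using int
    by (simp only: Bochner_Integration.integral_sum integral_mult_right_zero integral_phi) simp
qed

text \<open>Absolute summability of the coefficients bounds the partial sums uniformly, so Parseval's identity
  for the infinite series follows from the finite one by dominated convergence.\<close>

lemma parseval_log_series: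
  assumes "abs_summable_coeffs a"
  shows "(\<integral>x. (log_series a x)\<^sup>2 \<partial>leb01) = (\<Sum>j. (a (Suc j))\<^sup>2)"
proof (rule LIMSEQ_unique)
  let ?S = "sqrt 2 * (\<Sum>j. \<bar>a (Suc j)\<bar>)"
  show "(\<lambda>n. \<integral>x. (partial_series a n x)\<^sup>2 \<partial>leb01) \<longlonglongrightarrow> (\<integral>x. (log_series a x)\<^sup>2 \<partial>leb01)"
  proof (rule integral_dominated_convergence[where w = "\<lambda>_. ?S\<^sup>2"])
    show "AE x in leb01. (\<lambda>n. (partial_series a n x)\<^sup>2) \<longlonglongrightarrow> (log_series a x)\<^sup>2"
      using partial_series_tendsto[OF assms] by (auto intro!: AE_I2 tendsto_power)
    show "AE x in leb01. norm ((partial_series a n x)\<^sup>2) \<le> ?S\<^sup>2" for n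
      using abs_le_square_iff[THEN iffD1, OF order_trans[OF abs_partial_series_le[OF assms] abs_ge_self]]
      by (intro AE_I2) simp
  qed auto
  show "(\<lambda>n. \<integral>x. (partial_series a n x)\<^sup>2 \<partial>leb01) \<longlonglongrightarrow> (\<Sum>j. (a (Suc j))\<^sup>2)"
    unfolding integral_partial_series_sq by (rule summable_LIMSEQ[OF summable_sq_coeffs[OF assms]])
qed

lemma integral_log_series:
  assumes "abs_summable_coeffs a"
  shows "(\<integral>x. log_series a x \<partial>leb01) = 0"
proof -
  have "(\<lambda>n. \<integral>x. partial_series a n x \<partial>leb01) \<longlonglongrightarrow> (\<integral>x. log_series a x \<partial>leb01)"
  proof (rule integral_dominated_convergence[where w = "\<lambda>_. sqrt 2 * (\<Sum>j. \<bar>a (Suc j)\<bar>)"])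
    show "AE x in leb01. (\<lambda>n. partial_series a n x) \<longlonglongrightarrow> log_series a x"
      using partial_series_tendsto[OF assms] by auto
    show "AE x in leb01. norm (partial_series a n x) \<le> sqrt 2 * (\<Sum>j. \<bar>a (Suc j)\<bar>)" for n
      using abs_partial_series_le[OF assms] by (intro AE_I2) simp
  qed auto
  then show ?thesis by (simp add: integral_partial_series LIMSEQ_const_iff)
qed

text \<open>With \<open>b\<^sub>j\<close> the coefficients of \<open>F\<close> and \<open>w = \<Sum> b\<^sub>j \<phi>\<^sub>j\<close>, the sum of the \<open>b\<^sub>j\<^sup>2\<close> is the integral
  of \<open>w F \<le> (w\<^sup>2 + F\<^sup>2) / 2\<close>, and the integral of \<open>w\<^sup>2\<close> is that same sum.\<close>

lemma bessel:
  assumes [measurable]: "F \<in> borel_measurable borel" and F: "\<And>x. \<bar>F x\<bar> \<le> C"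
  shows "(\<Sum>j<n. (\<integral>x. phi (Suc j) x * F x \<partial>leb01)\<^sup>2) \<le> (\<integral>x. (F x)\<^sup>2 \<partial>leb01)"
proof -
  define b where "b j = (\<integral>x. phi j x * F x \<partial>leb01)" for j
  have C: "C \<ge> 0" using F[of 0] by linarith
  have iphi: "integrable leb01 (\<lambda>x. b (Suc j) * (phi (Suc j) x * F x))" for j
    using C by (intro integrable_mult_right integrable_leb01_bounded[where C = "sqrt 2 * C"])
       (auto simp: abs_mult intro!: mult_mono abs_phi_le F)
  define K where "K = (\<Sum>j<n. \<bar>b (Suc j)\<bar> * sqrt 2)"
  have K: "\<bar>partial_series b n x\<bar> \<le> K" for x
    unfolding partial_series_def K_def
    by (rule order_trans[OF sum_abs sum_mono]) (auto simp: abs_mult intro!: mult_left_mono abs_phi_le)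
  have i1: "integrable leb01 (\<lambda>x. (partial_series b n x)\<^sup>2)"
    using K by (intro integrable_leb01_bounded_sq) auto
  have i2: "integrable leb01 (\<lambda>x. (F x)\<^sup>2)"
    using F by (intro integrable_leb01_bounded_sq) auto
  have "(\<Sum>j<n. (b (Suc j))\<^sup>2) = (\<Sum>j<n. b (Suc j) * (\<integral>x. phi (Suc j) x * F x \<partial>leb01))"
    by (simp add: b_def power2_eq_square)
  also have "\<dots> = (\<integral>x. (\<Sum>j<n. b (Suc j) * (phi (Suc j) x * F x)) \<partial>leb01)"
    using iphi by (simp only: Bochner_Integration.integral_sum integral_mult_right_zero)
  also have "\<dots> \<le> (\<integral>x. ((partial_series b n x)\<^sup>2 + (F x)\<^sup>2) / 2 \<partial>leb01)"
  proof (rule integral_mono)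
    show "(\<Sum>j<n. b (Suc j) * (phi (Suc j) x * F x)) \<le> ((partial_series b n x)\<^sup>2 + (F x)\<^sup>2) / 2" for x
    proof -
      have "(\<Sum>j<n. b (Suc j) * (phi (Suc j) x * F x)) = partial_series b n x * F x"
        by (simp add: partial_series_def sum_distrib_right mult.assoc)
      then show ?thesis using sum_squares_bound[of "partial_series b n x" "F x"] by simp
    qed
  qed (intro Bochner_Integration.integrable_sum iphi integrable_divide Bochner_Integration.integrable_add i1 i2)+
  also have "\<dots> = ((\<Sum>j<n. (b (Suc j))\<^sup>2) + (\<integral>x. (F x)\<^sup>2 \<partial>leb01)) / 2"
    using i1 i2 by (simp add: integral_partial_series_sq)
  finally show ?thesis by (simp add: b_def)
qed

section \<open>Second-order bounds for cumulants\<close>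

lemma exp_taylor_bounds:
  fixes x b :: real
  assumes "\<bar>x\<bar> \<le> b"
  shows "1 + x + exp (- b) / 2 * x\<^sup>2 \<le> exp x" "exp x \<le> 1 + x + exp b / 2 * x\<^sup>2"
proof -
  obtain t where t: "\<bar>t\<bar> \<le> \<bar>x\<bar>" "exp x = (\<Sum>m<2. x ^ m / fact m) + exp t / fact 2 * x ^ 2"
    using Maclaurin_exp_le by blast
  then have e: "exp x = 1 + x + exp t / 2 * x\<^sup>2" by (simp add: numeral_2_eq_2)
  show "1 + x + exp (- b) / 2 * x\<^sup>2 \<le> exp x" unfolding e
    using t(1) assms by (intro add_left_mono mult_right_mono divide_right_mono) auto
  show "exp x \<le> 1 + x + exp b / 2 * x\<^sup>2" unfolding e
    using t(1) assms by (intro add_left_mono mult_right_mono divide_right_mono) auto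
qed

lemma abs_exp_diff_le:
  fixes u v c :: real
  assumes "u \<le> c" "v \<le> c"
  shows "\<bar>exp u - exp v\<bar> \<le> exp c * \<bar>u - v\<bar>"
proof -
  have *: "exp s - exp t \<le> exp c * (s - t)" if "t \<le> s" "s \<le> c" for s t :: real
  proof -
    have "exp s - exp t = exp s * (1 - exp (t - s))" by (simp add: exp_diff right_diff_distrib)
    also have "\<dots> \<le> exp s * (s - t)"
    proof (rule mult_left_mono)
      show "1 - exp (t - s) \<le> s - t"
        using exp_ge_add_one_self[of "t - s"] by linarith
    qed simp
    also have "\<dots> \<le> exp c * (s - t)" using that by (intro mult_right_mono) auto
    finally show ?thesis .
  qed
  show ?thesis using *[of v u] *[of u v] assms by (cases "v \<le> u") auto
qed

context prob_space
begin

lemma centered_exp_moment_bounds: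
  fixes h :: "'a \<Rightarrow> real"
  assumes [measurable]: "h \<in> borel_measurable M"
    and b: "\<And>x. \<bar>h x - m\<bar> \<le> b" and m: "expectation h = m"
  shows "expectation (\<lambda>x. exp (h x - m)) \<le> 1 + exp b / 2 * expectation (\<lambda>x. (h x - m)\<^sup>2)"
    and "expectation (\<lambda>x. exp (h x - m)) \<ge> 1 + exp (- b) / 2 * expectation (\<lambda>x. (h x - m)\<^sup>2)"
    and "expectation (\<lambda>x. (h x - m)\<^sup>2) \<le> b\<^sup>2"
proof -
  have b0: "0 \<le> b" using b order_trans[OF abs_ge_zero] by blast
  have sq: "(h x - m)\<^sup>2 \<le> b\<^sup>2" for x
    using b[of x] b0 by (simp add: abs_le_square_iff[symmetric])
  have i1: "integrable M (\<lambda>x. h x - m)"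
    using b by (intro integrable_const_bound[where B = b]) auto
  have "integrable M (\<lambda>x. (h x - m) + m)"
    by (intro Bochner_Integration.integrable_add i1 integrable_const)
  then have ih: "integrable M h" by simp
  have c: "expectation (\<lambda>x. h x - m) = 0"
    using ih m prob_space by simp
  have i2: "integrable M (\<lambda>x. (h x - m)\<^sup>2)"
    using sq by (intro integrable_const_bound[where B = "b\<^sup>2"]) auto
  have ie: "integrable M (\<lambda>x. exp (h x - m))"
    using b abs_ge_self order_trans by (intro integrable_const_bound[where B = "exp b"]) (auto, blast)
  have poly: "integrable M (\<lambda>x. 1 + (h x - m) + k * (h x - m)\<^sup>2)"
    "expectation (\<lambda>x. 1 + (h x - m) + k * (h x - m)\<^sup>2) = 1 + k * expectation (\<lambda>x. (h x - m)\<^sup>2)" for k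
    using i1 i2 c prob_space by (simp_all del: Bochner_Integration.integral_diff)
  show "expectation (\<lambda>x. exp (h x - m)) \<le> 1 + exp b / 2 * expectation (\<lambda>x. (h x - m)\<^sup>2)"
    unfolding poly(2)[symmetric] by (intro integral_mono ie poly(1) exp_taylor_bounds b)
  show "expectation (\<lambda>x. exp (h x - m)) \<ge> 1 + exp (- b) / 2 * expectation (\<lambda>x. (h x - m)\<^sup>2)"
    unfolding poly(2)[symmetric] by (intro integral_mono ie poly(1) exp_taylor_bounds b)
  have "expectation (\<lambda>x. (h x - m)\<^sup>2) \<le> expectation (\<lambda>x. b\<^sup>2)"
    by (intro integral_mono i2 sq) simp
  then show "expectation (\<lambda>x. (h x - m)\<^sup>2) \<le> b\<^sup>2" using prob_space by simp
qed

text \<open>For a bounded variable the logarithm of the moment generating function exceeds the mean by an amount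
  comparable to the variance. Applied to a log-density ratio, this compares relative entropy with a
  squared \<open>L\<^sup>2\<close> distance.\<close>

lemma cumulant_bounds:
  fixes h :: "'a \<Rightarrow> real"
  assumes [measurable]: "h \<in> borel_measurable M"
    and b: "\<And>x. \<bar>h x - m\<bar> \<le> b" and m: "expectation h = m"
  shows "ln (expectation (\<lambda>x. exp (h x))) - m \<le> exp b / 2 * expectation (\<lambda>x. (h x - m)\<^sup>2)"
    and "ln (expectation (\<lambda>x. exp (h x))) - m
           \<ge> exp (- b) / (2 + b\<^sup>2) * expectation (\<lambda>x. (h x - m)\<^sup>2)"
proof -
  define V where "V = expectation (\<lambda>x. (h x - m)\<^sup>2)"
  define E where "E = expectation (\<lambda>x. exp (h x - m))"
  note bd = centered_exp_moment_bounds[OF assms, folded V_def E_def]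
  have b0: "0 \<le> b" using b order_trans[OF abs_ge_zero] by blast
  have V0: "V \<ge> 0" unfolding V_def by simp
  have E1: "E \<ge> 1"
    using bd(2) mult_nonneg_nonneg[OF _ V0, of "exp (- b) / 2"] by simp
  have "expectation (\<lambda>x. exp (h x)) = expectation (\<lambda>x. exp m * exp (h x - m))"
    by (simp add: exp_add[symmetric])
  also have "\<dots> = exp m * E" unfolding E_def by (rule integral_mult_right_zero)
  finally have ln_eq: "ln (expectation (\<lambda>x. exp (h x))) - m = ln E"
    using E1 by (simp add: ln_mult)
  show "ln (expectation (\<lambda>x. exp (h x))) - m \<le> exp b / 2 * V"
    using ln_le_minus_one[of E] E1 bd(1) unfolding ln_eq by linarith
  define y where "y = exp (- b) / 2 * V"
  have y0: "y \<ge> 0" and yb: "y \<le> b\<^sup>2 / 2"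
  proof -
    show "y \<ge> 0" using V0 by (simp add: y_def)
    have "y \<le> 1 / 2 * b\<^sup>2" unfolding y_def using bd(3) V0 b0 by (intro mult_mono) auto
    then show "y \<le> b\<^sup>2 / 2" by simp
  qed
  \<comment> \<open>The elementary inequality \<open>ln (1 + y) \<ge> y / (1 + y)\<close>.\<close>
  have "- ln (1 + y) \<le> 1 / (1 + y) - 1"
    using ln_le_minus_one[of "1 / (1 + y)"] y0 by (simp add: ln_div)
  then have "y / (1 + y) \<le> ln (1 + y)" using y0 by (simp add: field_simps)
  moreover have "y / (1 + b\<^sup>2 / 2) \<le> y / (1 + y)"
    using y0 yb by (intro divide_left_mono mult_pos_pos add_pos_nonneg) auto
  moreover have "exp (- b) / (2 + b\<^sup>2) * V = y / (1 + b\<^sup>2 / 2)"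
  proof -
    have "1 + b\<^sup>2 / 2 = (2 + b\<^sup>2) / 2" by (simp add: field_simps)
    then show ?thesis unfolding y_def by (simp only:) simp
  qed
  moreover have "ln (1 + y) \<le> ln E" using bd(2) y0 by (simp add: y_def)
  ultimately show "ln (expectation (\<lambda>x. exp (h x))) - m \<ge> exp (- b) / (2 + b\<^sup>2) * V"
    unfolding ln_eq by linarith
qed

end

section \<open>The log-density model\<close>

text \<open>A uniform bound \<open>B\<close> on an absolutely convergent exponent is the only property of the Sobolev ellipsoid that the
  estimates for a fixed pair of parameters rely on.\<close>

definition bounded_exponent :: "real \<Rightarrow> (nat \<Rightarrow> real) \<Rightarrow> bool" where
  "bounded_exponent B \<theta> \<longleftrightarrow> abs_summable_coeffs \<theta> \<and> (\<forall>x. \<bar>log_series \<theta> x\<bar> \<le> B)"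

definition log_partition :: "(nat \<Rightarrow> real) \<Rightarrow> real" where
  "log_partition \<theta> = ln (\<integral>t. exp (log_series \<theta> t) \<partial>leb01)"

lemma dens_borel [measurable]: "dens \<theta> \<in> borel_measurable borel"
  unfolding dens_def[abs_def] by measurable

lemma integrable_exp_log_series:
  assumes "bounded_exponent B \<theta>"
  shows "integrable leb01 (\<lambda>x. exp (log_series \<theta> x))"
  using assms by (intro integrable_leb01_bounded[where C = "exp B"]) (auto simp: bounded_exponent_def abs_le_iff)

lemma partition_bounds:
  assumes "bounded_exponent B \<theta>"
  shows "exp (- B) \<le> (\<integral>t. exp (log_series \<theta> t) \<partial>leb01)" "(\<integral>t. exp (log_series \<theta> t) \<partial>leb01) \<le> exp B"
proof -
  have b: "- B \<le> log_series \<theta> x" "log_series \<theta> x \<le> B" for x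
    using assms by (auto simp: bounded_exponent_def abs_le_iff minus_le_iff)
  have "(\<integral>t. exp (- B) \<partial>leb01) \<le> (\<integral>t. exp (log_series \<theta> t) \<partial>leb01)"
    by (intro integral_mono integrable_exp_log_series[OF assms]) (auto simp: b)
  then show "exp (- B) \<le> (\<integral>t. exp (log_series \<theta> t) \<partial>leb01)" using leb01.prob_space by simp
  have "(\<integral>t. exp (log_series \<theta> t) \<partial>leb01) \<le> (\<integral>t. exp B \<partial>leb01)"
    by (intro integral_mono integrable_exp_log_series[OF assms]) (auto simp: b)
  then show "(\<integral>t. exp (log_series \<theta> t) \<partial>leb01) \<le> exp B" using leb01.prob_space by simp
qed

lemma partition_pos:
  assumes "bounded_exponent B \<theta>"
  shows "0 < (\<integral>t. exp (log_series \<theta> t) \<partial>leb01)"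
  by (rule less_le_trans[OF exp_gt_zero partition_bounds(1)[OF assms]])

lemma dens_eq_exp:
  assumes "bounded_exponent B \<theta>"
  shows "dens \<theta> x = exp (log_series \<theta> x - log_partition \<theta>)"
  using partition_pos[OF assms] by (simp add: dens_def log_partition_def exp_diff)

lemma abs_log_partition_le:
  assumes "bounded_exponent B \<theta>"
  shows "\<bar>log_partition \<theta>\<bar> \<le> B"
  using partition_bounds[OF assms] partition_pos[OF assms]
  unfolding log_partition_def abs_le_iff
  by (metis ln_ge_iff ln_le_cancel_iff exp_gt_zero ln_exp minus_le_iff)

lemma abs_log_dens_le:
  assumes "bounded_exponent B \<theta>"
  shows "\<bar>log_series \<theta> x - log_partition \<theta>\<bar> \<le> 2 * B"
  using abs_log_partition_le[OF assms] assms
  by (auto simp: bounded_exponent_def intro: order_trans[OF abs_triangle_ineq4 add_mono, of _ B _ B, simplified])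

lemma dens_bounds:
  assumes "bounded_exponent B \<theta>"
  shows "exp (- (2 * B)) \<le> dens \<theta> x" "dens \<theta> x \<le> exp (2 * B)"
  using abs_log_dens_le[OF assms, of x] unfolding dens_eq_exp[OF assms] by (auto simp: abs_le_iff)

lemma dens_pos: "bounded_exponent B \<theta> \<Longrightarrow> 0 < dens \<theta> x"
  by (simp add: dens_eq_exp)

lemma integrable_dens: "bounded_exponent B \<theta> \<Longrightarrow> integrable leb01 (dens \<theta>)"
  by (intro integrable_leb01_bounded[where C = "exp (2 * B)"])
     (auto simp: dens_bounds less_imp_le[OF dens_pos])

lemma integral_dens:
  assumes "bounded_exponent B \<theta>"
  shows "(\<integral>x. dens \<theta> x \<partial>leb01) = 1"
  using partition_pos[OF assms] unfolding dens_def by simp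

lemma sets_Ptheta [measurable_cong]: "sets (Ptheta \<theta>) = sets leb01"
  by (simp add: Ptheta_def)

lemma borel_measurable_Ptheta [measurable (raw)]:
  "f \<in> borel_measurable borel \<Longrightarrow> f \<in> borel_measurable (Ptheta \<theta>)"
  by measurable

lemma prob_space_Ptheta:
  assumes "bounded_exponent B \<theta>"
  shows "prob_space (Ptheta \<theta>)"
proof
  have "emeasure (Ptheta \<theta>) (space (Ptheta \<theta>)) = (\<integral>\<^sup>+x. ennreal (dens \<theta> x) \<partial>leb01)"
    unfolding Ptheta_def by (simp add: emeasure_density cong: nn_integral_cong)
  also have "\<dots> = ennreal (\<integral>x. dens \<theta> x \<partial>leb01)"
    using integrable_dens[OF assms] less_imp_le[OF dens_pos[OF assms]]
    by (intro nn_integral_eq_integral) auto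
  finally show "emeasure (Ptheta \<theta>) (space (Ptheta \<theta>)) = 1" by (simp add: integral_dens[OF assms])
qed

lemma integral_Ptheta:
  fixes g :: "real \<Rightarrow> real"
  assumes "bounded_exponent B \<theta>" "g \<in> borel_measurable borel"
  shows "(\<integral>x. g x \<partial>Ptheta \<theta>) = (\<integral>x. dens \<theta> x * g x \<partial>leb01)"
  unfolding Ptheta_def using assms less_imp_le[OF dens_pos[OF assms(1)]]
  by (subst integral_density) auto

lemma integral_Ptheta_bounds:
  fixes g :: "real \<Rightarrow> real"
  assumes \<theta>: "bounded_exponent B \<theta>" and [measurable]: "g \<in> borel_measurable borel"
    and g: "\<And>x. 0 \<le> g x" "\<And>x. g x \<le> C"
  shows "exp (- (2 * B)) * (\<integral>x. g x \<partial>leb01) \<le> (\<integral>x. g x \<partial>Ptheta \<theta>)"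
    and "(\<integral>x. g x \<partial>Ptheta \<theta>) \<le> exp (2 * B) * (\<integral>x. g x \<partial>leb01)"
proof -
  have ig: "integrable leb01 g"
    using g by (intro integrable_leb01_bounded[where C = C]) auto
  have idg: "integrable leb01 (\<lambda>x. dens \<theta> x * g x)"
    using g dens_bounds[OF \<theta>] less_imp_le[OF dens_pos[OF \<theta>]]
    by (intro integrable_leb01_bounded[where C = "exp (2 * B) * C"]) (auto intro!: mult_mono simp: abs_mult)
  have "exp (- (2 * B)) * (\<integral>x. g x \<partial>leb01) = (\<integral>x. exp (- (2 * B)) * g x \<partial>leb01)" by simp
  also have "\<dots> \<le> (\<integral>x. dens \<theta> x * g x \<partial>leb01)"
    using ig idg g dens_bounds[OF \<theta>] by (intro integral_mono) (auto intro!: mult_right_mono)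
  finally show "exp (- (2 * B)) * (\<integral>x. g x \<partial>leb01) \<le> (\<integral>x. g x \<partial>Ptheta \<theta>)"
    using \<theta> by (simp add: integral_Ptheta)
  have "(\<integral>x. dens \<theta> x * g x \<partial>leb01) \<le> (\<integral>x. exp (2 * B) * g x \<partial>leb01)"
    using ig idg g dens_bounds[OF \<theta>] by (intro integral_mono) (auto intro!: mult_right_mono)
  then show "(\<integral>x. g x \<partial>Ptheta \<theta>) \<le> exp (2 * B) * (\<integral>x. g x \<partial>leb01)"
    using \<theta> by (simp add: integral_Ptheta)
qed

lemma log_partition_diff:
  assumes \<theta>: "bounded_exponent B \<theta>" and \<eta>: "bounded_exponent B \<eta>"
  shows "log_partition \<theta> - log_partition \<eta> = ln (\<integral>x. exp (log_series \<theta> x - log_series \<eta> x) \<partial>Ptheta \<eta>)"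
proof -
  have "(\<integral>x. exp (log_series \<theta> x - log_series \<eta> x) \<partial>Ptheta \<eta>)
      = (\<integral>x. dens \<eta> x * exp (log_series \<theta> x - log_series \<eta> x) \<partial>leb01)"
    by (rule integral_Ptheta[OF \<eta>]) measurable
  also have "\<dots> = (\<integral>x. exp (log_series \<theta> x) / exp (log_partition \<eta>) \<partial>leb01)"
    by (intro Bochner_Integration.integral_cong refl) (simp add: dens_eq_exp[OF \<eta>] exp_diff)
  also have "\<dots> = exp (log_partition \<theta>) / exp (log_partition \<eta>)"
    using partition_pos[OF \<theta>] by (simp add: log_partition_def)
  finally show ?thesis by (simp add: exp_diff[symmetric])
qed

text \<open>The Kullback--Leibler divergence of the density at \<open>\<theta>\<close> from the one at \<open>\<eta>\<close>, the expectation under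
  \<open>\<eta>\<close> of the log-density ratio, written through the log-partition function.\<close>

definition rel_entropy :: "(nat \<Rightarrow> real) \<Rightarrow> (nat \<Rightarrow> real) \<Rightarrow> real" where
  "rel_entropy \<eta> \<theta> = log_partition \<theta> - log_partition \<eta> - (\<integral>x. log_series \<theta> x - log_series \<eta> x \<partial>Ptheta \<eta>)"

lemma abs_log_series_diff_le:
  assumes "bounded_exponent B \<theta>" "bounded_exponent B \<eta>"
  shows "\<bar>log_series \<theta> x - log_series \<eta> x\<bar> \<le> 2 * B"
  using assms by (auto simp: bounded_exponent_def intro: order_trans[OF abs_triangle_ineq4 add_mono, of _ B _ B, simplified])

lemma bounded_exponent_nonneg: "bounded_exponent B \<theta> \<Longrightarrow> 0 \<le> B"
  unfolding bounded_exponent_def using order_trans[OF abs_ge_zero] by blast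

definition coeff_dist_sq :: "(nat \<Rightarrow> real) \<Rightarrow> (nat \<Rightarrow> real) \<Rightarrow> real" where
  "coeff_dist_sq \<theta> \<eta> = (\<Sum>j. (\<theta> (Suc j) - \<eta> (Suc j))\<^sup>2)"

lemma integral_log_series_diff:
  assumes "bounded_exponent B \<theta>" "bounded_exponent B \<eta>"
  shows "(\<integral>x. (log_series \<theta> x - log_series \<eta> x)\<^sup>2 \<partial>leb01) = coeff_dist_sq \<theta> \<eta>"
    and "(\<integral>x. log_series \<theta> x - log_series \<eta> x \<partial>leb01) = 0"
proof -
  have s: "abs_summable_coeffs \<theta>" "abs_summable_coeffs \<eta>"
    using assms by (auto simp: bounded_exponent_def)
  note d = abs_summable_coeffs_diff[OF s]
  show "(\<integral>x. (log_series \<theta> x - log_series \<eta> x)\<^sup>2 \<partial>leb01) = coeff_dist_sq \<theta> \<eta>"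
    using parseval_log_series[OF d] by (simp add: log_series_diff[OF s] coeff_dist_sq_def)
  show "(\<integral>x. log_series \<theta> x - log_series \<eta> x \<partial>leb01) = 0"
    using integral_log_series[OF d] by (simp add: log_series_diff[OF s])
qed

lemma coeff_dist_sq_nonneg:
  assumes "bounded_exponent B \<theta>" "bounded_exponent B \<eta>"
  shows "0 \<le> coeff_dist_sq \<theta> \<eta>"
  unfolding integral_log_series_diff(1)[OF assms, symmetric] by simp

text \<open>The relative entropy is a cumulant of \<open>h = log_series \<theta> - log_series \<eta>\<close> under \<open>P\<^sub>\<eta>\<close>, hence
  comparable to the variance of \<open>h\<close>. That variance is comparable to the integral of \<open>h\<^sup>2\<close> over the unit
  interval because the density at \<open>\<eta>\<close> is bounded away from zero and infinity, and because \<open>h\<close> is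
  orthogonal to constants: centring it can only increase the Lebesgue integral of its square.\<close>

lemma rel_entropy_bounds:
  assumes \<theta>: "bounded_exponent B \<theta>" and \<eta>: "bounded_exponent B \<eta>"
  shows "rel_entropy \<eta> \<theta> \<ge> exp (- (6 * B)) / (2 + (4 * B)\<^sup>2) * coeff_dist_sq \<theta> \<eta>"
    and "rel_entropy \<eta> \<theta> \<le> exp (6 * B) / 2 * coeff_dist_sq \<theta> \<eta>"
proof -
  interpret P: prob_space "Ptheta \<eta>" by (rule prob_space_Ptheta[OF \<eta>])
  define h where "h x = log_series \<theta> x - log_series \<eta> x" for x
  define m where "m = (\<integral>x. h x \<partial>Ptheta \<eta>)"
  have [measurable]: "h \<in> borel_measurable borel" unfolding h_def[abs_def] by measurable
  have h2: "\<bar>h x\<bar> \<le> 2 * B" for x unfolding h_def by (rule abs_log_series_diff_le[OF \<theta> \<eta>])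
  have ih: "integrable (Ptheta \<eta>) h"
    using h2 by (intro P.integrable_const_bound[where B = "2 * B"]) auto
  have "\<bar>m\<bar> \<le> (\<integral>x. 2 * B \<partial>Ptheta \<eta>)"
    unfolding m_def using ih h2 by (intro integral_abs_bound[THEN order_trans] integral_mono) auto
  then have m2: "\<bar>m\<bar> \<le> 2 * B" using P.prob_space by simp
  have hm: "\<bar>h x - m\<bar> \<le> 4 * B" for x using h2[of x] m2 by linarith
  have B0: "B \<ge> 0" by (rule bounded_exponent_nonneg[OF \<theta>])
  define V where "V = (\<integral>x. (h x - m)\<^sup>2 \<partial>Ptheta \<eta>)"
  have ih01: "integrable leb01 h" "integrable leb01 (\<lambda>x. (h x)\<^sup>2)"
    using h2
    by (auto intro!: integrable_leb01_bounded[where C = "2 * B"] integrable_leb01_bounded_sq[where C = "2 * B"])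
  have bd: "rel_entropy \<eta> \<theta> \<le> exp (4 * B) / 2 * V"
    "rel_entropy \<eta> \<theta> \<ge> exp (- (4 * B)) / (2 + (4 * B)\<^sup>2) * V"
    unfolding rel_entropy_def log_partition_diff[OF \<theta> \<eta>] V_def h_def[symmetric] m_def[symmetric]
    by (rule P.cumulant_bounds[OF _ hm]; simp add: m_def)+
  have sqb: "(h x - m)\<^sup>2 \<le> (4 * B)\<^sup>2" "(h x)\<^sup>2 \<le> (2 * B)\<^sup>2" for x
    using power_mono[OF hm abs_ge_zero, of _ 2] power_mono[OF h2 abs_ge_zero, of _ 2] by simp_all
  have var: "(\<integral>x. (h x - m)\<^sup>2 \<partial>leb01) = coeff_dist_sq \<theta> \<eta> + m\<^sup>2"
  proof -
    have "(\<integral>x. (h x - m)\<^sup>2 \<partial>leb01) = (\<integral>x. (h x)\<^sup>2 - 2 * m * h x + m\<^sup>2 \<partial>leb01)"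
      by (simp add: power2_diff algebra_simps)
    also have "\<dots> = (\<integral>x. (h x)\<^sup>2 \<partial>leb01) - 2 * m * (\<integral>x. h x \<partial>leb01) + m\<^sup>2"
      using ih01 leb01.prob_space by simp
    finally show ?thesis
      using integral_log_series_diff[OF \<theta> \<eta>] unfolding h_def[symmetric] by simp
  qed
  have "exp (- (2 * B)) * coeff_dist_sq \<theta> \<eta> \<le> exp (- (2 * B)) * (\<integral>x. (h x - m)\<^sup>2 \<partial>leb01)"
    unfolding var by (intro mult_left_mono) auto
  also have "\<dots> \<le> V"
    unfolding V_def by (rule integral_Ptheta_bounds[OF \<eta> _ _ sqb(1)]) auto
  finally have V1: "exp (- (2 * B)) * coeff_dist_sq \<theta> \<eta> \<le> V" .
  have "exp (- (6 * B)) / (2 + (4 * B)\<^sup>2) * coeff_dist_sq \<theta> \<eta>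
      = exp (- (4 * B)) / (2 + (4 * B)\<^sup>2) * (exp (- (2 * B)) * coeff_dist_sq \<theta> \<eta>)"
    by (simp add: exp_add[symmetric])
  also have "\<dots> \<le> exp (- (4 * B)) / (2 + (4 * B)\<^sup>2) * V"
    using V1 by (intro mult_left_mono) auto
  finally show "rel_entropy \<eta> \<theta> \<ge> exp (- (6 * B)) / (2 + (4 * B)\<^sup>2) * coeff_dist_sq \<theta> \<eta>"
    using bd(2) by linarith
  have "V = (\<integral>x. (h x)\<^sup>2 \<partial>Ptheta \<eta>) - m\<^sup>2"
  proof -
    have i2: "integrable (Ptheta \<eta>) (\<lambda>x. (h x)\<^sup>2)"
      using sqb(2) by (intro P.integrable_const_bound[where B = "(2 * B)\<^sup>2"]) auto
    have "V = (\<integral>x. (h x)\<^sup>2 - 2 * m * h x + m\<^sup>2 \<partial>Ptheta \<eta>)"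
      unfolding V_def by (simp add: power2_diff algebra_simps)
    also have "\<dots> = (\<integral>x. (h x)\<^sup>2 \<partial>Ptheta \<eta>) - 2 * m * m + m\<^sup>2"
      using i2 ih P.prob_space by (simp add: m_def)
    finally show ?thesis by (simp add: power2_eq_square)
  qed
  also have "\<dots> \<le> (\<integral>x. (h x)\<^sup>2 \<partial>Ptheta \<eta>)" by simp
  also have "\<dots> \<le> exp (2 * B) * (\<integral>x. (h x)\<^sup>2 \<partial>leb01)"
    by (rule integral_Ptheta_bounds[OF \<eta> _ _ sqb(2)]) auto
  also have "\<dots> = exp (2 * B) * coeff_dist_sq \<theta> \<eta>"
    using integral_log_series_diff[OF \<theta> \<eta>] unfolding h_def[symmetric] by simp
  finally have "exp (4 * B) / 2 * V \<le> exp (4 * B) / 2 * (exp (2 * B) * coeff_dist_sq \<theta> \<eta>)"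
    by (intro mult_left_mono) auto
  also have "\<dots> = exp (6 * B) / 2 * coeff_dist_sq \<theta> \<eta>"
    by (simp add: exp_add[symmetric])
  finally show "rel_entropy \<eta> \<theta> \<le> exp (6 * B) / 2 * coeff_dist_sq \<theta> \<eta>"
    using bd(1) by linarith
qed

text \<open>The logarithm is Lipschitz with constant \<open>exp B\<close> above \<open>exp (- B)\<close>, where both partition functions
  lie, and the \<open>L\<^sup>1\<close> norm on the unit interval is at most the \<open>L\<^sup>2\<close> norm.\<close>

lemma log_partition_diff_sq_le:
  assumes \<theta>: "bounded_exponent B \<theta>" and \<eta>: "bounded_exponent B \<eta>"
  shows "(log_partition \<theta> - log_partition \<eta>)\<^sup>2 \<le> exp (4 * B) * coeff_dist_sq \<theta> \<eta>"
proof -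
  define g where "g x = log_series \<theta> x - log_series \<eta> x" for x
  define Z where "Z \<theta> = (\<integral>t. exp (log_series \<theta> t) \<partial>leb01)" for \<theta>
  have [measurable]: "g \<in> borel_measurable borel" unfolding g_def[abs_def] by measurable
  have gb: "\<bar>g x\<bar> \<le> 2 * B" for x unfolding g_def by (rule abs_log_series_diff_le[OF \<theta> \<eta>])
  have B0: "B \<ge> 0" by (rule bounded_exponent_nonneg[OF \<theta>])
  have ig: "integrable leb01 g" "integrable leb01 (\<lambda>x. \<bar>g x\<bar>)" "integrable leb01 (\<lambda>x. \<bar>g x\<bar>\<^sup>2)"
    using gb
    by (auto intro!: integrable_leb01_bounded[where C = "2 * B"] integrable_leb01_bounded_sq[where C = "2 * B"])
  have Zpos: "Z \<theta> > 0" "Z \<eta> > 0" and Zlow: "exp (- B) \<le> Z \<theta>" "exp (- B) \<le> Z \<eta>"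
    unfolding Z_def using partition_pos partition_bounds \<theta> \<eta> by auto
  have "\<bar>Z \<theta> - Z \<eta>\<bar> = \<bar>\<integral>x. exp (log_series \<theta> x) - exp (log_series \<eta> x) \<partial>leb01\<bar>"
    unfolding Z_def using integrable_exp_log_series \<theta> \<eta> by (subst Bochner_Integration.integral_diff) auto
  also have "\<dots> \<le> (\<integral>x. exp B * \<bar>g x\<bar> \<partial>leb01)"
  proof (rule integral_abs_bound[THEN order_trans], rule integral_mono)
    show "\<bar>exp (log_series \<theta> x) - exp (log_series \<eta> x)\<bar> \<le> exp B * \<bar>g x\<bar>" for x
      unfolding g_def using \<theta> \<eta> by (intro abs_exp_diff_le) (auto simp: bounded_exponent_def abs_le_iff)
  qed (use ig integrable_exp_log_series \<theta> \<eta> in auto)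
  also have "\<dots> = exp B * (\<integral>x. \<bar>g x\<bar> \<partial>leb01)" by simp
  finally have Zd: "\<bar>Z \<theta> - Z \<eta>\<bar> \<le> exp B * (\<integral>x. \<bar>g x\<bar> \<partial>leb01)" .
  have lnd: "\<bar>ln s - ln t\<bar> \<le> exp B * \<bar>s - t\<bar>" if st: "exp (- B) \<le> s" "exp (- B) \<le> t" for s t
  proof -
    have *: "ln u - ln v \<le> exp B * \<bar>u - v\<bar>" if uv: "exp (- B) \<le> u" "exp (- B) \<le> v" for u v
    proof -
      have p: "u > 0" "v > 0" using uv exp_gt_zero[of "- B"] by linarith+
      have "ln u - ln v = ln (u / v)" using p by (simp add: ln_div)
      also have "\<dots> \<le> u / v - 1" using p by (intro ln_le_minus_one) auto
      also have "\<dots> = (u - v) / v" using p by (simp add: field_simps)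
      also have "\<dots> \<le> \<bar>u - v\<bar> / v" using p by (intro divide_right_mono) auto
      also have "\<dots> \<le> \<bar>u - v\<bar> / exp (- B)" using p uv by (intro divide_left_mono) auto
      finally show ?thesis by (simp add: exp_minus field_simps)
    qed
    show ?thesis using *[OF st] *[OF st(2,1)] by (simp add: abs_le_iff abs_minus_commute)
  qed
  have "\<bar>log_partition \<theta> - log_partition \<eta>\<bar> \<le> exp B * \<bar>Z \<theta> - Z \<eta>\<bar>"
    unfolding log_partition_def using lnd[OF Zlow] by (simp add: Z_def)
  also have "\<dots> \<le> exp B * (exp B * (\<integral>x. \<bar>g x\<bar> \<partial>leb01))" using Zd by (intro mult_left_mono) auto
  also have "\<dots> = exp (2 * B) * (\<integral>x. \<bar>g x\<bar> \<partial>leb01)" by (simp add: exp_add[symmetric])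
  finally have "(log_partition \<theta> - log_partition \<eta>)\<^sup>2 \<le> (exp (2 * B) * (\<integral>x. \<bar>g x\<bar> \<partial>leb01))\<^sup>2"
    by (simp add: abs_le_square_iff[symmetric] abs_mult)
  also have "\<dots> = exp (4 * B) * (\<integral>x. \<bar>g x\<bar> \<partial>leb01)\<^sup>2"
    by (simp add: power_mult_distrib exp_double[symmetric])
  also have "\<dots> \<le> exp (4 * B) * (\<integral>x. \<bar>g x\<bar>\<^sup>2 \<partial>leb01)"
    using leb01.variance_positive[of "\<lambda>x. \<bar>g x\<bar>", unfolded leb01.variance_eq[OF ig(2,3)]]
    by (intro mult_left_mono) simp_all
  also have "(\<integral>x. \<bar>g x\<bar>\<^sup>2 \<partial>leb01) = coeff_dist_sq \<theta> \<eta>"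
    using integral_log_series_diff(1)[OF \<theta> \<eta>] by (simp add: g_def)
  finally show ?thesis .
qed

lemma integral_log_dens_diff_sq_le:
  assumes \<theta>: "bounded_exponent B \<theta>" and \<eta>: "bounded_exponent B \<eta>"
  defines "l \<equiv> \<lambda>\<theta> x. log_series \<theta> x - log_partition \<theta>"
  shows "integrable leb01 (\<lambda>x. (l \<theta> x - l \<eta> x)\<^sup>2)"
    and "(\<integral>x. (l \<theta> x - l \<eta> x)\<^sup>2 \<partial>leb01) \<le> (1 + exp (4 * B)) * coeff_dist_sq \<theta> \<eta>"
proof -
  define g where "g x = log_series \<theta> x - log_series \<eta> x" for x
  define \<delta> where "\<delta> = log_partition \<theta> - log_partition \<eta>"
  have [measurable]: "g \<in> borel_measurable borel" unfolding g_def[abs_def] by measurable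
  have gb: "\<bar>g x\<bar> \<le> 2 * B" for x unfolding g_def by (rule abs_log_series_diff_le[OF \<theta> \<eta>])
  have B0: "B \<ge> 0" by (rule bounded_exponent_nonneg[OF \<theta>])
  have ig: "integrable leb01 g" "integrable leb01 (\<lambda>x. (g x)\<^sup>2)"
    using gb
    by (auto intro!: integrable_leb01_bounded[where C = "2 * B"] integrable_leb01_bounded_sq[where C = "2 * B"])
  have eq: "(l \<theta> x - l \<eta> x)\<^sup>2 = (g x - \<delta>)\<^sup>2" for x by (simp add: l_def g_def \<delta>_def algebra_simps)
  have eq': "(g x - \<delta>)\<^sup>2 = (g x)\<^sup>2 - 2 * \<delta> * g x + \<delta>\<^sup>2" for x by (simp add: power2_diff)
  show "integrable leb01 (\<lambda>x. (l \<theta> x - l \<eta> x)\<^sup>2)" unfolding eq eq' using ig by simp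
  have "(\<integral>x. (l \<theta> x - l \<eta> x)\<^sup>2 \<partial>leb01) = coeff_dist_sq \<theta> \<eta> + \<delta>\<^sup>2"
    unfolding eq eq' using ig integral_log_series_diff[OF \<theta> \<eta>] leb01.prob_space
    by (simp add: g_def[symmetric])
  also have "\<dots> \<le> (1 + exp (4 * B)) * coeff_dist_sq \<theta> \<eta>"
    using log_partition_diff_sq_le[OF \<theta> \<eta>] by (simp add: \<delta>_def algebra_simps)
  finally show "(\<integral>x. (l \<theta> x - l \<eta> x)\<^sup>2 \<partial>leb01) \<le> (1 + exp (4 * B)) * coeff_dist_sq \<theta> \<eta>" .
qed

text \<open>The square root of a density is the exponential of half its logarithm, and the exponential is
  Lipschitz on bounded sets.\<close>

lemma hellinger_dist_sq_le:
  assumes \<theta>: "bounded_exponent B \<theta>" and \<eta>: "bounded_exponent B \<eta>"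
  shows "(hellinger_dist (dens \<theta>) (dens \<eta>))\<^sup>2 \<le> exp (2 * B) * (1 + exp (4 * B)) * coeff_dist_sq \<theta> \<eta>"
proof -
  define l where "l \<theta> x = log_series \<theta> x - log_partition \<theta>" for \<theta> x
  note L2 = integral_log_dens_diff_sq_le[OF \<theta> \<eta>, folded l_def]
  have sq: "(sqrt (dens \<theta> x) - sqrt (dens \<eta> x))\<^sup>2 \<le> exp (2 * B) * (l \<theta> x - l \<eta> x)\<^sup>2" for x
  proof -
    have s: "sqrt (exp y) = exp (y / 2)" for y :: real
      by (rule real_sqrt_unique) (simp_all add: exp_double[symmetric])
    have "\<bar>exp (l \<theta> x / 2) - exp (l \<eta> x / 2)\<bar> \<le> exp B * \<bar>l \<theta> x / 2 - l \<eta> x / 2\<bar>"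
      using abs_log_dens_le[OF \<theta>, of x] abs_log_dens_le[OF \<eta>, of x]
      by (intro abs_exp_diff_le) (auto simp: l_def abs_le_iff)
    also have "\<dots> \<le> exp B * \<bar>l \<theta> x - l \<eta> x\<bar>" by (intro mult_left_mono) auto
    finally have "(exp (l \<theta> x / 2) - exp (l \<eta> x / 2))\<^sup>2 \<le> (exp B * (l \<theta> x - l \<eta> x))\<^sup>2"
      by (simp add: abs_le_square_iff[symmetric] abs_mult)
    then show ?thesis
      by (simp add: dens_eq_exp[OF \<theta>] dens_eq_exp[OF \<eta>] s l_def power_mult_distrib exp_double[symmetric])
  qed
  have "(hellinger_dist (dens \<theta>) (dens \<eta>))\<^sup>2 = (\<integral>x. (sqrt (dens \<theta> x) - sqrt (dens \<eta> x))\<^sup>2 \<partial>leb01)"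
    unfolding hellinger_dist_def by simp
  also have "\<dots> \<le> (\<integral>x. exp (2 * B) * (l \<theta> x - l \<eta> x)\<^sup>2 \<partial>leb01)"
  proof (rule integral_mono)
    show "integrable leb01 (\<lambda>x. (sqrt (dens \<theta> x) - sqrt (dens \<eta> x))\<^sup>2)"
      by (rule Bochner_Integration.integrable_bound[OF integrable_mult_right[OF L2(1), of "exp (2 * B)"]])
         (use sq in auto)
  qed (use sq L2(1) in auto)
  also have "\<dots> \<le> exp (2 * B) * ((1 + exp (4 * B)) * coeff_dist_sq \<theta> \<eta>)"
    using L2(2) by simp
  finally show ?thesis by (simp add: mult.assoc)
qed

lemma integral_dens_diff_sq_le:
  assumes \<theta>: "bounded_exponent B \<theta>" and \<eta>: "bounded_exponent B \<eta>"
  shows "(\<integral>x. (dens \<theta> x - dens \<eta> x)\<^sup>2 \<partial>leb01) \<le> exp (4 * B) * (1 + exp (4 * B)) * coeff_dist_sq \<theta> \<eta>"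
proof -
  define l where "l \<theta> x = log_series \<theta> x - log_partition \<theta>" for \<theta> x
  note L2 = integral_log_dens_diff_sq_le[OF \<theta> \<eta>, folded l_def]
  have sq: "(dens \<theta> x - dens \<eta> x)\<^sup>2 \<le> exp (4 * B) * (l \<theta> x - l \<eta> x)\<^sup>2" for x
  proof -
    have "\<bar>exp (l \<theta> x) - exp (l \<eta> x)\<bar> \<le> exp (2 * B) * \<bar>l \<theta> x - l \<eta> x\<bar>"
      using abs_log_dens_le[OF \<theta>, of x] abs_log_dens_le[OF \<eta>, of x]
      by (intro abs_exp_diff_le) (auto simp: l_def abs_le_iff)
    then have "(exp (l \<theta> x) - exp (l \<eta> x))\<^sup>2 \<le> (exp (2 * B) * (l \<theta> x - l \<eta> x))\<^sup>2"
      by (simp add: abs_le_square_iff[symmetric] abs_mult)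
    then show ?thesis
      by (simp add: dens_eq_exp[OF \<theta>] dens_eq_exp[OF \<eta>] l_def power_mult_distrib exp_double[symmetric])
  qed
  have "(\<integral>x. (dens \<theta> x - dens \<eta> x)\<^sup>2 \<partial>leb01) \<le> (\<integral>x. exp (4 * B) * (l \<theta> x - l \<eta> x)\<^sup>2 \<partial>leb01)"
  proof (rule integral_mono)
    show "integrable leb01 (\<lambda>x. (dens \<theta> x - dens \<eta> x)\<^sup>2)"
      by (rule Bochner_Integration.integrable_bound[OF integrable_mult_right[OF L2(1), of "exp (4 * B)"]])
         (use sq in auto)
  qed (use sq L2(1) in auto)
  also have "\<dots> \<le> exp (4 * B) * ((1 + exp (4 * B)) * coeff_dist_sq \<theta> \<eta>)"
    using L2(2) by simp
  finally show ?thesis by (simp add: mult.assoc)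
qed

text \<open>The sets of measures whose posterior mass is studied are given by parameters, while the Hellinger
  distance depends only on the measure.\<close>

lemma hellinger_dist_cong_Ptheta:
  assumes eq: "Ptheta \<theta> = Ptheta \<eta>" and \<theta>: "bounded_exponent B \<theta>" and \<eta>: "bounded_exponent B \<eta>"
    and [measurable]: "f \<in> borel_measurable borel"
  shows "hellinger_dist f (dens \<theta>) = hellinger_dist f (dens \<eta>)"
proof -
  have "AE x in leb01. ennreal (dens \<theta> x) = ennreal (dens \<eta> x)"
    using eq unfolding Ptheta_def by (intro leb01.density_unique) auto
  then have "AE x in leb01. dens \<theta> x = dens \<eta> x"
    by eventually_elim (simp add: less_imp_le[OF dens_pos[OF \<theta>]] less_imp_le[OF dens_pos[OF \<eta>]])
  then have "AE x in leb01. (sqrt (f x) - sqrt (dens \<theta> x))\<^sup>2 = (sqrt (f x) - sqrt (dens \<eta> x))\<^sup>2"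
    by eventually_elim simp
  then show ?thesis
    unfolding hellinger_dist_def by (intro arg_cong[of _ _ sqrt] integral_cong_AE) measurable
qed

section \<open>The likelihood ratio within a finite-dimensional exponential family\<close>

definition feature_mean :: "(nat \<Rightarrow> real) \<Rightarrow> nat \<Rightarrow> real" where
  "feature_mean \<eta> j = (\<integral>x. phi j x \<partial>Ptheta \<eta>)"

definition empirical_mean :: "nat \<Rightarrow> (nat \<Rightarrow> real) \<Rightarrow> nat \<Rightarrow> real" where
  "empirical_mean n X j = (\<Sum>i<n. phi j (X i)) / real n"

lemma finite_support_log_series:
  assumes "\<And>j. N < j \<Longrightarrow> a j = 0"
  shows "abs_summable_coeffs a" "log_series a x = partial_series a N x"
proof -
  have z: "a (Suc j) = 0" if "j \<notin> {..<N}" for j using assms[of "Suc j"] that by simp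
  show "abs_summable_coeffs a"
    unfolding abs_summable_coeffs_def by (rule summable_finite[of "{..<N}"]) (simp_all add: z)
  show "log_series a x = partial_series a N x"
    unfolding log_series_def partial_series_def by (rule suminf_finite) (simp_all add: z)
qed

lemma integrable_phi_Ptheta: "bounded_exponent B \<eta> \<Longrightarrow> integrable (Ptheta \<eta>) (phi j)"
proof -
  assume \<eta>: "bounded_exponent B \<eta>"
  interpret P: prob_space "Ptheta \<eta>" by (rule prob_space_Ptheta[OF \<eta>])
  show ?thesis using abs_phi_le by (intro P.integrable_const_bound[where B = "sqrt 2"]) auto
qed

lemma sum_centered_eq_empirical:
  assumes n: "0 < n" and \<eta>: "bounded_exponent B \<eta>"
  shows "(\<Sum>i<n. partial_series a N (X i) - (\<integral>x. partial_series a N x \<partial>Ptheta \<eta>))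
    = real n * (\<Sum>j<N. a (Suc j) * (empirical_mean n X (Suc j) - feature_mean \<eta> (Suc j)))"
proof -
  have mean: "(\<integral>x. partial_series a N x \<partial>Ptheta \<eta>) = (\<Sum>j<N. a (Suc j) * feature_mean \<eta> (Suc j))"
    unfolding partial_series_def feature_mean_def
    using integrable_phi_Ptheta[OF \<eta>] by (simp add: Bochner_Integration.integral_sum)
  have "(\<Sum>i<n. partial_series a N (X i)) = (\<Sum>j<N. \<Sum>i<n. a (Suc j) * phi (Suc j) (X i))"
    unfolding partial_series_def by (rule sum.swap)
  also have "\<dots> = (\<Sum>j<N. real n * (a (Suc j) * empirical_mean n X (Suc j)))"
    using n by (intro sum.cong refl) (simp add: empirical_mean_def sum_distrib_left[symmetric])
  finally show ?thesis
    by (simp add: sum_subtractf mean right_diff_distrib sum_distrib_left)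
qed

text \<open>The exponential-family identity: the data enter only through the empirical means of the basis
  functions.\<close>

lemma likelihood_ratio:
  assumes \<theta>: "bounded_exponent B \<theta>" and \<eta>: "bounded_exponent B \<eta>"
    and supp: "\<And>j. N < j \<Longrightarrow> \<theta> j = \<eta> j" and n: "0 < n"
  shows "likelihood n X \<theta> = likelihood n X \<eta> *
    exp (real n * ((\<Sum>j<N. (\<theta> (Suc j) - \<eta> (Suc j)) * (empirical_mean n X (Suc j) - feature_mean \<eta> (Suc j)))
                  - rel_entropy \<eta> \<theta>))"
proof -
  define d where "d j = \<theta> j - \<eta> j" for j
  define m where "m = (\<integral>x. partial_series d N x \<partial>Ptheta \<eta>)"
  have s: "abs_summable_coeffs \<theta>" "abs_summable_coeffs \<eta>"
    using \<theta> \<eta> by (auto simp: bounded_exponent_def)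
  have h: "log_series \<theta> x - log_series \<eta> x = partial_series d N x" for x
    unfolding log_series_diff[OF s, symmetric] d_def[symmetric]
    by (rule finite_support_log_series) (simp add: d_def supp)
  have "dens \<theta> x = dens \<eta> x * exp ((partial_series d N x - m) - rel_entropy \<eta> \<theta>)" for x
    unfolding dens_eq_exp[OF \<theta>] dens_eq_exp[OF \<eta>] rel_entropy_def m_def h[symmetric]
    by (simp add: exp_add[symmetric])
  then have "likelihood n X \<theta>
      = likelihood n X \<eta> * exp (\<Sum>i<n. (partial_series d N (X i) - m) - rel_entropy \<eta> \<theta>)"
    unfolding likelihood_def by (simp add: prod.distrib exp_sum)
  also have "(\<Sum>i<n. (partial_series d N (X i) - m) - rel_entropy \<eta> \<theta>)
      = (\<Sum>i<n. partial_series d N (X i) - m) - real n * rel_entropy \<eta> \<theta>"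
    by (simp add: sum_subtractf)
  also have "\<dots> = real n * ((\<Sum>j<N. d (Suc j) * (empirical_mean n X (Suc j) - feature_mean \<eta> (Suc j)))
      - rel_entropy \<eta> \<theta>)"
    unfolding m_def sum_centered_eq_empirical[OF n \<eta>] by (simp only: right_diff_distrib)
  finally show ?thesis by (simp only: d_def)
qed

definition noise :: "nat \<Rightarrow> (nat \<Rightarrow> real) \<Rightarrow> nat \<Rightarrow> (nat \<Rightarrow> real) \<Rightarrow> real" where
  "noise n X N \<eta> = sqrt (\<Sum>j<N. (empirical_mean n X (Suc j) - feature_mean \<eta> (Suc j))\<^sup>2)"

lemma coeff_dist_sq_finite:
  assumes "\<And>j. N < j \<Longrightarrow> \<theta> j = \<eta> j"
  shows "coeff_dist_sq \<theta> \<eta> = (\<Sum>j<N. (\<theta> (Suc j) - \<eta> (Suc j))\<^sup>2)"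
  unfolding coeff_dist_sq_def using assms by (intro suminf_finite) auto

lemma abs_linear_noise_le:
  assumes "\<And>j. N < j \<Longrightarrow> \<theta> j = \<eta> j"
  shows "\<bar>\<Sum>j<N. (\<theta> (Suc j) - \<eta> (Suc j)) * (empirical_mean n X (Suc j) - feature_mean \<eta> (Suc j))\<bar>
    \<le> sqrt (coeff_dist_sq \<theta> \<eta>) * noise n X N \<eta>"
proof -
  have "coeff_dist_sq \<theta> \<eta> = (\<Sum>j<N. (\<theta> (Suc j) - \<eta> (Suc j))\<^sup>2)"
    using assms by (rule coeff_dist_sq_finite)
  then show ?thesis
    unfolding noise_def real_sqrt_mult[symmetric]
    by (intro real_le_rsqrt) (simp only: power2_abs Cauchy_Schwarz_ineq_sum)
qed

lemma likelihood_pos: "bounded_exponent B \<theta> \<Longrightarrow> 0 < likelihood n X \<theta>"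
  unfolding likelihood_def by (intro prod_pos) (auto intro: dens_pos)

section \<open>Sobolev ellipsoids\<close>

lemma vseq_ge: "real j \<le> vseq j" and vseq_le: "vseq j \<le> real j + 1"
  by (auto simp: vseq_def)

lemma vseq_pos: "0 < vseq (Suc j)"
  by (simp add: vseq_def)

lemma vseq_le_dim: "j \<le> N \<Longrightarrow> vseq j \<le> real N + 1"
  using vseq_le[of j] by linarith

lemma summable_const_A:
  assumes "1 \<le> p"
  shows "summable (\<lambda>j. 1 / vseq (Suc j) ^ (2 * p))"
proof (rule summable_comparison_test')
  show "summable (\<lambda>j. 1 / real (Suc j) ^ 2)"
    using inverse_power_summable[of 2, where 'a = real] by (subst summable_Suc_iff) (simp add: field_simps)
  fix j
  have "real (Suc j) ^ 2 \<le> real (Suc j) ^ (2 * p)" using assms by (intro power_increasing) auto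
  also have "\<dots> \<le> vseq (Suc j) ^ (2 * p)" by (intro power_mono vseq_ge) auto
  finally show "norm (1 / vseq (Suc j) ^ (2 * p)) \<le> 1 / real (Suc j) ^ 2"
    using vseq_pos[of j] by (simp add: frac_le)
qed

text \<open>Cauchy--Schwarz with the weights \<open>v\<^sub>j\<^sup>p\<close> and \<open>v\<^sub>j\<^sup>-\<^sup>p\<close>.\<close>

lemma ellipsoid_abs_summable:
  assumes p: "1 \<le> p" and \<theta>: "\<theta> \<in> ellipsoid p Q"
  shows "abs_summable_coeffs \<theta>" "(\<Sum>j. \<bar>\<theta> (Suc j)\<bar>) \<le> sqrt (Q * const_A p)"
proof -
  have sw: "summable (\<lambda>j. vseq (Suc j) ^ (2 * p) * (\<theta> (Suc j))\<^sup>2)"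
    using \<theta> by (subst summable_Suc_iff) (simp add: ellipsoid_def)
  have v0: "vseq 0 ^ (2 * p) = 0" using p by (simp add: vseq_def)
  have wQ: "(\<Sum>j. vseq (Suc j) ^ (2 * p) * (\<theta> (Suc j))\<^sup>2) \<le> Q"
    using \<theta> suminf_split_head[of "\<lambda>j. vseq j ^ (2 * p) * (\<theta> j)\<^sup>2"] v0
    by (simp add: ellipsoid_def)
  have A0: "0 \<le> const_A p"
    unfolding const_A_def using vseq_pos by (intro suminf_nonneg summable_const_A p) (auto simp: less_imp_le)
  have part: "(\<Sum>j<n. \<bar>\<theta> (Suc j)\<bar>) \<le> sqrt (Q * const_A p)" for n
  proof (rule real_le_rsqrt)
    have "(\<Sum>j<n. \<bar>\<theta> (Suc j)\<bar>)\<^sup>2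
        = (\<Sum>j<n. (vseq (Suc j) ^ p * \<bar>\<theta> (Suc j)\<bar>) * (1 / vseq (Suc j) ^ p))\<^sup>2"
      using vseq_pos by (simp add: less_imp_neq[symmetric])
    also have "\<dots> \<le> (\<Sum>j<n. (vseq (Suc j) ^ p * \<bar>\<theta> (Suc j)\<bar>)\<^sup>2) * (\<Sum>j<n. (1 / vseq (Suc j) ^ p)\<^sup>2)"
      by (rule Cauchy_Schwarz_ineq_sum)
    also have "\<dots> = (\<Sum>j<n. vseq (Suc j) ^ (2 * p) * (\<theta> (Suc j))\<^sup>2) * (\<Sum>j<n. 1 / vseq (Suc j) ^ (2 * p))"
      by (simp add: power_mult_distrib power_divide power_mult[symmetric] mult.commute)
    also have "\<dots> \<le> Q * const_A p"
    proof (rule mult_mono)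
      show "(\<Sum>j<n. vseq (Suc j) ^ (2 * p) * (\<theta> (Suc j))\<^sup>2) \<le> Q"
        using vseq_pos by (intro order_trans[OF sum_le_suminf[OF sw] wQ]) (auto simp: less_imp_le)
      show "(\<Sum>j<n. 1 / vseq (Suc j) ^ (2 * p)) \<le> const_A p"
        unfolding const_A_def using vseq_pos
        by (intro sum_le_suminf summable_const_A p) (auto simp: less_imp_le)
      show "0 \<le> Q"
        using vseq_pos by (intro order_trans[OF suminf_nonneg[OF sw] wQ]) (auto simp: less_imp_le)
      show "0 \<le> (\<Sum>j<n. 1 / vseq (Suc j) ^ (2 * p))"
        using vseq_pos by (intro sum_nonneg) (auto simp: less_imp_le)
    qed
    finally show "(\<Sum>j<n. \<bar>\<theta> (Suc j)\<bar>)\<^sup>2 \<le> Q * const_A p" .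
  qed
  show s: "abs_summable_coeffs \<theta>"
    unfolding abs_summable_coeffs_def
    by (rule bounded_imp_summable[where B = "sqrt (Q * const_A p)"])
       (use part[of "Suc _"] in \<open>auto simp: lessThan_Suc_atMost\<close>)
  show "(\<Sum>j. \<bar>\<theta> (Suc j)\<bar>) \<le> sqrt (Q * const_A p)"
    using s part by (intro suminf_le_const) (auto simp: abs_summable_coeffs_def)
qed

lemma ellipsoid_bounded_exponent:
  assumes "1 \<le> p" and "\<theta> \<in> ellipsoid p Q"
  shows "bounded_exponent (const_B p Q) \<theta>"
  unfolding bounded_exponent_def
proof (intro conjI allI)
  show s: "abs_summable_coeffs \<theta>" by (rule ellipsoid_abs_summable[OF assms])
  fix x
  have "\<bar>log_series \<theta> x\<bar> \<le> sqrt 2 * (\<Sum>j. \<bar>\<theta> (Suc j)\<bar>)" by (rule abs_log_series_le[OF s])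
  also have "\<dots> \<le> sqrt 2 * sqrt (Q * const_A p)"
    by (intro mult_left_mono ellipsoid_abs_summable(2)[OF assms]) auto
  also have "\<dots> = const_B p Q" by (simp add: const_B_def real_sqrt_mult)
  finally show "\<bar>log_series \<theta> x\<bar> \<le> const_B p Q" .
qed

lemma sieve_ellipsoid_subset: "sieve_ellipsoid p N Q \<subseteq> ellipsoid p Q"
proof
  fix \<theta> assume \<theta>: "\<theta> \<in> sieve_ellipsoid p N Q"
  then have supp: "\<theta> j = 0" if "j > N" for j using that by (auto simp: sieve_ellipsoid_def)
  have "(\<Sum>j. vseq j ^ (2 * p) * (\<theta> j)\<^sup>2) = (\<Sum>j\<le>N. vseq j ^ (2 * p) * (\<theta> j)\<^sup>2)"
    by (rule suminf_finite) (auto simp: supp)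
  then show "\<theta> \<in> ellipsoid p Q"
    using \<theta> summable_finite[of "{..N}" "\<lambda>j. (\<theta> j)\<^sup>2"]
      summable_finite[of "{..N}" "\<lambda>j. vseq j ^ (2 * p) * (\<theta> j)\<^sup>2"]
    by (simp add: ellipsoid_def sieve_ellipsoid_def)
qed

definition truncate :: "nat \<Rightarrow> (nat \<Rightarrow> real) \<Rightarrow> nat \<Rightarrow> real" where
  "truncate N \<theta> j = (if j \<le> N then \<theta> j else 0)"

lemma truncate_in_sieve:
  assumes "\<theta> \<in> ellipsoid p Q"
  shows "truncate N \<theta> \<in> sieve_ellipsoid p N Q"
proof -
  have "(\<Sum>j\<le>N. vseq j ^ (2 * p) * (truncate N \<theta> j)\<^sup>2) = (\<Sum>j\<le>N. vseq j ^ (2 * p) * (\<theta> j)\<^sup>2)"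
    by (simp add: truncate_def)
  also have "\<dots> \<le> (\<Sum>j. vseq j ^ (2 * p) * (\<theta> j)\<^sup>2)"
    using assms by (intro sum_le_suminf) (auto simp: ellipsoid_def)
  finally show ?thesis using assms by (auto simp: sieve_ellipsoid_def ellipsoid_def truncate_def)
qed

text \<open>The squared approximation error of the sieve: beyond \<open>N\<close> every weight is at least \<open>(N + 1)\<^sup>2\<^sup>p\<close>.\<close>

lemma coeff_dist_truncate_le:
  assumes p: "1 \<le> p" and \<theta>: "\<theta> \<in> ellipsoid p Q"
  shows "coeff_dist_sq \<theta> (truncate N \<theta>) \<le> Q / (real N + 1) ^ (2 * p)"
proof -
  let ?w = "\<lambda>j. vseq j ^ (2 * p) * (\<theta> j)\<^sup>2"
  have sw: "summable ?w" and wQ: "(\<Sum>j. ?w j) < Q" using \<theta> by (auto simp: ellipsoid_def)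
  have sw': "summable (\<lambda>j. ?w (Suc j))" using sw by (subst summable_Suc_iff)
  have le: "(\<theta> (Suc j) - truncate N \<theta> (Suc j))\<^sup>2 \<le> ?w (Suc j) / (real N + 1) ^ (2 * p)" for j
  proof (cases "Suc j \<le> N")
    case True
    then show ?thesis using vseq_pos[of j] by (simp add: truncate_def)
  next
    case False
    then have "real N + 1 \<le> vseq (Suc j)" using vseq_ge[of "Suc j"] by linarith
    then have "(real N + 1) ^ (2 * p) \<le> vseq (Suc j) ^ (2 * p)" by (intro power_mono) auto
    then have "(\<theta> (Suc j))\<^sup>2 * (real N + 1) ^ (2 * p) \<le> ?w (Suc j)"
      by (subst mult.commute) (intro mult_right_mono, auto)
    then show ?thesis using False by (simp add: truncate_def field_simps)
  qed
  have "coeff_dist_sq \<theta> (truncate N \<theta>) \<le> (\<Sum>j. ?w (Suc j) / (real N + 1) ^ (2 * p))"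
    unfolding coeff_dist_sq_def using sw' le
    by (intro suminf_le summable_divide summable_comparison_test'[OF summable_divide[OF sw']]) auto
  also have "\<dots> = (\<Sum>j. ?w (Suc j)) / (real N + 1) ^ (2 * p)" by (rule suminf_divide[OF sw'])
  also have "\<dots> \<le> Q / (real N + 1) ^ (2 * p)"
  proof (rule divide_right_mono)
    have "?w 0 = 0" using p by (simp add: vseq_def)
    then show "(\<Sum>j. ?w (Suc j)) \<le> Q" using suminf_split_head[OF sw] wQ by linarith
  qed simp
  finally show ?thesis .
qed

section \<open>Concentration of the empirical means\<close>

lemma nn_integral_PiM_prod_iid:
  assumes "prob_space P" and f: "f \<in> borel_measurable P"
  shows "(\<integral>\<^sup>+X. (\<Prod>i<n. f (X i)) \<partial>(Pi\<^sub>M (UNIV :: nat set) (\<lambda>_. P))) = (\<integral>\<^sup>+x. f x \<partial>P) ^ n"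
proof -
  interpret P: prob_space P by fact
  interpret prod: product_prob_space "\<lambda>_. P" "UNIV :: nat set" by unfold_locales
  note f [measurable]
  have "(\<integral>\<^sup>+X. (\<Prod>i<n. f (X i)) \<partial>(Pi\<^sub>M UNIV (\<lambda>_. P)))
      = (\<integral>\<^sup>+X. (\<Prod>i<n. f (X i)) \<partial>(distr (Pi\<^sub>M UNIV (\<lambda>_. P)) (Pi\<^sub>M {..<n} (\<lambda>_. P)) (\<lambda>x. restrict x {..<n})))"
    by (subst nn_integral_distr) (auto intro!: nn_integral_cong prod.cong)
  also have "\<dots> = (\<integral>\<^sup>+X. (\<Prod>i<n. f (X i)) \<partial>(Pi\<^sub>M {..<n} (\<lambda>_. P)))"
    by (subst prod.distr_PiM_restrict_finite) auto
  also have "\<dots> = (\<Prod>i<n. \<integral>\<^sup>+x. f x \<partial>P)"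
    by (rule prod.product_nn_integral_prod) auto
  finally show ?thesis by simp
qed

lemma borel_measurable_coordinate:
  assumes "g \<in> borel_measurable borel"
  shows "(\<lambda>X. g (X i)) \<in> borel_measurable (Pi\<^sub>M (UNIV :: nat set) (\<lambda>_. Ptheta \<eta>))"
  by (rule measurable_compose[OF measurable_component_singleton[of i] borel_measurable_Ptheta[OF assms]]) simp

text \<open>Markov's inequality for \<open>exp (l \<Sum> (g (X\<^sub>i) - m))\<close>, whose expectation is controlled by the variance
  of \<open>g\<close> as long as \<open>l (g - m)\<close> stays bounded. A bound by the variance is essential: for normalised
  combinations of \<open>N\<close> basis functions the range grows with \<open>N\<close> and the variance does not.\<close>

lemma chernoff_iid:
  fixes g :: "real \<Rightarrow> real"
  assumes \<eta>: "bounded_exponent B \<eta>" and [measurable]: "g \<in> borel_measurable borel"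
    and l: "0 < l" and b: "\<And>x. \<bar>l * g x - l * m\<bar> \<le> b" and m: "(\<integral>x. g x \<partial>Ptheta \<eta>) = m"
  shows "emeasure (Pi\<^sub>M (UNIV :: nat set) (\<lambda>_. Ptheta \<eta>))
      {X \<in> space (Pi\<^sub>M UNIV (\<lambda>_. Ptheta \<eta>)). real n * t \<le> (\<Sum>i<n. g (X i) - m)}
    \<le> ennreal (exp (real n * (exp b / 2 * l\<^sup>2 * (\<integral>x. (g x - m)\<^sup>2 \<partial>Ptheta \<eta>) - l * t)))"
proof -
  interpret P: prob_space "Ptheta \<eta>" by (rule prob_space_Ptheta[OF \<eta>])
  define M where "M = Pi\<^sub>M (UNIV :: nat set) (\<lambda>_. Ptheta \<eta>)"
  define V where "V = (\<integral>x. (g x - m)\<^sup>2 \<partial>Ptheta \<eta>)"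
  define f where "f x = exp (l * (g x - m))" for x
  have [measurable]: "(\<lambda>X. g (X i)) \<in> borel_measurable M" for i
    unfolding M_def by (rule borel_measurable_coordinate) simp
  have fb: "f x \<le> exp b" "0 \<le> f x" for x
    using b[of x] by (auto simp: f_def right_diff_distrib abs_le_iff)
  have "integrable (Ptheta \<eta>) f"
    using fb by (intro P.integrable_const_bound[where B = "exp b"]) (auto simp: f_def[abs_def])
  then have "(\<integral>\<^sup>+x. ennreal (f x) \<partial>Ptheta \<eta>) = ennreal (\<integral>x. f x \<partial>Ptheta \<eta>)"
    using fb by (intro nn_integral_eq_integral) auto
  also have "(\<integral>x. f x \<partial>Ptheta \<eta>) \<le> 1 + exp b / 2 * (\<integral>x. (l * g x - l * m)\<^sup>2 \<partial>Ptheta \<eta>)"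
    unfolding f_def right_diff_distrib
    by (rule P.centered_exp_moment_bounds(1)[OF _ b]) (auto simp: m)
  also have "(\<integral>x. (l * g x - l * m)\<^sup>2 \<partial>Ptheta \<eta>) = l\<^sup>2 * V"
    by (simp add: V_def right_diff_distrib[symmetric] power_mult_distrib)
  also have "1 + exp b / 2 * (l\<^sup>2 * V) \<le> exp (exp b / 2 * (l\<^sup>2 * V))"
    by (rule exp_ge_add_one_self)
  finally have mgf: "(\<integral>\<^sup>+x. ennreal (f x) \<partial>Ptheta \<eta>) \<le> ennreal (exp (exp b / 2 * (l\<^sup>2 * V)))"
    by (simp add: ennreal_leI)
  have "emeasure M {X \<in> space M. real n * t \<le> (\<Sum>i<n. g (X i) - m)}
      \<le> emeasure M {X \<in> space M. 1 \<le> ennreal (exp (- (l * (real n * t)))) * (\<Prod>i<n. ennreal (f (X i)))}"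
  proof (rule emeasure_mono)
    show "{X \<in> space M. real n * t \<le> (\<Sum>i<n. g (X i) - m)}
      \<subseteq> {X \<in> space M. 1 \<le> ennreal (exp (- (l * (real n * t)))) * (\<Prod>i<n. ennreal (f (X i)))}"
    proof safe
      fix X assume "real n * t \<le> (\<Sum>i<n. g (X i) - m)"
      then have "l * (real n * t) \<le> l * (\<Sum>i<n. g (X i) - m)" using l by (intro mult_left_mono) auto
      then have "1 \<le> exp (- (l * (real n * t))) * exp (l * (\<Sum>i<n. g (X i) - m))"
        by (simp add: exp_add[symmetric])
      also have "exp (l * (\<Sum>i<n. g (X i) - m)) = (\<Prod>i<n. f (X i))"
        by (simp add: f_def exp_sum sum_distrib_left)
      finally show "1 \<le> ennreal (exp (- (l * (real n * t)))) * (\<Prod>i<n. ennreal (f (X i)))"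
        using fb by (simp add: prod_ennreal ennreal_mult[symmetric] prod_nonneg)
    qed
    show "{X \<in> space M. 1 \<le> ennreal (exp (- (l * (real n * t)))) * (\<Prod>i<n. ennreal (f (X i)))} \<in> sets M"
      unfolding f_def by measurable
  qed
  also have "\<dots> \<le> ennreal (exp (- (l * (real n * t)))) * (\<integral>\<^sup>+X. (\<Prod>i<n. ennreal (f (X i))) * indicator (space M) X \<partial>M)"
    by (rule nn_integral_Markov_inequality) (auto simp: f_def)
  also have "(\<integral>\<^sup>+X. (\<Prod>i<n. ennreal (f (X i))) * indicator (space M) X \<partial>M) = (\<integral>\<^sup>+X. (\<Prod>i<n. ennreal (f (X i))) \<partial>M)"
    by (intro nn_integral_cong) auto
  also have "\<dots> = (\<integral>\<^sup>+x. ennreal (f x) \<partial>Ptheta \<eta>) ^ n"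
    unfolding M_def by (intro nn_integral_PiM_prod_iid P.prob_space_axioms) (auto simp: f_def[abs_def])
  also have "\<dots> \<le> ennreal (exp (exp b / 2 * (l\<^sup>2 * V))) ^ n"
    by (rule power_mono[OF mgf]) simp
  also have "ennreal (exp (- (l * (real n * t)))) * \<dots> = ennreal (exp (real n * (exp b / 2 * l\<^sup>2 * V - l * t)))"
    by (simp add: ennreal_power ennreal_mult[symmetric] exp_of_nat_mult[symmetric] exp_add[symmetric] algebra_simps)
  finally show ?thesis
    unfolding M_def V_def by (simp add: mult_left_mono)
qed

text \<open>Integer points of norm at most \<open>2 \<surd>N\<close>. Divided by \<open>2 \<surd>N\<close> they form a net of the unit ball that is
  fine enough to recover a fixed fraction of any Euclidean norm.\<close>

definition lattice_net :: "nat \<Rightarrow> (nat \<Rightarrow> int) set" where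
  "lattice_net N = {k \<in> Pi\<^sub>E {..<N} (\<lambda>_. {- int (4 * N)..int (4 * N)}). (\<Sum>j<N. (k j)\<^sup>2) \<le> int (4 * N)}"

lemma finite_lattice_net: "finite (lattice_net N)"
proof -
  have "finite (Pi\<^sub>E {..<N} (\<lambda>_. {- int (4 * N)..int (4 * N)}))" by (intro finite_PiE) auto
  then show ?thesis unfolding lattice_net_def by simp
qed

lemma int_abs_le_square: "\<bar>k\<bar> \<le> k\<^sup>2" for k :: int
proof (cases "k = 0")
  case False
  then have "\<bar>k\<bar> * 1 \<le> \<bar>k\<bar> * \<bar>k\<bar>" by (intro mult_left_mono) auto
  then show ?thesis by (simp add: power2_eq_square)
qed simp

lemma sum_exp_sq_le_3: "(\<Sum>k\<in>{- int m..int m}. exp (- real_of_int (k\<^sup>2))) \<le> (3 :: real)"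
proof -
  have le: "exp (- real_of_int (k\<^sup>2)) \<le> (1 / 2 :: real) ^ nat \<bar>k\<bar>" for k
  proof -
    have e: "exp (- 1) \<le> (1 / 2 :: real)"
      using exp_ge_add_one_self[of 1] by (simp add: exp_minus inverse_eq_divide)
    have "\<bar>k\<bar> \<le> k\<^sup>2" by (rule int_abs_le_square)
    then have "exp (- real_of_int (k\<^sup>2)) \<le> exp (- real (nat \<bar>k\<bar>))"
      by (metis exp_le_cancel_iff neg_le_iff_le of_int_le_iff of_nat_nat abs_ge_zero of_int_of_nat_eq)
    also have "\<dots> = exp (- 1) ^ nat \<bar>k\<bar>" by (simp add: exp_of_nat_mult[symmetric])
    also have "\<dots> \<le> (1 / 2) ^ nat \<bar>k\<bar>" using e by (intro power_mono) auto
    finally show ?thesis .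
  qed
  have "(\<Sum>k\<in>{- int m..int m}. (1 / 2 :: real) ^ nat \<bar>k\<bar>) = 3 - 2 * (1 / 2) ^ m"
  proof (induction m)
    case (Suc m)
    have "{- int (Suc m)..int (Suc m)} = insert (int (Suc m)) (insert (- int (Suc m)) {- int m..int m})"
      by auto
    then have "(\<Sum>k\<in>{- int (Suc m)..int (Suc m)}. (1 / 2 :: real) ^ nat \<bar>k\<bar>)
        = (1 / 2) ^ Suc m + ((1 / 2) ^ Suc m + (\<Sum>k\<in>{- int m..int m}. (1 / 2) ^ nat \<bar>k\<bar>))"
      by (simp only:) (subst sum.insert, simp, simp, subst sum.insert, simp, simp, simp add: nat_add_distrib)
    then show ?case using Suc by simp
  qed simp
  moreover have "(\<Sum>k\<in>{- int m..int m}. exp (- real_of_int (k\<^sup>2)))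
      \<le> (\<Sum>k\<in>{- int m..int m}. (1 / 2 :: real) ^ nat \<bar>k\<bar>)"
    by (intro sum_mono le)
  moreover have "0 \<le> (1 / 2 :: real) ^ m" by simp
  ultimately show ?thesis by linarith
qed

text \<open>On the net the weight \<open>exp (4 N - \<Sum> k\<^sub>j\<^sup>2)\<close> is at least one. Its sum over all integer points is a
  product of one-dimensional sums, each of which is bounded by \<open>3 \<le> exp 2\<close>.\<close>

lemma card_lattice_net_le: "real (card (lattice_net N)) \<le> exp (6 * real N)"
proof -
  let ?B = "\<lambda>_::nat. {- int (4 * N)..int (4 * N)}"
  have "real (card (lattice_net N)) = (\<Sum>k\<in>lattice_net N. 1)" by simp
  also have "\<dots> \<le> (\<Sum>k\<in>lattice_net N. exp (4 * real N) * (\<Prod>j<N. exp (- real_of_int ((k j)\<^sup>2))))"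
  proof (rule sum_mono)
    fix k assume "k \<in> lattice_net N"
    then have "(\<Sum>j<N. (k j)\<^sup>2) \<le> int (4 * N)" by (simp add: lattice_net_def)
    then have "real_of_int (\<Sum>j<N. (k j)\<^sup>2) \<le> real_of_int (int (4 * N))" by (simp only: of_int_le_iff)
    then have "0 \<le> 4 * real N + (\<Sum>j<N. - real_of_int ((k j)\<^sup>2))" by (simp add: sum_negf)
    then have "1 \<le> exp (4 * real N + (\<Sum>j<N. - real_of_int ((k j)\<^sup>2)))" by simp
    then show "1 \<le> exp (4 * real N) * (\<Prod>j<N. exp (- real_of_int ((k j)\<^sup>2)))"
      by (simp only: exp_add exp_sum finite_lessThan)
  qed
  also have "\<dots> \<le> (\<Sum>k\<in>Pi\<^sub>E {..<N} ?B. exp (4 * real N) * (\<Prod>j<N. exp (- real_of_int ((k j)\<^sup>2))))"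
  proof (rule sum_mono2)
    show "lattice_net N \<subseteq> Pi\<^sub>E {..<N} ?B" unfolding lattice_net_def by blast
    show "0 \<le> exp (4 * real N) * (\<Prod>j<N. exp (- real_of_int ((k j)\<^sup>2)))" for k :: "nat \<Rightarrow> int"
      by (intro mult_nonneg_nonneg prod_nonneg ballI exp_ge_zero)
  qed (intro finite_PiE finite_lessThan finite_atLeastAtMost_int)
  also have "\<dots> = exp (4 * real N) * (\<Prod>j<N. \<Sum>i\<in>?B j. exp (- real_of_int (i\<^sup>2)))"
  proof -
    have "(\<Prod>j<N. \<Sum>i\<in>?B j. exp (- real_of_int (i\<^sup>2)))
        = (\<Sum>k\<in>Pi\<^sub>E {..<N} ?B. \<Prod>j<N. exp (- real_of_int ((k j)\<^sup>2)))"
      by (rule prod_sum_PiE) simp_all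
    then show ?thesis by (simp only: sum_distrib_left[symmetric])
  qed
  also have "\<dots> \<le> exp (4 * real N) * (\<Prod>j<N. exp 2)"
  proof (intro mult_left_mono prod_mono conjI)
    fix j
    show "(\<Sum>i\<in>?B j. exp (- real_of_int (i\<^sup>2))) \<le> exp 2"
      using sum_exp_sq_le_3[of "4 * N"] exp_ge_add_one_self[of 2] by linarith
  qed (auto intro!: sum_nonneg)
  also have "\<dots> = exp (6 * real N)"
    by (simp add: exp_of_nat_mult[symmetric] exp_add[symmetric])
  finally show ?thesis .
qed

text \<open>The net point is the vector \<open>z\<close>, scaled to norm \<open>2 \<surd>N\<close> and rounded coordinatewise. The rounding
  error has norm at most \<open>\<surd>N\<close>, half of that.\<close>

lemma lattice_net_covers:
  fixes z :: "nat \<Rightarrow> real"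
  shows "\<exists>k\<in>lattice_net N. sqrt (real N) / 2 * sqrt (\<Sum>j<N. (z j)\<^sup>2) \<le> (\<Sum>j<N. of_int (k j) * z j)"
proof -
  define r where "r = sqrt (\<Sum>j<N. (z j)\<^sup>2)"
  have r2: "r\<^sup>2 = (\<Sum>j<N. (z j)\<^sup>2)" unfolding r_def by (simp add: sum_nonneg)
  have r0: "r \<ge> 0" unfolding r_def by (simp add: sum_nonneg)
  show ?thesis
  proof (cases "r = 0 \<or> N = 0")
    case True
    have "(\<lambda>j\<in>{..<N}. 0) \<in> lattice_net N" by (auto simp: lattice_net_def)
    moreover have "sqrt (real N) / 2 * sqrt (\<Sum>j<N. (z j)\<^sup>2) \<le> (\<Sum>j<N. of_int ((\<lambda>j\<in>{..<N}. 0 :: int) j) * z j)"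
      using True by (auto simp: r_def)
    ultimately show ?thesis by blast
  next
    case False
    then have r: "r > 0" and N: "N > 0" using r0 by auto
    define y where "y j = 2 * sqrt (real N) / r * z j" for j
    \<comment> \<open>Rounding toward zero keeps the squared norm below \<open>4 N\<close> and moves each coordinate by at most one.\<close>
    define c :: "nat \<Rightarrow> int" where "c j = (if 0 \<le> y j then \<lfloor>y j\<rfloor> else - \<lfloor>- y j\<rfloor>)" for j
    have c1: "\<bar>of_int (c j)\<bar> \<le> \<bar>y j\<bar>" and c2: "\<bar>y j - of_int (c j)\<bar> \<le> 1" for j
      unfolding c_def by (cases "0 \<le> y j"; simp; linarith)+
    have ysum: "(\<Sum>j<N. (y j)\<^sup>2) = 4 * real N"
      unfolding y_def power_mult_distrib sum_distrib_left[symmetric] r2[symmetric]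
      using r by (simp add: power_divide power_mult_distrib)
    have csum: "(\<Sum>j<N. (c j)\<^sup>2) \<le> int (4 * N)"
    proof -
      have "real_of_int (\<Sum>j<N. (c j)\<^sup>2) \<le> (\<Sum>j<N. (y j)\<^sup>2)"
        using c1 by (simp add: sum_mono abs_le_square_iff)
      also have "\<dots> = real_of_int (int (4 * N))" using ysum by simp
      finally show ?thesis by (simp only: of_int_le_iff)
    qed
    have cb: "\<bar>c j\<bar> \<le> int (4 * N)" if "j < N" for j
    proof -
      have "\<bar>c j\<bar> \<le> (c j)\<^sup>2" by (rule int_abs_le_square)
      also have "\<dots> \<le> (\<Sum>j<N. (c j)\<^sup>2)" using that by (intro member_le_sum) auto
      finally show ?thesis using csum by linarith
    qed
    have "restrict c {..<N} \<in> lattice_net N"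
      using csum cb by (auto simp: lattice_net_def abs_le_iff minus_le_iff)
    moreover have "sqrt (real N) / 2 * r \<le> (\<Sum>j<N. of_int (restrict c {..<N} j) * z j)"
    proof -
      have "(y j)\<^sup>2 - 1 \<le> 2 * (of_int (c j) * y j)" for j
      proof -
        have "(y j - of_int (c j))\<^sup>2 \<le> 1" using power_mono[OF c2 abs_ge_zero, of j 2] by simp
        moreover have "(y j - of_int (c j))\<^sup>2 = (y j)\<^sup>2 - 2 * (of_int (c j) * y j) + (of_int (c j))\<^sup>2"
          by (simp add: power2_diff)
        ultimately show ?thesis using zero_le_power2[of "real_of_int (c j)"] by linarith
      qed
      then have "(\<Sum>j<N. (y j)\<^sup>2 - 1) \<le> (\<Sum>j<N. 2 * (of_int (c j) * y j))" by (rule sum_mono)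
      then have "3 * real N \<le> 2 * (\<Sum>j<N. of_int (c j) * y j)"
        by (simp add: sum_subtractf ysum sum_distrib_left)
      also have "(\<Sum>j<N. of_int (c j) * y j) = 2 * sqrt (real N) / r * (\<Sum>j<N. of_int (c j) * z j)"
        by (simp add: y_def sum_distrib_left mult_ac)
      finally have "3 * real N * r \<le> 4 * sqrt (real N) * (\<Sum>j<N. of_int (c j) * z j)"
        using r by (simp add: field_simps)
      moreover have "sqrt (real N) * (3 * sqrt (real N) * r) = 3 * (sqrt (real N) * sqrt (real N)) * r"
        by (simp only: mult_ac)
      ultimately have "sqrt (real N) * (3 * sqrt (real N) * r) \<le> sqrt (real N) * (4 * (\<Sum>j<N. of_int (c j) * z j))"
        by (simp only: real_sqrt_mult_self mult_ac abs_of_nat)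
      then have "3 * sqrt (real N) * r \<le> 4 * (\<Sum>j<N. of_int (c j) * z j)"
        by (rule mult_left_le_imp_le) (use N in simp)
      moreover have "0 \<le> sqrt (real N) * r" using r by simp
      ultimately show ?thesis by simp
    qed
    ultimately show ?thesis unfolding r_def by blast
  qed
qed

lemma noise_borel [measurable]:
  "(\<lambda>X. noise n X N \<eta>') \<in> borel_measurable (Pi\<^sub>M (UNIV :: nat set) (\<lambda>_. Ptheta \<eta>))"
proof -
  have [measurable]: "(\<lambda>X. phi j (X i)) \<in> borel_measurable (Pi\<^sub>M (UNIV :: nat set) (\<lambda>_. Ptheta \<eta>))" for i j
    by (rule borel_measurable_coordinate) simp
  show ?thesis unfolding noise_def empirical_mean_def by measurable
qed

text \<open>A union bound over the net. In each direction of norm at most one the variance is at most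
  \<open>exp (2 B)\<close>, and the exponent \<open>e\<close> times a unit combination of \<open>N\<close> basis functions stays bounded
  because \<open>e\<^sup>2 N\<close> does.\<close>

lemma noise_tail:
  assumes \<eta>: "bounded_exponent B \<eta>" and e: "0 < e" and L: "e\<^sup>2 * real N \<le> L" and N: "0 < N" and n: "0 < n"
  shows "emeasure (Pi\<^sub>M (UNIV :: nat set) (\<lambda>_. Ptheta \<eta>))
      {X \<in> space (Pi\<^sub>M UNIV (\<lambda>_. Ptheta \<eta>)). K * e \<le> noise n X N \<eta>}
    \<le> ennreal (exp (6 * real N - real n * e\<^sup>2 * (K / 4 - exp (sqrt (8 * L) + 2 * B) / 2)))"
proof -
  interpret P: prob_space "Ptheta \<eta>" by (rule prob_space_Ptheta[OF \<eta>])
  define M where "M = Pi\<^sub>M (UNIV :: nat set) (\<lambda>_. Ptheta \<eta>)"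
  define a :: "(nat \<Rightarrow> int) \<Rightarrow> nat \<Rightarrow> real" where "a k j = of_int (k (j - 1)) / (2 * sqrt (real N))" for k j
  define g where "g k = partial_series (a k) N" for k
  define m where "m k = (\<integral>x. g k x \<partial>Ptheta \<eta>)" for k
  define b where "b = sqrt (8 * L)"
  define T where "T k = {X \<in> space M. real n * (K * e / 4) \<le> (\<Sum>i<n. g k (X i) - m k)}" for k
  have [measurable]: "g k \<in> borel_measurable borel" for k unfolding g_def by measurable
  have "(\<lambda>X. g k (X i)) \<in> borel_measurable M" for k i
    unfolding M_def by (rule borel_measurable_coordinate) simp
  note this [measurable]
  have T_sets: "T k \<in> sets M" for k unfolding T_def by measurable
  have T_bound: "emeasure M (T k) \<le> ennreal (exp (- (real n * e\<^sup>2 * (K / 4 - exp (b + 2 * B) / 2))))"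
    if k: "k \<in> lattice_net N" for k
  proof -
    have a2: "(\<Sum>j<N. (a k (Suc j))\<^sup>2) \<le> 1"
    proof -
      have "real_of_int (\<Sum>j<N. (k j)\<^sup>2) \<le> real_of_int (int (4 * N))"
        using k by (simp only: of_int_le_iff lattice_net_def mem_Collect_eq)
      then have "(\<Sum>j<N. (of_int (k j))\<^sup>2) / (4 * real N) \<le> 1" using N by (simp add: field_simps)
      moreover have "(\<Sum>j<N. (a k (Suc j))\<^sup>2) = (\<Sum>j<N. (of_int (k j))\<^sup>2) / (4 * real N)"
        by (simp add: a_def power_divide power_mult_distrib sum_divide_distrib)
      ultimately show ?thesis by simp
    qed
    have a1: "(\<Sum>j<N. \<bar>a k (Suc j)\<bar>) \<le> sqrt (real N)"
    proof (rule real_le_rsqrt)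
      have "(\<Sum>j<N. 1 * \<bar>a k (Suc j)\<bar>)\<^sup>2 \<le> (\<Sum>j<N. 1\<^sup>2) * (\<Sum>j<N. \<bar>a k (Suc j)\<bar>\<^sup>2)"
        by (rule Cauchy_Schwarz_ineq_sum)
      also have "\<dots> \<le> real N * 1" using a2 by (intro mult_mono) (auto intro: sum_nonneg)
      finally show "(\<Sum>j<N. \<bar>a k (Suc j)\<bar>)\<^sup>2 \<le> real N" by simp
    qed
    have gb: "\<bar>g k x\<bar> \<le> sqrt 2 * sqrt (real N)" for x
    proof -
      have "\<bar>g k x\<bar> \<le> (\<Sum>j<N. \<bar>a k (Suc j)\<bar> * sqrt 2)"
        unfolding g_def partial_series_def
        by (rule order_trans[OF sum_abs sum_mono]) (auto simp: abs_mult intro!: mult_left_mono abs_phi_le)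
      also have "\<dots> = sqrt 2 * (\<Sum>j<N. \<bar>a k (Suc j)\<bar>)" by (simp add: sum_distrib_left mult.commute)
      also have "\<dots> \<le> sqrt 2 * sqrt (real N)" by (intro mult_left_mono a1) simp
      finally show ?thesis .
    qed
    have ig: "integrable (Ptheta \<eta>) (g k)" "integrable (Ptheta \<eta>) (\<lambda>x. (g k x)\<^sup>2)"
    proof -
      show "integrable (Ptheta \<eta>) (g k)"
        using gb by (intro P.integrable_const_bound[where B = "sqrt 2 * sqrt (real N)"]) auto
      show "integrable (Ptheta \<eta>) (\<lambda>x. (g k x)\<^sup>2)"
        using power_mono[OF gb abs_ge_zero, of _ 2]
        by (intro P.integrable_const_bound[where B = "(sqrt 2 * sqrt (real N))\<^sup>2"] AE_I2)
           (simp_all only: real_norm_def abs_power2 power2_abs, measurable)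
    qed
    have "\<bar>m k\<bar> \<le> (\<integral>x. sqrt 2 * sqrt (real N) \<partial>Ptheta \<eta>)"
      unfolding m_def using ig(1) gb by (intro integral_abs_bound[THEN order_trans] integral_mono) auto
    then have mb: "\<bar>m k\<bar> \<le> sqrt 2 * sqrt (real N)" using P.prob_space by simp
    have db: "\<bar>e * g k x - e * m k\<bar> \<le> b" for x
    proof -
      have "\<bar>e * g k x - e * m k\<bar> = e * \<bar>g k x - m k\<bar>"
        using e by (simp add: right_diff_distrib[symmetric] abs_mult)
      also have "\<dots> \<le> e * (2 * (sqrt 2 * sqrt (real N)))"
        using gb[of x] mb e by (intro mult_left_mono) linarith+
      also have "\<dots> = sqrt (8 * (e\<^sup>2 * real N))"
      proof -
        have "sqrt 8 = 2 * sqrt 2" using real_sqrt_mult[of 4 2] by simp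
        then show ?thesis using e by (simp add: real_sqrt_mult)
      qed
      also have "\<dots> \<le> b" unfolding b_def using L by simp
      finally show ?thesis .
    qed
    define V where "V = (\<integral>x. (g k x - m k)\<^sup>2 \<partial>Ptheta \<eta>)"
    have "V = (\<integral>x. (g k x)\<^sup>2 \<partial>Ptheta \<eta>) - (m k)\<^sup>2"
      unfolding V_def m_def by (rule P.variance_eq[OF ig])
    also have "\<dots> \<le> (\<integral>x. (g k x)\<^sup>2 \<partial>Ptheta \<eta>)" by simp
    also have "\<dots> \<le> exp (2 * B) * (\<integral>x. (g k x)\<^sup>2 \<partial>leb01)"
      using power_mono[OF gb abs_ge_zero, of _ 2]
      by (intro integral_Ptheta_bounds(2)[OF \<eta>, where C = "(sqrt 2 * sqrt (real N))\<^sup>2"])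
         (simp_all only: power2_abs zero_le_power2, measurable)
    also have "\<dots> \<le> exp (2 * B) * 1"
      unfolding g_def integral_partial_series_sq by (intro mult_left_mono a2) simp
    finally have V: "V \<le> exp (2 * B)" by simp
    have "emeasure M (T k) \<le> ennreal (exp (real n * (exp b / 2 * e\<^sup>2 * V - e * (K * e / 4))))"
      unfolding T_def M_def V_def by (rule chernoff_iid[OF \<eta> _ e db]) (simp_all add: m_def)
    also have "\<dots> \<le> ennreal (exp (- (real n * e\<^sup>2 * (K / 4 - exp (b + 2 * B) / 2))))"
    proof -
      have "exp b / 2 * e\<^sup>2 * V \<le> exp b / 2 * e\<^sup>2 * exp (2 * B)"
        using V by (intro mult_left_mono) auto
      then have "real n * (exp b / 2 * e\<^sup>2 * V - e * (K * e / 4))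
          \<le> real n * (exp b / 2 * e\<^sup>2 * exp (2 * B) - e * (K * e / 4))"
        by (intro mult_left_mono) auto
      also have "\<dots> = - (real n * e\<^sup>2 * (K / 4 - exp (b + 2 * B) / 2))"
        by (simp add: exp_add algebra_simps power2_eq_square)
      finally show ?thesis by (intro ennreal_leI) simp
    qed
    finally show ?thesis .
  qed
  have sub: "{X \<in> space M. K * e \<le> noise n X N \<eta>} \<subseteq> (\<Union>k\<in>lattice_net N. T k)"
  proof
    fix X assume X: "X \<in> {X \<in> space M. K * e \<le> noise n X N \<eta>}"
    define z where "z j = empirical_mean n X (Suc j) - feature_mean \<eta> (Suc j)" for j
    obtain k where k: "k \<in> lattice_net N"
      and kz: "sqrt (real N) / 2 * noise n X N \<eta> \<le> (\<Sum>j<N. of_int (k j) * z j)"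
      using lattice_net_covers[of N z] unfolding noise_def z_def by blast
    have "(\<Sum>j<N. a k (Suc j) * z j) = (\<Sum>j<N. of_int (k j) * z j) / (2 * sqrt (real N))"
      by (simp add: a_def sum_divide_distrib)
    also have "\<dots> \<ge> (sqrt (real N) / 2 * noise n X N \<eta>) / (2 * sqrt (real N))"
      using kz by (intro divide_right_mono) auto
    also have "(sqrt (real N) / 2 * noise n X N \<eta>) / (2 * sqrt (real N)) = noise n X N \<eta> / 4"
      using N by simp
    finally have "K * e / 4 \<le> (\<Sum>j<N. a k (Suc j) * z j)" using X by simp
    then have "real n * (K * e / 4) \<le> real n * (\<Sum>j<N. a k (Suc j) * z j)" by (intro mult_left_mono) auto
    also have "\<dots> = (\<Sum>i<n. g k (X i) - m k)"
      unfolding g_def m_def z_def by (rule sum_centered_eq_empirical[OF n \<eta>, symmetric])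
    finally have "X \<in> T k" using X by (simp add: T_def)
    then show "X \<in> (\<Union>k\<in>lattice_net N. T k)" using k by blast
  qed
  have "emeasure M {X \<in> space M. K * e \<le> noise n X N \<eta>} \<le> emeasure M (\<Union>k\<in>lattice_net N. T k)"
    using T_sets finite_lattice_net by (intro emeasure_mono sub sets.finite_UN) auto
  also have "\<dots> \<le> (\<Sum>k\<in>lattice_net N. emeasure M (T k))"
    using T_sets by (intro emeasure_subadditive_finite finite_lattice_net) auto
  also have "\<dots> \<le> (\<Sum>k\<in>lattice_net N. ennreal (exp (- (real n * e\<^sup>2 * (K / 4 - exp (b + 2 * B) / 2)))))"
    by (intro sum_mono T_bound)
  also have "\<dots> = ennreal (real (card (lattice_net N)) * exp (- (real n * e\<^sup>2 * (K / 4 - exp (b + 2 * B) / 2))))"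
    by (simp add: ennreal_of_nat_eq_real_of_nat ennreal_mult)
  also have "\<dots> \<le> ennreal (exp (6 * real N) * exp (- (real n * e\<^sup>2 * (K / 4 - exp (b + 2 * B) / 2))))"
    by (intro ennreal_leI mult_right_mono card_lattice_net_le) simp
  also have "\<dots> = ennreal (exp (6 * real N - real n * e\<^sup>2 * (K / 4 - exp (b + 2 * B) / 2)))"
    by (simp only: exp_add[symmetric]) simp
  finally show ?thesis unfolding M_def b_def .
qed

text \<open>The bias between the means under \<open>\<theta>\<close> and \<open>\<eta>\<close> consists of Fourier coefficients of the difference
  of the densities.\<close>

lemma noise_change_center:
  assumes \<theta>: "bounded_exponent B \<theta>" and \<eta>: "bounded_exponent B \<eta>"
  shows "noise n X N \<eta> \<le> noise n X N \<theta> + sqrt (exp (4 * B) * (1 + exp (4 * B)) * coeff_dist_sq \<theta> \<eta>)"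
proof -
  have "(\<Sum>j<N. (feature_mean \<theta> (Suc j) - feature_mean \<eta> (Suc j))\<^sup>2)
      = (\<Sum>j<N. (\<integral>x. phi (Suc j) x * (dens \<theta> x - dens \<eta> x) \<partial>leb01)\<^sup>2)"
  proof (intro sum.cong refl arg_cong[where f = "\<lambda>x. x\<^sup>2"])
    fix j
    have i: "integrable leb01 (\<lambda>x. dens \<zeta> x * phi (Suc j) x)" if "bounded_exponent B \<zeta>" for \<zeta>
      using abs_phi_le dens_bounds[OF that] less_imp_le[OF dens_pos[OF that]]
      by (intro integrable_leb01_bounded[where C = "exp (2 * B) * sqrt 2"]) (auto simp: abs_mult intro!: mult_mono)
    show "feature_mean \<theta> (Suc j) - feature_mean \<eta> (Suc j)
        = (\<integral>x. phi (Suc j) x * (dens \<theta> x - dens \<eta> x) \<partial>leb01)"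
      unfolding feature_mean_def integral_Ptheta[OF \<theta> phi_borel] integral_Ptheta[OF \<eta> phi_borel]
      using i[OF \<theta>] i[OF \<eta>] by (subst Bochner_Integration.integral_diff[symmetric]) (auto simp: algebra_simps)
  qed
  also have "\<dots> \<le> (\<integral>x. (dens \<theta> x - dens \<eta> x)\<^sup>2 \<partial>leb01)"
  proof (rule bessel)
    show "\<bar>dens \<theta> x - dens \<eta> x\<bar> \<le> exp (2 * B)" for x
      using dens_bounds[OF \<theta>, of x] dens_bounds[OF \<eta>, of x] dens_pos[OF \<theta>, of x] dens_pos[OF \<eta>, of x]
      by (simp add: abs_le_iff)
  qed measurable
  also have "\<dots> \<le> exp (4 * B) * (1 + exp (4 * B)) * coeff_dist_sq \<theta> \<eta>"
    by (rule integral_dens_diff_sq_le[OF \<theta> \<eta>])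
  finally have bias: "sqrt (\<Sum>j<N. (feature_mean \<theta> (Suc j) - feature_mean \<eta> (Suc j))\<^sup>2)
      \<le> sqrt (exp (4 * B) * (1 + exp (4 * B)) * coeff_dist_sq \<theta> \<eta>)" by simp
  have "noise n X N \<eta> \<le> noise n X N \<theta> + sqrt (\<Sum>j<N. (feature_mean \<theta> (Suc j) - feature_mean \<eta> (Suc j))\<^sup>2)"
    using L2_set_triangle_ineq[of "\<lambda>j. empirical_mean n X (Suc j) - feature_mean \<theta> (Suc j)"
        "\<lambda>j. feature_mean \<theta> (Suc j) - feature_mean \<eta> (Suc j)" "{..<N}"]
    unfolding noise_def L2_set_def by simp
  with bias show ?thesis by linarith
qed

section \<open>Prior mass near the truth\<close>

lemma power_le_fact_mult_exp:
  fixes x :: real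
  assumes "0 \<le> x"
  shows "x ^ n \<le> fact n * exp x"
proof -
  obtain t where "exp x = (\<Sum>m<Suc n. x ^ m / fact m) + exp t / fact (Suc n) * x ^ Suc n"
    using Maclaurin_exp_le by blast
  moreover have "0 \<le> exp t / fact (Suc n) * x ^ Suc n" "0 \<le> (\<Sum>m<n. x ^ m / fact m)"
    using assms by (auto intro!: sum_nonneg)
  ultimately have "x ^ n / fact n \<le> exp x" by simp
  then show ?thesis by (simp add: field_simps)
qed

text \<open>The length of the interval times a lower bound of the density on it; the exponent uses
  \<open>x\<^sup>2 \<le> 2 a\<^sup>2 + 2 (x - a)\<^sup>2\<close> and the constant \<open>2 \<pi> \<le> 16\<close>.\<close>

lemma normal_interval_mass:
  assumes s: "0 < s" and d: "0 < d"
  shows "emeasure (density lborel (\<lambda>x. ennreal (normal_density 0 s x))) {a - d..a + d}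
    \<ge> ennreal (d / (2 * s) * exp (- (a\<^sup>2 + d\<^sup>2) / s\<^sup>2))"
proof -
  define c where "c = 1 / (4 * s) * exp (- (a\<^sup>2 + d\<^sup>2) / s\<^sup>2)"
  have c0: "c \<ge> 0" using s by (simp add: c_def)
  have low: "c \<le> normal_density 0 s x" if x: "x \<in> {a - d..a + d}" for x
  proof -
    have "\<bar>x - a\<bar> \<le> d" using x by auto
    from power_mono[OF this abs_ge_zero, of 2] have "(x - a)\<^sup>2 \<le> d\<^sup>2" by simp
    moreover have "x\<^sup>2 \<le> 2 * a\<^sup>2 + 2 * (x - a)\<^sup>2"
      using zero_le_power2[of "x - 2 * a"] by (simp add: power2_diff algebra_simps)
    ultimately have "x\<^sup>2 / (2 * s\<^sup>2) \<le> (2 * (a\<^sup>2 + d\<^sup>2)) / (2 * s\<^sup>2)"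
      by (intro divide_right_mono) auto
    also have "\<dots> = (a\<^sup>2 + d\<^sup>2) / s\<^sup>2" by (rule mult_divide_mult_cancel_left) simp
    finally have e: "exp (- (a\<^sup>2 + d\<^sup>2) / s\<^sup>2) \<le> exp (- x\<^sup>2 / (2 * s\<^sup>2))"
      by (simp only: exp_le_cancel_iff minus_divide_left[symmetric] neg_le_iff_le)
    have "sqrt (2 * pi * s\<^sup>2) \<le> sqrt (4\<^sup>2 * s\<^sup>2)"
      using pi_less_4 s by (intro real_sqrt_le_mono mult_right_mono) auto
    also have "\<dots> = 4 * s" using s by (simp add: real_sqrt_mult)
    finally have "1 / (4 * s) \<le> 1 / sqrt (2 * pi * s\<^sup>2)"
      using s by (intro divide_left_mono) auto
    with e show ?thesis unfolding c_def normal_density_def using s by (intro mult_mono) auto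
  qed
  have "ennreal (d / (2 * s) * exp (- (a\<^sup>2 + d\<^sup>2) / s\<^sup>2)) = ennreal c * ennreal (2 * d)"
    using d c0 by (simp add: ennreal_mult[symmetric] c_def)
  also have "\<dots> = (\<integral>\<^sup>+x. ennreal c * indicator {a - d..a + d} x \<partial>lborel)"
    using d by (simp add: nn_integral_cmult_indicator)
  also have "\<dots> \<le> (\<integral>\<^sup>+x. ennreal (normal_density 0 s x) * indicator {a - d..a + d} x \<partial>lborel)"
    using low by (intro nn_integral_mono) (auto simp: indicator_def intro!: ennreal_leI)
  also have "\<dots> = emeasure (density lborel (\<lambda>x. ennreal (normal_density 0 s x))) {a - d..a + d}"
    by (simp add: emeasure_density)
  finally show ?thesis .
qed

lemma sets_gauss_prior [measurable_cong]: "sets (gauss_prior p N) = sets (Pi\<^sub>M UNIV (\<lambda>_. borel))"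
  unfolding gauss_prior_def by (intro sets_PiM_cong) auto

lemma space_gauss_prior: "space (gauss_prior p N) = UNIV"
  using sets_eq_imp_space_eq[OF sets_gauss_prior] by (auto simp: space_PiM)

lemma sieve_ellipsoid_sets: "sieve_ellipsoid p N Q \<in> sets (gauss_prior p N)"
proof -
  have "{\<theta> \<in> space (gauss_prior p N). (\<forall>j. N < j \<longrightarrow> \<theta> j = 0) \<and> (\<Sum>j\<le>N. vseq j ^ (2 * p) * (\<theta> j)\<^sup>2) < Q}
      \<in> sets (gauss_prior p N)"
    by measurable
  then show ?thesis by (simp add: sieve_ellipsoid_def space_gauss_prior)
qed

lemma prob_space_gauss_factor:
  "prob_space (if 1 \<le> j \<and> j \<le> N
      then density lborel (\<lambda>x. ennreal (normal_density 0 (sqrt (1 / vseq j ^ (2 * p + 1))) x))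
      else return borel 0)"
proof (cases "1 \<le> j \<and> j \<le> N")
  case True
  then obtain i where "j = Suc i" by (cases j) auto
  then have "0 < sqrt (1 / vseq j ^ (2 * p + 1))" using vseq_pos[of i] by simp
  then show ?thesis using True prob_space_normal_density by auto
next
  case False
  then show ?thesis by (auto intro: prob_space_return)
qed

lemma prob_space_gauss_prior: "prob_space (gauss_prior p N)"
  unfolding gauss_prior_def by (intro prob_space_PiM prob_space_gauss_factor)

lemma gauss_prior_AE_support: "AE \<theta> in gauss_prior p N. \<forall>j. (j = 0 \<or> N < j) \<longrightarrow> \<theta> j = 0"
proof -
  define G where "G j = (if 1 \<le> j \<and> j \<le> N
      then density lborel (\<lambda>x. ennreal (normal_density 0 (sqrt (1 / vseq j ^ (2 * p + 1))) x))
      else return borel 0)" for j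
  interpret prob_space "G j" for j unfolding G_def by (rule prob_space_gauss_factor)
  interpret product_prob_space G UNIV by unfold_locales
  have "AE \<theta> in Pi\<^sub>M UNIV G. (j = 0 \<or> N < j) \<longrightarrow> \<theta> j = 0" for j
  proof (cases "j = 0 \<or> N < j")
    case True
    then have "G j = return borel 0" by (auto simp: G_def)
    moreover have "AE x in return borel (0 :: real). x = 0"
      by (subst AE_return) simp_all
    ultimately have "AE x in G j. x = 0" by (simp only:)
    from AE_component[OF UNIV_I this] show ?thesis by eventually_elim simp
  qed simp
  then show ?thesis unfolding gauss_prior_def G_def[symmetric] by (simp add: AE_all_countable)
qed

text \<open>The inequality defining the ellipsoid is strict, so sieve parameters whose first coordinates are
  close to those of \<open>\<theta>\<^sub>0\<close> in the weighted norm stay inside, with a radius independent of the dimension.\<close>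

lemma ellipsoid_slack:
  assumes Q: "0 < Q" and \<theta>\<^sub>0: "\<theta>\<^sub>0 \<in> ellipsoid p Q"
  obtains r where "0 < r" "r \<le> 1"
    "\<And>N \<theta>. (\<And>j. N < j \<Longrightarrow> \<theta> j = 0) \<Longrightarrow> (\<Sum>j\<le>N. vseq j ^ (2 * p) * (\<theta> j - \<theta>\<^sub>0 j)\<^sup>2) \<le> r\<^sup>2
      \<Longrightarrow> \<theta> \<in> sieve_ellipsoid p N Q"
proof -
  define Q0 where "Q0 = (\<Sum>j. vseq j ^ (2 * p) * (\<theta>\<^sub>0 j)\<^sup>2)"
  have Q0: "Q0 < Q" "0 \<le> Q0"
    using \<theta>\<^sub>0 by (auto simp: ellipsoid_def Q0_def intro!: suminf_nonneg)
  \<comment> \<open>With \<open>t\<close> this small, \<open>(x + y)\<^sup>2 \<le> (1 + t) x\<^sup>2 + (1 + 1 / t) y\<^sup>2\<close> keeps the first term below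
    the midpoint of \<open>Q0\<close> and \<open>Q\<close>; \<open>r\<close> then keeps the second below half of what is left.\<close>
  define t where "t = (Q - Q0) / (2 * Q)"
  have t: "t > 0" using Q Q0 by (simp add: t_def)
  define r where "r = min 1 (sqrt ((Q - Q0) / (4 * (1 + 1 / t))))"
  have r: "0 < r" "r \<le> 1" using Q0 t by (auto simp: r_def intro!: divide_pos_pos add_pos_pos mult_pos_pos)
  have rt: "(1 + 1 / t) * r\<^sup>2 \<le> (Q - Q0) / 4"
  proof -
    have "r\<^sup>2 \<le> (sqrt ((Q - Q0) / (4 * (1 + 1 / t))))\<^sup>2" using r by (intro power_mono) (auto simp: r_def)
    also have "\<dots> = (Q - Q0) / (4 * (1 + 1 / t))" using Q0 t by simp
    finally have "(1 + 1 / t) * r\<^sup>2 \<le> (1 + 1 / t) * ((Q - Q0) / (4 * (1 + 1 / t)))"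
      using t by (intro mult_left_mono) auto
    also have "\<dots> = (Q - Q0) / 4" using t add_pos_pos[of 1 "1 / t"] by (simp add: divide_simps)
    finally show ?thesis .
  qed
  show ?thesis
  proof (rule that[OF r])
    fix N :: nat and \<theta> :: "nat \<Rightarrow> real"
    assume supp: "\<And>j. N < j \<Longrightarrow> \<theta> j = 0"
      and close: "(\<Sum>j\<le>N. vseq j ^ (2 * p) * (\<theta> j - \<theta>\<^sub>0 j)\<^sup>2) \<le> r\<^sup>2"
    have sq: "(\<theta> j)\<^sup>2 \<le> (1 + t) * (\<theta>\<^sub>0 j)\<^sup>2 + (1 + 1 / t) * (\<theta> j - \<theta>\<^sub>0 j)\<^sup>2" for j
    proof -
      have gen: "(x + y)\<^sup>2 \<le> (1 + t) * x\<^sup>2 + (1 + 1 / t) * y\<^sup>2" for x y :: real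
      proof -
        have "0 \<le> (t * x - y)\<^sup>2 / t" using t by simp
        also have "\<dots> = t * x\<^sup>2 - 2 * x * y + y\<^sup>2 / t"
          using t by (simp add: power2_eq_square field_simps)
        finally show ?thesis by (simp add: power2_sum algebra_simps)
      qed
      show ?thesis using gen[of "\<theta>\<^sub>0 j" "\<theta> j - \<theta>\<^sub>0 j"] by simp
    qed
    have "(\<Sum>j\<le>N. vseq j ^ (2 * p) * (\<theta> j)\<^sup>2)
        \<le> (\<Sum>j\<le>N. vseq j ^ (2 * p) * ((1 + t) * (\<theta>\<^sub>0 j)\<^sup>2 + (1 + 1 / t) * (\<theta> j - \<theta>\<^sub>0 j)\<^sup>2))"
      by (intro sum_mono mult_left_mono sq) (simp add: vseq_def)
    also have "\<dots> = (1 + t) * (\<Sum>j\<le>N. vseq j ^ (2 * p) * (\<theta>\<^sub>0 j)\<^sup>2)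
        + (1 + 1 / t) * (\<Sum>j\<le>N. vseq j ^ (2 * p) * (\<theta> j - \<theta>\<^sub>0 j)\<^sup>2)"
      unfolding sum_distrib_left sum.distrib[symmetric]
      by (intro sum.cong refl) (simp only: distrib_left mult.left_commute)
    also have "\<dots> \<le> (1 + t) * Q0 + (1 + 1 / t) * r\<^sup>2"
      using t close \<theta>\<^sub>0 unfolding Q0_def
      by (intro add_mono mult_left_mono sum_le_suminf) (auto simp: ellipsoid_def)
    also have "\<dots> \<le> Q0 + (Q - Q0) / 2 + (Q - Q0) / 4"
    proof -
      have "t * Q0 \<le> t * Q" using t Q0 by (intro mult_left_mono) auto
      also have "\<dots> = (Q - Q0) / 2" using Q by (simp add: t_def)
      finally show ?thesis using rt by (simp add: distrib_right)
    qed
    also have "\<dots> < Q" using Q0 by (simp add: field_simps)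
    finally show "\<theta> \<in> sieve_ellipsoid p N Q" using supp by (simp add: sieve_ellipsoid_def)
  qed
qed

lemma le_divide_ennreal:
  fixes x y :: ennreal
  assumes "y \<le> 1"
  shows "x \<le> x / y"
proof (cases "y = 0")
  case False
  then obtain m where m: "y = ennreal m" "0 < m" "m \<le> 1"
    using assms by (cases y) (auto simp: ennreal_le_1 top_unique)
  show ?thesis
  proof (cases x)
    case (real a)
    then show ?thesis using m mult_left_mono[of m 1 a]
      by (simp add: divide_ennreal le_divide_eq ennreal_le_iff)
  next
    case top
    then show ?thesis using m by (simp add: ennreal_top_divide)
  qed
qed (cases "x = 0"; simp add: divide_ennreal_def ennreal_mult_top)

text \<open>The set \<open>A\<close> is the part in the sieve of a box around \<open>\<theta>\<^sub>0\<close> whose half-width \<open>\<delta>\<close> is the same in all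
  coordinates and proportional to \<open>(N + 1)\<^sup>-\<^sup>(\<^sup>p\<^sup>+\<^sup>1\<^sup>/\<^sup>2\<^sup>)\<close>; this is small enough to remain in the ellipsoid and
  to have distance of order \<open>N\<^sup>-\<^sup>p\<close> from the truncation. Relative to the standard deviation of the
  \<open>j\<close>-th coordinate, \<open>\<delta>\<close> is at least a constant times \<open>(j / (N + 1))\<^sup>p\<^sup>+\<^sup>1\<close>, so the product of the interval
  masses is governed by \<open>N! / (N + 1)\<^sup>N \<ge> exp (- (N + 1))\<close>. The Gaussian exponents sum to \<open>O(N)\<close> because
  \<open>v\<^sub>j\<^sup>2\<^sup>p\<^sup>+\<^sup>1 \<le> (N + 1) v\<^sub>j\<^sup>2\<^sup>p\<close> and \<open>\<theta>\<^sub>0\<close> lies in the ellipsoid. Conditioning on the sieve only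
  increases the mass.\<close>

lemma sieve_prior_mass:
  assumes p: "1 \<le> p" and Q: "0 < Q" and \<theta>\<^sub>0: "\<theta>\<^sub>0 \<in> ellipsoid p Q"
  obtains c where "0 < c"
    "\<And>N. 0 < N \<Longrightarrow> \<exists>A \<in> sets (gauss_prior p N).
       (\<forall>\<theta>\<in>A. \<theta> \<in> sieve_ellipsoid p N Q \<and> coeff_dist_sq \<theta> (truncate N \<theta>\<^sub>0) \<le> 1 / (real N + 1) ^ (2 * p))
       \<and> ennreal (exp (- c * (real N + 1))) \<le> emeasure (sieve_prior p N Q) A"
proof -
  obtain r where r: "0 < r" "r \<le> 1"
    and slack: "\<And>N \<theta>. (\<And>j. N < j \<Longrightarrow> \<theta> j = 0)
      \<Longrightarrow> (\<Sum>j\<le>N. vseq j ^ (2 * p) * (\<theta> j - \<theta>\<^sub>0 j)\<^sup>2) \<le> r\<^sup>2 \<Longrightarrow> \<theta> \<in> sieve_ellipsoid p N Q"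
    using ellipsoid_slack[OF Q \<theta>\<^sub>0] by blast
  define c where "c = real (p + 1) + (Q + r\<^sup>2) + ln (2 / r)"
  have lnr: "0 < ln (2 / r)" using r by simp
  have c: "c > 0" unfolding c_def using Q lnr by (intro add_nonneg_pos) auto
  show ?thesis
  proof (rule that[OF c])
    fix N :: nat assume N: "0 < N"
    define G where "G j = (if 1 \<le> j \<and> j \<le> N
        then density lborel (\<lambda>x. ennreal (normal_density 0 (sqrt (1 / vseq j ^ (2 * p + 1))) x))
        else return borel 0)" for j
    interpret G: prob_space "G j" for j unfolding G_def by (rule prob_space_gauss_factor)
    interpret product_prob_space G UNIV by unfold_locales
    let ?\<mu> = "gauss_prior p N"
    have \<mu>: "?\<mu> = Pi\<^sub>M UNIV G" unfolding gauss_prior_def G_def ..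
    define n1 where "n1 = real N + 1"
    have n1: "n1 > 0" by (simp add: n1_def)
    define \<delta> where "\<delta> = r / sqrt (n1 ^ (2 * p + 1))"
    have \<delta>: "\<delta> > 0" using r n1 by (simp add: \<delta>_def)
    have \<delta>2: "\<delta>\<^sup>2 = r\<^sup>2 / n1 ^ (2 * p + 1)" using n1 by (simp add: \<delta>_def power_divide)
    define C where "C = {\<theta> \<in> space ?\<mu>. \<forall>j\<in>{1..N}. \<theta> j \<in> {\<theta>\<^sub>0 j - \<delta>..\<theta>\<^sub>0 j + \<delta>}}"
    define A where "A = C \<inter> sieve_ellipsoid p N Q"
    have C_sets: "C \<in> sets ?\<mu>" unfolding C_def by measurable
    have A_sets: "A \<in> sets ?\<mu>" unfolding A_def by (intro sets.Int C_sets sieve_ellipsoid_sets)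
    have v_le: "vseq (Suc j) \<le> n1" if "j < N" for j
      using vseq_le_dim[of "Suc j" N] that by (simp add: n1_def)
    have in_C: "(\<theta> (Suc j) - \<theta>\<^sub>0 (Suc j))\<^sup>2 \<le> \<delta>\<^sup>2" if "\<theta> \<in> C" "j < N" for \<theta> j
    proof -
      have "\<theta> (Suc j) \<in> {\<theta>\<^sub>0 (Suc j) - \<delta>..\<theta>\<^sub>0 (Suc j) + \<delta>}" using that by (simp add: C_def)
      then have "\<bar>\<theta> (Suc j) - \<theta>\<^sub>0 (Suc j)\<bar> \<le> \<delta>" by (auto simp: abs_le_iff)
      from power_mono[OF this abs_ge_zero, of 2] show ?thesis by simp
    qed
    have N\<delta>: "real N * \<delta>\<^sup>2 \<le> r\<^sup>2 / n1 ^ (2 * p)"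
    proof -
      have "real N * \<delta>\<^sup>2 \<le> n1 * \<delta>\<^sup>2" by (intro mult_right_mono) (auto simp: n1_def)
      also have "\<dots> = r\<^sup>2 / n1 ^ (2 * p)" using n1 by (simp add: \<delta>2)
      finally show ?thesis .
    qed
    have C_sieve: "\<theta> \<in> sieve_ellipsoid p N Q" if \<theta>: "\<theta> \<in> C" and supp: "\<And>j. N < j \<Longrightarrow> \<theta> j = 0" for \<theta>
    proof (rule slack[OF supp])
      have "(\<Sum>j\<le>N. vseq j ^ (2 * p) * (\<theta> j - \<theta>\<^sub>0 j)\<^sup>2)
          = (\<Sum>j<N. vseq (Suc j) ^ (2 * p) * (\<theta> (Suc j) - \<theta>\<^sub>0 (Suc j))\<^sup>2)"
        using p by (simp add: sum.atMost_shift vseq_def)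
      also have "\<dots> \<le> (\<Sum>j<N. n1 ^ (2 * p) * \<delta>\<^sup>2)"
      proof (rule sum_mono, rule mult_mono)
        fix j assume "j \<in> {..<N}"
        then show "(\<theta> (Suc j) - \<theta>\<^sub>0 (Suc j))\<^sup>2 \<le> \<delta>\<^sup>2" "vseq (Suc j) ^ (2 * p) \<le> n1 ^ (2 * p)"
          using in_C[OF \<theta>] v_le vseq_pos[of j] by (auto intro: power_mono)
      qed (use n1 in auto)
      also have "\<dots> = n1 ^ (2 * p) * (real N * \<delta>\<^sup>2)" by simp
      also have "\<dots> \<le> n1 ^ (2 * p) * (r\<^sup>2 / n1 ^ (2 * p))" using n1 by (intro mult_left_mono N\<delta>) auto
      also have "\<dots> = r\<^sup>2" using n1 by simp
      finally show "(\<Sum>j\<le>N. vseq j ^ (2 * p) * (\<theta> j - \<theta>\<^sub>0 j)\<^sup>2) \<le> r\<^sup>2" .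
    qed
    have near: "coeff_dist_sq \<theta> (truncate N \<theta>\<^sub>0) \<le> 1 / (real N + 1) ^ (2 * p)" if "\<theta> \<in> A" for \<theta>
    proof -
      have "coeff_dist_sq \<theta> (truncate N \<theta>\<^sub>0) = (\<Sum>j<N. (\<theta> (Suc j) - truncate N \<theta>\<^sub>0 (Suc j))\<^sup>2)"
        using that by (intro coeff_dist_sq_finite) (auto simp: A_def sieve_ellipsoid_def truncate_def)
      also have "\<dots> \<le> (\<Sum>j<N. \<delta>\<^sup>2)"
        using in_C that by (intro sum_mono) (auto simp: truncate_def A_def)
      also have "\<dots> \<le> r\<^sup>2 / n1 ^ (2 * p)" using N\<delta> by simp
      also have "\<dots> \<le> 1 / n1 ^ (2 * p)"
        using r n1 by (intro divide_right_mono) (auto simp: power_le_one)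
      finally show ?thesis by (simp add: n1_def)
    qed
    \<comment> \<open>The mass of the box, one coordinate at a time.\<close>
    define w where "w j = r / 2 * (real (Suc j) / n1) ^ (p + 1)
        * exp (- ((\<theta>\<^sub>0 (Suc j))\<^sup>2 + \<delta>\<^sup>2) * vseq (Suc j) ^ (2 * p + 1))" for j
    have w_le: "ennreal (w j) \<le> emeasure (G (Suc j)) {\<theta>\<^sub>0 (Suc j) - \<delta>..\<theta>\<^sub>0 (Suc j) + \<delta>}" if j: "j < N" for j
    proof -
      define v where "v = vseq (Suc j)"
      have v: "v > 0" unfolding v_def by (rule vseq_pos)
      define s where "s = sqrt (1 / v ^ (2 * p + 1))"
      have s: "s > 0" "s\<^sup>2 = 1 / v ^ (2 * p + 1)" using v by (simp_all add: s_def)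
      define u where "u = real (Suc j) / n1"
      have u: "0 \<le> u" "u \<le> 1" "u \<le> v / n1"
        using j vseq_ge[of "Suc j"] n1 by (auto simp: u_def n1_def v_def intro: divide_right_mono)
      have "u ^ (p + 1) = sqrt (u ^ (2 * p + 2))"
      proof -
        have "2 * p + 2 = (p + 1) * 2" by simp
        then have "u ^ (2 * p + 2) = (u ^ (p + 1))\<^sup>2" by (simp only: power_mult)
        then show ?thesis using u by simp
      qed
      also have "\<dots> \<le> sqrt (u ^ (2 * p + 1))" using u by (intro real_sqrt_le_mono power_decreasing) auto
      also have "\<dots> \<le> sqrt ((v / n1) ^ (2 * p + 1))" using u by (intro real_sqrt_le_mono power_mono) auto
      also have "\<dots> = sqrt (v ^ (2 * p + 1)) / sqrt (n1 ^ (2 * p + 1))"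
        by (simp only: power_divide real_sqrt_divide)
      finally have "r / 2 * u ^ (p + 1) \<le> r / 2 * (sqrt (v ^ (2 * p + 1)) / sqrt (n1 ^ (2 * p + 1)))"
        using r by (intro mult_left_mono) auto
      also have "\<dots> = \<delta> / (2 * s)" unfolding \<delta>_def s_def by (simp add: real_sqrt_divide)
      finally have "r / 2 * u ^ (p + 1) * exp (- ((\<theta>\<^sub>0 (Suc j))\<^sup>2 + \<delta>\<^sup>2) / s\<^sup>2)
          \<le> \<delta> / (2 * s) * exp (- ((\<theta>\<^sub>0 (Suc j))\<^sup>2 + \<delta>\<^sup>2) / s\<^sup>2)"
        by (rule mult_right_mono) simp
      then have "w j \<le> \<delta> / (2 * s) * exp (- ((\<theta>\<^sub>0 (Suc j))\<^sup>2 + \<delta>\<^sup>2) / s\<^sup>2)"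
        unfolding w_def u_def[symmetric] v_def[symmetric] s(2) by (simp only: div_by_1 divide_divide_eq_right)
      then have "ennreal (w j) \<le> ennreal (\<delta> / (2 * s) * exp (- ((\<theta>\<^sub>0 (Suc j))\<^sup>2 + \<delta>\<^sup>2) / s\<^sup>2))"
        by (rule ennreal_leI)
      also have "\<dots> \<le> emeasure (G (Suc j)) {\<theta>\<^sub>0 (Suc j) - \<delta>..\<theta>\<^sub>0 (Suc j) + \<delta>}"
        using normal_interval_mass[OF s(1) \<delta>] j by (simp add: G_def s_def v_def)
      finally show ?thesis .
    qed
    have w0: "w j \<ge> 0" for j using r n1 by (simp add: w_def)
    have "exp (- c * n1) \<le> (\<Prod>j<N. w j)"
    proof -
      have "(\<Prod>j<N. w j) = (r / 2) ^ N * (\<Prod>j<N. real (Suc j) / n1) ^ (p + 1)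
          * exp (\<Sum>j<N. - ((\<theta>\<^sub>0 (Suc j))\<^sup>2 + \<delta>\<^sup>2) * vseq (Suc j) ^ (2 * p + 1))"
        unfolding w_def prod.distrib prod_power_distrib exp_sum[OF finite_lessThan]
        by (simp only: prod_constant card_lessThan)
      moreover have "exp (- ln (2 / r) * n1) \<le> (r / 2) ^ N"
      proof -
        have "exp (- ln (2 / r) * n1) \<le> exp (- ln (2 / r) * real N)"
          using lnr by (simp add: n1_def)
        also have "\<dots> = (r / 2) ^ N"
          using r by (simp add: exp_of_nat2_mult ln_div exp_diff)
        finally show ?thesis .
      qed
      moreover have "exp (- real (p + 1) * n1) \<le> (\<Prod>j<N. real (Suc j) / n1) ^ (p + 1)"
      proof -
        have "(\<Prod>j<N. real (Suc j)) = fact N"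
          by (induction N) (auto simp: algebra_simps)
        then have "(\<Prod>j<N. real (Suc j) / n1) = fact N / n1 ^ N"
          by (simp add: prod_dividef)
        moreover have "exp (- n1) \<le> fact N / n1 ^ N"
          using power_le_fact_mult_exp[of n1 N] n1 by (simp add: exp_minus field_simps)
        ultimately have "exp (- n1) ^ (p + 1) \<le> (\<Prod>j<N. real (Suc j) / n1) ^ (p + 1)"
          by (intro power_mono) auto
        then show ?thesis
          by (simp only: exp_of_nat_mult[symmetric] mult_minus_left mult_minus_right)
      qed
      moreover have "exp (- (Q + r\<^sup>2) * n1)
          \<le> exp (\<Sum>j<N. - ((\<theta>\<^sub>0 (Suc j))\<^sup>2 + \<delta>\<^sup>2) * vseq (Suc j) ^ (2 * p + 1))"
      proof -
        have "(\<Sum>j<N. ((\<theta>\<^sub>0 (Suc j))\<^sup>2 + \<delta>\<^sup>2) * vseq (Suc j) ^ (2 * p + 1))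
            \<le> (\<Sum>j<N. n1 * (vseq (Suc j) ^ (2 * p) * (\<theta>\<^sub>0 (Suc j))\<^sup>2) + r\<^sup>2)"
        proof (rule sum_mono)
          fix j assume j: "j \<in> {..<N}"
          have v0: "0 \<le> vseq (Suc j)" using vseq_pos[of j] by simp
          have "(\<theta>\<^sub>0 (Suc j))\<^sup>2 * vseq (Suc j) ^ (2 * p + 1) = vseq (Suc j) * (vseq (Suc j) ^ (2 * p) * (\<theta>\<^sub>0 (Suc j))\<^sup>2)"
            by simp
          also have "\<dots> \<le> n1 * (vseq (Suc j) ^ (2 * p) * (\<theta>\<^sub>0 (Suc j))\<^sup>2)"
            using v_le j v0 by (intro mult_right_mono) auto
          finally have 1: "(\<theta>\<^sub>0 (Suc j))\<^sup>2 * vseq (Suc j) ^ (2 * p + 1) \<le> n1 * (vseq (Suc j) ^ (2 * p) * (\<theta>\<^sub>0 (Suc j))\<^sup>2)" .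
          have "\<delta>\<^sup>2 * vseq (Suc j) ^ (2 * p + 1) \<le> \<delta>\<^sup>2 * n1 ^ (2 * p + 1)"
            using v_le j v0 by (intro mult_left_mono power_mono) auto
          also have "\<dots> = r\<^sup>2" unfolding \<delta>2 using n1 by simp
          finally have "\<delta>\<^sup>2 * vseq (Suc j) ^ (2 * p + 1) \<le> r\<^sup>2" .
          with 1 show "((\<theta>\<^sub>0 (Suc j))\<^sup>2 + \<delta>\<^sup>2) * vseq (Suc j) ^ (2 * p + 1)
              \<le> n1 * (vseq (Suc j) ^ (2 * p) * (\<theta>\<^sub>0 (Suc j))\<^sup>2) + r\<^sup>2"
            unfolding distrib_right by (rule add_mono)
        qed
        also have "\<dots> = n1 * (\<Sum>j<N. vseq (Suc j) ^ (2 * p) * (\<theta>\<^sub>0 (Suc j))\<^sup>2) + real N * r\<^sup>2"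
          by (simp add: sum.distrib sum_distrib_left)
        also have "\<dots> \<le> n1 * Q + n1 * r\<^sup>2"
        proof (intro add_mono mult_left_mono)
          have "(\<Sum>j<N. vseq (Suc j) ^ (2 * p) * (\<theta>\<^sub>0 (Suc j))\<^sup>2) \<le> (\<Sum>j\<le>N. vseq j ^ (2 * p) * (\<theta>\<^sub>0 j)\<^sup>2)"
            using p by (simp add: sum.atMost_shift vseq_def)
          also have "\<dots> \<le> (\<Sum>j. vseq j ^ (2 * p) * (\<theta>\<^sub>0 j)\<^sup>2)"
            using \<theta>\<^sub>0 by (intro sum_le_suminf) (auto simp: ellipsoid_def)
          also have "\<dots> \<le> Q" using \<theta>\<^sub>0 by (simp add: ellipsoid_def)
          finally show "(\<Sum>j<N. vseq (Suc j) ^ (2 * p) * (\<theta>\<^sub>0 (Suc j))\<^sup>2) \<le> Q" .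
          show "real N * r\<^sup>2 \<le> n1 * r\<^sup>2" by (intro mult_right_mono) (auto simp: n1_def)
        qed (use n1 in auto)
        finally have S: "(\<Sum>j<N. ((\<theta>\<^sub>0 (Suc j))\<^sup>2 + \<delta>\<^sup>2) * vseq (Suc j) ^ (2 * p + 1)) \<le> n1 * Q + n1 * r\<^sup>2" .
        have "(Q + r\<^sup>2) * n1 = n1 * Q + n1 * r\<^sup>2" by (simp add: algebra_simps)
        then show ?thesis
          unfolding exp_le_cancel_iff mult_minus_left sum_negf neg_le_iff_le using S by (simp only:)
      qed
      ultimately have "exp (- ln (2 / r) * n1) * exp (- real (p + 1) * n1) * exp (- (Q + r\<^sup>2) * n1) \<le> (\<Prod>j<N. w j)"
        using r n1 by (simp only:) (intro mult_mono mult_nonneg_nonneg zero_le_power prod_nonneg ballI exp_ge_zero; simp)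
      then show ?thesis unfolding c_def by (simp add: exp_add[symmetric] algebra_simps)
    qed
    then have "ennreal (exp (- c * n1)) \<le> ennreal (\<Prod>j<N. w j)" by (rule ennreal_leI)
    also have "\<dots> = (\<Prod>j<N. ennreal (w j))" using w0 by (simp add: prod_ennreal)
    also have "\<dots> \<le> (\<Prod>j<N. emeasure (G (Suc j)) {\<theta>\<^sub>0 (Suc j) - \<delta>..\<theta>\<^sub>0 (Suc j) + \<delta>})"
      by (intro prod_mono_ennreal w_le) auto
    also have "\<dots> = (\<Prod>j\<in>{1..N}. emeasure (G j) {\<theta>\<^sub>0 j - \<delta>..\<theta>\<^sub>0 j + \<delta>})"
      by (simp add: prod.atLeast1_atMost_eq)
    also have "\<dots> = emeasure ?\<mu> C"
      unfolding C_def \<mu> by (rule emeasure_PiM_Collect[symmetric]) (auto simp: G_def)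
    also have "\<dots> = emeasure ?\<mu> A"
    proof (rule emeasure_eq_AE[OF _ C_sets A_sets])
      show "AE \<theta> in ?\<mu>. (\<theta> \<in> C) = (\<theta> \<in> A)"
        using gauss_prior_AE_support[where p = p and N = N]
      proof eventually_elim
        case (elim \<theta>)
        then show ?case using C_sieve[of \<theta>] unfolding A_def by blast
      qed
    qed
    also have "\<dots> \<le> emeasure ?\<mu> A / emeasure ?\<mu> (sieve_ellipsoid p N Q)"
      using prob_space.emeasure_le_1[OF prob_space_gauss_prior] by (intro le_divide_ennreal)
    also have "\<dots> = emeasure (sieve_prior p N Q) A"
      unfolding sieve_prior_def
      by (subst emeasure_uniform_measure) (use A_sets sieve_ellipsoid_sets in \<open>auto simp: A_def Int_commute Int_left_commute\<close>)
    finally show "\<exists>A \<in> sets ?\<mu>.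
       (\<forall>\<theta>\<in>A. \<theta> \<in> sieve_ellipsoid p N Q \<and> coeff_dist_sq \<theta> (truncate N \<theta>\<^sub>0) \<le> 1 / (real N + 1) ^ (2 * p))
       \<and> ennreal (exp (- c * (real N + 1))) \<le> emeasure (sieve_prior p N Q) A"
      using A_sets near unfolding n1_def A_def by blast
  qed
qed

section \<open>The posterior bound on a good event\<close>

lemma coeff_dist_sq_commute: "coeff_dist_sq \<theta> \<eta> = coeff_dist_sq \<eta> \<theta>"
  unfolding coeff_dist_sq_def by (simp add: power2_commute)

lemma coeff_dist_sq_triangle:
  assumes "bounded_exponent B \<theta>" "bounded_exponent B \<eta>" "bounded_exponent B \<zeta>"
  shows "coeff_dist_sq \<theta> \<zeta> \<le> 2 * coeff_dist_sq \<theta> \<eta> + 2 * coeff_dist_sq \<eta> \<zeta>"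
proof -
  have s: "summable (\<lambda>j. (\<alpha> (Suc j) - \<beta> (Suc j))\<^sup>2)" if "bounded_exponent B \<alpha>" "bounded_exponent B \<beta>" for \<alpha> \<beta>
    using summable_sq_coeffs[OF abs_summable_coeffs_diff] that by (auto simp: bounded_exponent_def)
  have le: "(a - c)\<^sup>2 \<le> 2 * (a - b)\<^sup>2 + 2 * (b - c)\<^sup>2" for a b c :: real
    using zero_le_power2[of "(a - b) - (b - c)"] by (simp add: power2_eq_square algebra_simps)
  have "coeff_dist_sq \<theta> \<zeta> \<le> (\<Sum>j. 2 * (\<theta> (Suc j) - \<eta> (Suc j))\<^sup>2 + 2 * (\<eta> (Suc j) - \<zeta> (Suc j))\<^sup>2)"
    unfolding coeff_dist_sq_def using s assms by (intro suminf_le le summable_add summable_mult) auto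
  also have "\<dots> = 2 * coeff_dist_sq \<theta> \<eta> + 2 * coeff_dist_sq \<eta> \<zeta>"
    unfolding coeff_dist_sq_def using s assms
    by (simp add: suminf_add[symmetric] suminf_mult summable_mult)
  finally show ?thesis .
qed

text \<open>Far from \<open>\<eta>\<close> the entropy loss, at least \<open>c\<close> times the squared distance, is at least twice the
  linear noise term.\<close>

lemma likelihood_upper:
  assumes \<theta>: "bounded_exponent B \<theta>" and \<eta>: "bounded_exponent B \<eta>"
    and supp: "\<And>j. N < j \<Longrightarrow> \<theta> j = \<eta> j" and n: "0 < n"
    and noise: "noise n X N \<eta> \<le> K * e" and e: "0 < e" and K: "0 \<le> K"
  defines "c \<equiv> exp (- (6 * B)) / (2 + (4 * B)\<^sup>2)"
  assumes m: "2 * K / c \<le> m" "0 < m" and far: "m\<^sup>2 * e\<^sup>2 \<le> coeff_dist_sq \<theta> \<eta>"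
  shows "likelihood n X \<theta> \<le> likelihood n X \<eta> * exp (- (c / 2 * m\<^sup>2) * (real n * e\<^sup>2))"
proof -
  define S where "S = coeff_dist_sq \<theta> \<eta>"
  define lin where "lin = (\<Sum>j<N. (\<theta> (Suc j) - \<eta> (Suc j)) * (empirical_mean n X (Suc j) - feature_mean \<eta> (Suc j)))"
  have c: "c > 0" unfolding c_def by (intro divide_pos_pos add_pos_nonneg) auto
  have S0: "S \<ge> 0" unfolding S_def by (rule coeff_dist_sq_nonneg[OF \<theta> \<eta>])
  have "m * e = sqrt (m\<^sup>2 * e\<^sup>2)" using m e by (simp add: real_sqrt_mult)
  also have "\<dots> \<le> sqrt S" using far by (simp add: S_def)
  finally have sS: "m * e \<le> sqrt S" .
  have "K \<le> c / 2 * m" using m(1) c by (simp add: field_simps)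
  then have "K * e \<le> c / 2 * (m * e)" using e by simp
  also have "\<dots> \<le> c / 2 * sqrt S" using sS c by (intro mult_left_mono) auto
  finally have Ke: "K * e \<le> c / 2 * sqrt S" .
  have "lin \<le> \<bar>lin\<bar>" by simp
  also have "\<dots> \<le> sqrt S * noise n X N \<eta>"
    unfolding lin_def S_def using supp by (rule abs_linear_noise_le)
  also have "\<dots> \<le> sqrt S * (c / 2 * sqrt S)"
    using noise Ke S0 by (intro mult_left_mono) auto
  also have "\<dots> = c / 2 * (sqrt S * sqrt S)" by (simp only: mult_ac)
  also have "\<dots> = c / 2 * S" using S0 by simp
  finally have lin: "lin \<le> c / 2 * S" .
  have D: "c * S \<le> rel_entropy \<eta> \<theta>"
    unfolding c_def S_def by (rule rel_entropy_bounds(1)[OF \<theta> \<eta>])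
  have "lin - rel_entropy \<eta> \<theta> \<le> - (c / 2 * S)" using lin D by simp
  also have "\<dots> \<le> - (c / 2 * (m\<^sup>2 * e\<^sup>2))" using far c by (simp add: S_def)
  finally have "real n * (lin - rel_entropy \<eta> \<theta>) \<le> real n * - (c / 2 * (m\<^sup>2 * e\<^sup>2))"
    by (rule mult_left_mono) simp
  also have "\<dots> = - (c / 2 * m\<^sup>2) * (real n * e\<^sup>2)" by simp
  finally have "exp (real n * (lin - rel_entropy \<eta> \<theta>)) \<le> exp (- (c / 2 * m\<^sup>2) * (real n * e\<^sup>2))"
    by (simp only: exp_le_cancel_iff)
  moreover have "likelihood n X \<theta> = likelihood n X \<eta> * exp (real n * (lin - rel_entropy \<eta> \<theta>))"
    unfolding lin_def using supp by (intro likelihood_ratio[OF \<theta> \<eta> _ n])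
  ultimately show ?thesis
    using likelihood_pos[OF \<eta>, of n X] by simp
qed

lemma likelihood_lower:
  assumes \<theta>: "bounded_exponent B \<theta>" and \<eta>: "bounded_exponent B \<eta>"
    and supp: "\<And>j. N < j \<Longrightarrow> \<theta> j = \<eta> j" and n: "0 < n"
    and noise: "noise n X N \<eta> \<le> K * e" and e: "0 < e" and K: "0 \<le> K"
    and near: "coeff_dist_sq \<theta> \<eta> \<le> D * e\<^sup>2"
  shows "likelihood n X \<eta> * exp (- (sqrt D * K + exp (6 * B) / 2 * D) * (real n * e\<^sup>2)) \<le> likelihood n X \<theta>"
proof -
  define S where "S = coeff_dist_sq \<theta> \<eta>"
  define lin where "lin = (\<Sum>j<N. (\<theta> (Suc j) - \<eta> (Suc j)) * (empirical_mean n X (Suc j) - feature_mean \<eta> (Suc j)))"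
  have S0: "S \<ge> 0" unfolding S_def by (rule coeff_dist_sq_nonneg[OF \<theta> \<eta>])
  have "sqrt S \<le> sqrt (D * e\<^sup>2)" using near by (simp add: S_def)
  also have "\<dots> = sqrt D * e" using e by (simp add: real_sqrt_mult)
  finally have sS: "sqrt S \<le> sqrt D * e" .
  have "\<bar>lin\<bar> \<le> sqrt S * noise n X N \<eta>"
    unfolding lin_def S_def using supp by (rule abs_linear_noise_le)
  also have "\<dots> \<le> (sqrt D * e) * (K * e)"
  proof (rule mult_mono[OF sS noise])
    show "0 \<le> sqrt D * e" using sS S0 order_trans[OF real_sqrt_ge_zero] by blast
    show "0 \<le> noise n X N \<eta>" unfolding noise_def by (simp add: sum_nonneg)
  qed
  finally have "- (sqrt D * K * e\<^sup>2) \<le> lin" by (simp add: power2_eq_square abs_le_iff algebra_simps)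
  moreover have "rel_entropy \<eta> \<theta> \<le> exp (6 * B) / 2 * (D * e\<^sup>2)"
    by (rule order_trans[OF rel_entropy_bounds(2)[OF \<theta> \<eta>] mult_left_mono[OF near]]) simp
  ultimately have "- (sqrt D * K + exp (6 * B) / 2 * D) * e\<^sup>2 \<le> lin - rel_entropy \<eta> \<theta>"
    by (simp add: algebra_simps)
  then have "real n * (- (sqrt D * K + exp (6 * B) / 2 * D) * e\<^sup>2) \<le> real n * (lin - rel_entropy \<eta> \<theta>)"
    by (rule mult_left_mono) simp
  then have "exp (- (sqrt D * K + exp (6 * B) / 2 * D) * (real n * e\<^sup>2)) \<le> exp (real n * (lin - rel_entropy \<eta> \<theta>))"
    by (simp only: exp_le_cancel_iff mult.left_commute)
  moreover have "likelihood n X \<theta> = likelihood n X \<eta> * exp (real n * (lin - rel_entropy \<eta> \<theta>))"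
    unfolding lin_def using supp by (intro likelihood_ratio[OF \<theta> \<eta> _ n])
  ultimately show ?thesis
    using likelihood_pos[OF \<eta>, of n X] by simp
qed

text \<open>The factor \<open>l\<close> is the likelihood at a reference parameter; it cancels in Bayes' formula, so only
  likelihood ratios against that parameter have to be estimated.\<close>

lemma posterior_le:
  fixes p Q n X T
  defines "N \<equiv> sieve_dim p Q n"
  assumes upper: "\<And>\<theta>. \<theta> \<in> sieve_ellipsoid p N Q \<Longrightarrow> Ptheta \<theta> \<in> T \<Longrightarrow> likelihood n X \<theta> \<le> l * u"
    and A: "A \<in> sets (gauss_prior p N)"
    and lower: "\<And>\<theta>. \<theta> \<in> A \<Longrightarrow> l * v \<le> likelihood n X \<theta>"
    and mass: "ennreal w \<le> emeasure (sieve_prior p N Q) A"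
    and pos: "0 < l" "0 \<le> u" "0 < v" "0 < w"
  shows "posterior p Q n X T \<le> ennreal (u / (v * w))"
proof -
  let ?\<pi> = "sieve_prior p N Q"
  have space: "space ?\<pi> = UNIV"
    by (simp add: sieve_prior_def uniform_measure_def space_gauss_prior)
  have "emeasure ?\<pi> UNIV = emeasure (gauss_prior p N) (sieve_ellipsoid p N Q) / emeasure (gauss_prior p N) (sieve_ellipsoid p N Q)"
    unfolding sieve_prior_def
    by (subst emeasure_uniform_measure) (use sets.top[of "gauss_prior p N"] sieve_ellipsoid_sets space_gauss_prior in auto)
  then have total: "emeasure ?\<pi> UNIV \<le> 1"
    by (cases "emeasure (gauss_prior p N) (sieve_ellipsoid p N Q) = 0 \<or> emeasure (gauss_prior p N) (sieve_ellipsoid p N Q) = top")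
       (auto simp: less_top)
  have "(\<integral>\<^sup>+\<theta>\<in>{\<theta> \<in> sieve_ellipsoid p N Q. Ptheta \<theta> \<in> T}. ennreal (likelihood n X \<theta>) \<partial>?\<pi>)
      \<le> (\<integral>\<^sup>+\<theta>. ennreal (l * u) \<partial>?\<pi>)"
    using upper by (intro nn_integral_mono) (auto simp: indicator_def intro!: ennreal_leI)
  also have "\<dots> \<le> ennreal (l * u) * 1"
    unfolding nn_integral_const space by (intro mult_left_mono total) simp
  finally have num: "(\<integral>\<^sup>+\<theta>\<in>{\<theta> \<in> sieve_ellipsoid p N Q. Ptheta \<theta> \<in> T}. ennreal (likelihood n X \<theta>) \<partial>?\<pi>)
      \<le> ennreal (l * u)" by simp
  have A': "A \<in> sets ?\<pi>" using A by (simp add: sieve_prior_def)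
  have "ennreal (l * v * w) = ennreal (l * v) * ennreal w" using pos by (simp add: ennreal_mult)
  also have "\<dots> \<le> ennreal (l * v) * emeasure ?\<pi> A" by (intro mult_left_mono mass) simp
  also have "\<dots> = (\<integral>\<^sup>+\<theta>. ennreal (l * v) * indicator A \<theta> \<partial>?\<pi>)"
    using A' by (simp add: nn_integral_cmult_indicator)
  also have "\<dots> \<le> (\<integral>\<^sup>+\<theta>. ennreal (likelihood n X \<theta>) \<partial>?\<pi>)"
    using lower by (intro nn_integral_mono) (auto simp: indicator_def intro!: ennreal_leI)
  finally have den: "ennreal (l * v * w) \<le> (\<integral>\<^sup>+\<theta>. ennreal (likelihood n X \<theta>) \<partial>?\<pi>)" .
  have quot: "a / d \<le> ennreal (u / (v * w))" if "a \<le> ennreal (l * u)" "ennreal (l * v * w) \<le> d" for a d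
  proof (rule divide_le_posI_ennreal)
    show "0 < d" using that(2) pos by (simp add: less_le_trans[OF _ that(2)])
    have "a \<le> ennreal (u / (v * w)) * ennreal (l * v * w)"
      using that(1) pos by (simp add: ennreal_mult[symmetric] mult.commute)
    also have "\<dots> \<le> ennreal (u / (v * w)) * d" by (intro mult_left_mono that) simp
    finally show "a \<le> d * ennreal (u / (v * w))" by (simp add: mult.commute)
  qed
  show ?thesis unfolding posterior_def N_def[symmetric] Let_def by (rule quot[OF num den])
qed

section \<open>The rate\<close>

text \<open>Here \<open>e\<close> is the rate and \<open>y = n e\<^sup>2\<close> the exponent that governs all probabilities.\<close>

lemma rate_identities:
  fixes p n :: nat
  assumes p: "1 \<le> p" and n: "0 < n"
  defines "y \<equiv> real n powr (1 / real (2 * p + 1))"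
    and "e \<equiv> real n powr (- (real p / real (2 * p + 1)))"
  shows "1 \<le> y" "0 < e" "e\<^sup>2 * y ^ (2 * p) = 1" "real n * e\<^sup>2 = y" "y ^ (2 * p + 1) = real n"
proof -
  have n1: "real n \<ge> 1" "real n > 0" using n by auto
  show "1 \<le> y" unfolding y_def using n1 by (intro ge_one_powr_ge_zero) auto
  show e: "0 < e" unfolding e_def using n1 by simp
  have y: "y > 0" unfolding y_def using n1 by simp
  have ey: "e * y ^ p = 1"
  proof -
    have "y ^ p = real n powr (real p / real (2 * p + 1))"
      unfolding y_def by (subst powr_realpow[symmetric]) (use n1 in \<open>auto simp: powr_powr\<close>)
    then show ?thesis unfolding e_def using n1 by (simp add: powr_add[symmetric])
  qed
  have "e\<^sup>2 * y ^ (2 * p) = (e * y ^ p)\<^sup>2" by (simp add: power_mult_distrib power_mult[symmetric] mult.commute)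
  then show e2: "e\<^sup>2 * y ^ (2 * p) = 1" using ey by simp
  show yn: "y ^ (2 * p + 1) = real n"
    unfolding y_def by (subst powr_realpow[symmetric]) (use n1 in \<open>auto simp: powr_powr\<close>)
  have "real n * e\<^sup>2 = y * (e\<^sup>2 * y ^ (2 * p))" unfolding yn[symmetric] by simp
  then show "real n * e\<^sup>2 = y" using e2 by simp
qed

lemma sieve_dim_bounds:
  fixes p n :: nat and Q :: real
  assumes p: "1 \<le> p" and n: "0 < n" and Q: "0 < Q"
  defines "y \<equiv> real n powr (1 / real (2 * p + 1))"
    and "e \<equiv> real n powr (- (real p / real (2 * p + 1)))"
    and "R \<equiv> (2 * Q / const_B1_sq p Q) powr (1 / real (2 * p))"
    and "N \<equiv> sieve_dim p Q n"
  shows "0 < R" "0 < N" "real N \<le> (R + 1) * y" "1 / (real N + 1) ^ (2 * p) \<le> 1 / R ^ (2 * p) * e\<^sup>2"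
    "e\<^sup>2 * real N \<le> R + 1"
proof -
  note rate = rate_identities[OF p n, folded y_def e_def]
  show R: "0 < R" unfolding R_def using Q by (simp add: const_B1_sq_def)
  have N_eq: "N = nat \<lceil>R * y\<rceil>" unfolding N_def sieve_dim_def R_def y_def ..
  have Ry: "R * y > 0" using R rate(1) by simp
  then show N: "0 < N" unfolding N_eq by simp
  have N1: "R * y \<le> real N" unfolding N_eq by (rule real_nat_ceiling_ge)
  have "real N \<le> R * y + 1" unfolding N_eq using Ry by linarith
  then show N2: "real N \<le> (R + 1) * y" using rate(1) by (simp add: distrib_right)
  have "(R * y) ^ (2 * p) \<le> (real N + 1) ^ (2 * p)" using N1 Ry by (intro power_mono) auto
  then have "1 / (real N + 1) ^ (2 * p) \<le> 1 / (R * y) ^ (2 * p)"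
    using Ry zero_less_power[OF Ry, of "2 * p"] by (intro divide_left_mono mult_pos_pos) auto
  also have "\<dots> = 1 / R ^ (2 * p) * (e\<^sup>2 * y ^ (2 * p)) / y ^ (2 * p)"
    unfolding rate(3) by (simp add: power_mult_distrib)
  also have "\<dots> = 1 / R ^ (2 * p) * e\<^sup>2" using rate(1) by simp
  finally show "1 / (real N + 1) ^ (2 * p) \<le> 1 / R ^ (2 * p) * e\<^sup>2" .
  have "e\<^sup>2 * real N \<le> e\<^sup>2 * ((R + 1) * y)" using N2 by (intro mult_left_mono) auto
  also have "\<dots> = (R + 1) * (e\<^sup>2 * y ^ 1)" by simp
  also have "\<dots> \<le> (R + 1) * (e\<^sup>2 * y ^ (2 * p))"
    using R rate(1) p by (intro mult_left_mono power_increasing) auto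
  finally show "e\<^sup>2 * real N \<le> R + 1" using rate(3) by simp
qed

text \<open>With \<open>y\<^sup>2\<^sup>p\<^sup>+\<^sup>1 = n\<close>, the bound \<open>exp (- y) \<le> k! / y\<^sup>k\<close> for \<open>k = 2 (2 p + 1)\<close> gives the summable \<open>n\<^sup>-\<^sup>2\<close>.\<close>

lemma summable_exp_neg_rate:
  fixes p :: nat
  shows "summable (\<lambda>n. exp (- (real n powr (1 / real (2 * p + 1)))))"
proof (rule summable_comparison_test_ev)
  let ?k = "(2 * p + 1) * 2"
  show "summable (\<lambda>n. fact ?k * inverse (real n ^ 2))"
    by (intro summable_mult inverse_power_summable) simp
  show "\<forall>\<^sub>F n in sequentially. norm (exp (- (real n powr (1 / real (2 * p + 1))))) \<le> fact ?k * inverse (real n ^ 2)"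
    using eventually_gt_at_top[of 0]
  proof eventually_elim
    case (elim n)
    define y where "y = real n powr (1 / real (2 * p + 1))"
    have "y ^ (2 * p + 1) = real n"
      unfolding y_def by (subst powr_realpow[symmetric]) (use elim in \<open>auto simp: powr_powr\<close>)
    then have "y ^ ?k = real n ^ 2" by (simp only: power_mult)
    moreover have "y ^ ?k \<le> fact ?k * exp y" by (rule power_le_fact_mult_exp) (simp add: y_def)
    ultimately have "real n ^ 2 \<le> fact ?k * exp y" by simp
    then have "exp (- y) \<le> fact ?k * inverse (real n ^ 2)"
      using elim by (simp add: exp_minus field_simps)
    then show ?case by (simp add: y_def)
  qed
qed

text \<open>The net has at most \<open>exp (6 N)\<close> points and \<open>N\<close> is of order \<open>n e\<^sup>2\<close>. The constant \<open>K\<close> makes the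
  Bernstein exponent absorb this entropy and leaves \<open>exp (- n e\<^sup>2)\<close>, which is summable, so
  the Borel--Cantelli lemma applies.\<close>

lemma noise_eventually_small:
  fixes p :: nat and Q :: real
  assumes p: "1 \<le> p" and Q: "0 < Q" and \<theta>\<^sub>0: "\<theta>\<^sub>0 \<in> ellipsoid p Q"
  shows "\<exists>K>0. AE X in Pi\<^sub>M (UNIV :: nat set) (\<lambda>_. Ptheta \<theta>\<^sub>0). \<forall>\<^sub>F n in sequentially.
    noise n X (sieve_dim p Q n) \<theta>\<^sub>0 \<le> K * real n powr (- (real p / real (2 * p + 1)))"
proof -
  define B where "B = const_B p Q"
  have b0: "bounded_exponent B \<theta>\<^sub>0" unfolding B_def by (rule ellipsoid_bounded_exponent[OF p \<theta>\<^sub>0])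
  define R where "R = (2 * Q / const_B1_sq p Q) powr (1 / real (2 * p))"
  have R: "0 < R" unfolding R_def by (rule sieve_dim_bounds(1)[OF p zero_less_one Q])
  define cst where "cst = exp (sqrt (8 * (R + 1)) + 2 * B) / 2"
  define K where "K = 4 * (cst + 6 * (R + 1) + 1)"
  have K: "K > 0" using R by (simp add: K_def cst_def add_pos_pos)
  define M where "M = Pi\<^sub>M (UNIV :: nat set) (\<lambda>_. Ptheta \<theta>\<^sub>0)"
  interpret P: prob_space "Ptheta \<theta>\<^sub>0" by (rule prob_space_Ptheta[OF b0])
  interpret M: prob_space M unfolding M_def by (intro prob_space_PiM P.prob_space_axioms)
  define e where "e n = real n powr (- (real p / real (2 * p + 1)))" for n
  define y where "y n = real n powr (1 / real (2 * p + 1))" for n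
  define bad where "bad n = {X \<in> space M. K * e n \<le> noise n X (sieve_dim p Q n) \<theta>\<^sub>0}" for n
  have bad_sets: "bad n \<in> sets M" for n
    unfolding bad_def M_def by measurable
  have bad_le: "measure M (bad n) \<le> exp (- y n)" if n: "0 < n" for n
  proof -
    let ?N = "sieve_dim p Q n"
    note rate = rate_identities[OF p n, folded y_def e_def]
    note dim = sieve_dim_bounds[OF p n Q, folded y_def e_def R_def]
    have "emeasure M (bad n) \<le> ennreal (exp (6 * real ?N - real n * (e n)\<^sup>2 * (K / 4 - cst)))"
      unfolding bad_def M_def cst_def by (rule noise_tail[OF b0 rate(2) dim(5) dim(2) n])
    moreover have "6 * real ?N - real n * (e n)\<^sup>2 * (K / 4 - cst) \<le> - y n"
    proof -
      have "real n * (e n)\<^sup>2 * (K / 4 - cst) = y n * (6 * (R + 1) + 1)"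
        unfolding rate(4) by (simp add: K_def field_simps)
      then show ?thesis using dim(3) by (simp add: algebra_simps)
    qed
    ultimately have "emeasure M (bad n) \<le> ennreal (exp (- y n))"
      by (meson ennreal_leI exp_le_cancel_iff order_trans)
    then show ?thesis by (simp add: M.emeasure_eq_measure)
  qed
  have "summable (\<lambda>n. measure M (bad n))"
  proof (rule summable_comparison_test_ev)
    show "summable (\<lambda>n. exp (- y n))" unfolding y_def by (rule summable_exp_neg_rate)
    show "\<forall>\<^sub>F n in sequentially. norm (measure M (bad n)) \<le> exp (- y n)"
      using eventually_gt_at_top[of 0] by eventually_elim (simp add: bad_le)
  qed
  then have "AE X in M. \<forall>\<^sub>F n in sequentially. X \<in> space M - bad n"
    by (intro borel_cantelli_AE1 bad_sets) (auto simp: M.emeasure_eq_measure)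
  then have "AE X in M. \<forall>\<^sub>F n in sequentially. noise n X (sieve_dim p Q n) \<theta>\<^sub>0 \<le> K * e n"
    by eventually_elim (auto simp: bad_def elim: eventually_mono)
  then show ?thesis using K unfolding M_def e_def by blast
qed

theorem theorem4:
  fixes p :: nat and Q :: real and \<theta>\<^sub>0 :: "nat \<Rightarrow> real"
  assumes "1 \<le> p" and "0 < Q" and "\<theta>\<^sub>0 \<in> ellipsoid p Q"
  shows "\<exists>M\<^sub>0>0. \<forall>M\<ge>M\<^sub>0.
    AE X in Pi\<^sub>M (UNIV :: nat set) (\<lambda>_. Ptheta \<theta>\<^sub>0).
      (\<lambda>n. posterior p Q n X
             {Ptheta \<theta> | \<theta>. \<theta> \<in> ellipsoid p Q \<and>
                hellinger_dist (dens \<theta>\<^sub>0) (dens \<theta>) > M * real n powr (- (real p / real (2 * p + 1)))})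
      \<longlonglongrightarrow> 0"
proof -
  note p = assms(1) and Q = assms(2) and \<theta>\<^sub>0 = assms(3)
  define B where "B = const_B p Q"
  define R where "R = (2 * Q / const_B1_sq p Q) powr (1 / real (2 * p))"
  define D where "D = 1 / R ^ (2 * p)"
  define e where "e n = real n powr (- (real p / real (2 * p + 1)))" for n
  define y where "y n = real n powr (1 / real (2 * p + 1))" for n
  have R: "0 < R" unfolding R_def by (rule sieve_dim_bounds(1)[OF p zero_less_one Q])
  have D: "0 < D" using R by (simp add: D_def)
  have be: "bounded_exponent B \<theta>" if "\<theta> \<in> ellipsoid p Q" for \<theta>
    unfolding B_def using p that by (rule ellipsoid_bounded_exponent)
  obtain K\<^sub>0 where K\<^sub>0: "0 < K\<^sub>0"
    and ae: "AE X in Pi\<^sub>M (UNIV :: nat set) (\<lambda>_. Ptheta \<theta>\<^sub>0). \<forall>\<^sub>F n in sequentially.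
      noise n X (sieve_dim p Q n) \<theta>\<^sub>0 \<le> K\<^sub>0 * e n"
    using noise_eventually_small[OF assms] unfolding e_def by blast
  obtain c where c: "0 < c"
    and mass: "\<And>N. 0 < N \<Longrightarrow> \<exists>A \<in> sets (gauss_prior p N).
       (\<forall>\<theta>\<in>A. \<theta> \<in> sieve_ellipsoid p N Q \<and> coeff_dist_sq \<theta> (truncate N \<theta>\<^sub>0) \<le> 1 / (real N + 1) ^ (2 * p))
       \<and> ennreal (exp (- c * (real N + 1))) \<le> emeasure (sieve_prior p N Q) A"
    using sieve_prior_mass[OF assms] by blast
  define K where "K = K\<^sub>0 + sqrt (exp (4 * B) * (1 + exp (4 * B)) * (Q * D))"
  have K: "0 \<le> K" unfolding K_def using K\<^sub>0 Q D by (intro add_nonneg_nonneg) auto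
  define c\<^sub>1 where "c\<^sub>1 = exp (- (6 * B)) / (2 + (4 * B)\<^sup>2)"
  have c\<^sub>1: "c\<^sub>1 > 0" unfolding c\<^sub>1_def by (intro divide_pos_pos add_pos_nonneg) auto
  define G where "G = sqrt D * K + exp (6 * B) / 2 * D"
  have G: "0 \<le> G" unfolding G_def using D K by simp
  \<comment> \<open>The first bound on \<open>m\<close> makes the quadratic term beat the noise, the second makes the gain
    exceed the loss \<open>G\<close> in the denominator and the cost \<open>c * (R + 2)\<close> of the prior mass.\<close>
  define m where "m = max (2 * K / c\<^sub>1) (max 1 (2 * (G + c * (R + 2) + 1) / c\<^sub>1))"
  have m: "2 * K / c\<^sub>1 \<le> m" "1 \<le> m" "2 * (G + c * (R + 2) + 1) / c\<^sub>1 \<le> m"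
    unfolding m_def by auto
  have m0: "0 < m" using m(2) by linarith
  have gain: "G + c * (R + 2) + 1 \<le> c\<^sub>1 / 2 * m\<^sup>2"
  proof -
    have "G + c * (R + 2) + 1 \<le> c\<^sub>1 / 2 * m" using m(3) c\<^sub>1 by (simp add: field_simps)
    also have "\<dots> \<le> c\<^sub>1 / 2 * m\<^sup>2"
      using m(2) c\<^sub>1 by (intro mult_left_mono) (auto simp: power2_eq_square)
    finally show ?thesis .
  qed
  define C\<^sub>H where "C\<^sub>H = exp (2 * B) * (1 + exp (4 * B))"
  have C\<^sub>H: "0 < C\<^sub>H" unfolding C\<^sub>H_def by (intro mult_pos_pos add_pos_pos) auto
  define M\<^sub>0 where "M\<^sub>0 = sqrt (C\<^sub>H * (2 * (Q * D) + 2 * m\<^sup>2)) + 1"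
  have M\<^sub>0: "0 < M\<^sub>0" "C\<^sub>H * (2 * (Q * D) + 2 * m\<^sup>2) \<le> M\<^sub>0\<^sup>2"
  proof -
    have nn: "0 \<le> C\<^sub>H * (2 * (Q * D) + 2 * m\<^sup>2)" using C\<^sub>H Q D by simp
    then show "0 < M\<^sub>0" unfolding M\<^sub>0_def by (intro add_nonneg_pos) auto
    have "(sqrt (C\<^sub>H * (2 * (Q * D) + 2 * m\<^sup>2)))\<^sup>2 \<le> M\<^sub>0\<^sup>2"
      using nn by (intro power_mono) (auto simp: M\<^sub>0_def)
    then show "C\<^sub>H * (2 * (Q * D) + 2 * m\<^sup>2) \<le> M\<^sub>0\<^sup>2" using nn by simp
  qed
  have main: "posterior p Q n X {Ptheta \<theta> | \<theta>. \<theta> \<in> ellipsoid p Q \<and>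
      hellinger_dist (dens \<theta>\<^sub>0) (dens \<theta>) > M * e n} \<le> ennreal (exp (- y n))"
    if M: "M\<^sub>0 \<le> M" and n: "0 < n" and noise\<^sub>0: "noise n X (sieve_dim p Q n) \<theta>\<^sub>0 \<le> K\<^sub>0 * e n" for M n X
  proof -
    define N where "N = sieve_dim p Q n"
    define \<eta> where "\<eta> = truncate N \<theta>\<^sub>0"
    let ?T = "{Ptheta \<theta> | \<theta>. \<theta> \<in> ellipsoid p Q \<and> hellinger_dist (dens \<theta>\<^sub>0) (dens \<theta>) > M * e n}"
    note rate = rate_identities[OF p n, folded y_def e_def]
    note dim = sieve_dim_bounds[OF p n Q, folded y_def e_def R_def N_def D_def]
    have sub: "\<theta> \<in> ellipsoid p Q" if "\<theta> \<in> sieve_ellipsoid p N Q" for \<theta>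
      using that sieve_ellipsoid_subset by blast
    have supp: "\<theta> j = \<eta> j" if "\<theta> \<in> sieve_ellipsoid p N Q" "N < j" for \<theta> j
      using that by (simp add: sieve_ellipsoid_def \<eta>_def truncate_def)
    have b\<eta>: "bounded_exponent B \<eta>"
      unfolding \<eta>_def by (intro be sub truncate_in_sieve \<theta>\<^sub>0)
    have "coeff_dist_sq \<theta>\<^sub>0 \<eta> \<le> Q * (1 / (real N + 1) ^ (2 * p))"
      unfolding \<eta>_def using coeff_dist_truncate_le[OF p \<theta>\<^sub>0] by simp
    also have "\<dots> \<le> Q * (D * (e n)\<^sup>2)" using dim(4) Q by (intro mult_left_mono) auto
    finally have tail: "coeff_dist_sq \<theta>\<^sub>0 \<eta> \<le> Q * D * (e n)\<^sup>2" by simp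
    have noise: "noise n X N \<eta> \<le> K * e n"
    proof -
      have "sqrt (exp (4 * B) * (1 + exp (4 * B)) * coeff_dist_sq \<theta>\<^sub>0 \<eta>)
          \<le> sqrt (exp (4 * B) * (1 + exp (4 * B)) * (Q * D * (e n)\<^sup>2))"
        using tail by (intro real_sqrt_le_mono mult_left_mono) auto
      also have "\<dots> = sqrt (exp (4 * B) * (1 + exp (4 * B)) * (Q * D)) * e n"
        using rate(2) by (simp add: real_sqrt_mult)
      finally show ?thesis
        using noise_change_center[OF be[OF \<theta>\<^sub>0] b\<eta>, of n X N] noise\<^sub>0
        unfolding K_def N_def[symmetric] by (simp add: distrib_right)
    qed
    have upper: "likelihood n X \<theta> \<le> likelihood n X \<eta> * exp (- (c\<^sub>1 / 2 * m\<^sup>2) * (real n * (e n)\<^sup>2))"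
      if \<theta>: "\<theta> \<in> sieve_ellipsoid p N Q" and T: "Ptheta \<theta> \<in> ?T" for \<theta>
    proof -
      have b\<theta>: "bounded_exponent B \<theta>" by (intro be sub \<theta>)
      obtain \<theta>' where \<theta>': "Ptheta \<theta> = Ptheta \<theta>'" "\<theta>' \<in> ellipsoid p Q"
        and far': "M * e n < hellinger_dist (dens \<theta>\<^sub>0) (dens \<theta>')"
        using T by blast
      have far: "M * e n < hellinger_dist (dens \<theta>\<^sub>0) (dens \<theta>)"
        using far' hellinger_dist_cong_Ptheta[OF \<theta>'(1) b\<theta> be[OF \<theta>'(2)]] by simp
      have "M\<^sub>0 * e n \<le> M * e n" using M rate(2) by simp
      with far have "(M\<^sub>0 * e n)\<^sup>2 \<le> (hellinger_dist (dens \<theta>\<^sub>0) (dens \<theta>))\<^sup>2"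
        using mult_pos_pos[OF M\<^sub>0(1) rate(2)] by (intro power_mono) linarith+
      also have "\<dots> \<le> C\<^sub>H * coeff_dist_sq \<theta>\<^sub>0 \<theta>"
        unfolding C\<^sub>H_def by (rule hellinger_dist_sq_le[OF be[OF \<theta>\<^sub>0] b\<theta>])
      also have "\<dots> \<le> C\<^sub>H * (2 * (Q * D * (e n)\<^sup>2) + 2 * coeff_dist_sq \<theta> \<eta>)"
        using coeff_dist_sq_triangle[OF be[OF \<theta>\<^sub>0] b\<eta> b\<theta>] tail C\<^sub>H
        by (intro mult_left_mono) (auto simp: coeff_dist_sq_commute[of \<theta> \<eta>])
      finally have "C\<^sub>H * (2 * (Q * D) + 2 * m\<^sup>2) * (e n)\<^sup>2 \<le> C\<^sub>H * (2 * (Q * D * (e n)\<^sup>2) + 2 * coeff_dist_sq \<theta> \<eta>)"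
        using mult_right_mono[OF M\<^sub>0(2), of "(e n)\<^sup>2"] by (simp add: power_mult_distrib)
      then have "C\<^sub>H * ((2 * (Q * D) + 2 * m\<^sup>2) * (e n)\<^sup>2) \<le> C\<^sub>H * (2 * (Q * D * (e n)\<^sup>2) + 2 * coeff_dist_sq \<theta> \<eta>)"
        by (simp only: mult.assoc)
      then have "(2 * (Q * D) + 2 * m\<^sup>2) * (e n)\<^sup>2 \<le> 2 * (Q * D * (e n)\<^sup>2) + 2 * coeff_dist_sq \<theta> \<eta>"
        using C\<^sub>H by (rule mult_left_le_imp_le)
      then have "m\<^sup>2 * (e n)\<^sup>2 \<le> coeff_dist_sq \<theta> \<eta>" by (simp add: distrib_right)
      then show ?thesis
        using supp[OF \<theta>] m(1) m0 unfolding c\<^sub>1_def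
        by (intro likelihood_upper[OF b\<theta> b\<eta> _ n noise rate(2) K]) auto
    qed
    obtain A where A: "A \<in> sets (gauss_prior p N)" "\<And>\<theta>. \<theta> \<in> A \<Longrightarrow> \<theta> \<in> sieve_ellipsoid p N Q"
      "\<And>\<theta>. \<theta> \<in> A \<Longrightarrow> coeff_dist_sq \<theta> \<eta> \<le> 1 / (real N + 1) ^ (2 * p)"
      and massA: "ennreal (exp (- c * (real N + 1))) \<le> emeasure (sieve_prior p N Q) A"
      using mass[OF dim(2)] unfolding \<eta>_def by blast
    have lower: "likelihood n X \<eta> * exp (- G * (real n * (e n)\<^sup>2)) \<le> likelihood n X \<theta>" if "\<theta> \<in> A" for \<theta>
      unfolding G_def
    proof (rule likelihood_lower[OF _ b\<eta> _ n noise rate(2) K])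
      show "bounded_exponent B \<theta>" by (intro be sub A that)
      show "\<theta> j = \<eta> j" if "N < j" for j using supp A(2) \<open>\<theta> \<in> A\<close> that by blast
      show "coeff_dist_sq \<theta> \<eta> \<le> D * (e n)\<^sup>2" using A(3)[OF that] dim(4) by linarith
    qed
    have "posterior p Q n X ?T \<le> ennreal (exp (- (c\<^sub>1 / 2 * m\<^sup>2) * (real n * (e n)\<^sup>2))
        / (exp (- G * (real n * (e n)\<^sup>2)) * exp (- c * (real N + 1))))"
      using upper A(1) lower massA likelihood_pos[OF b\<eta>] unfolding N_def
      by (intro posterior_le[where l = "likelihood n X \<eta>" and A = A]) auto
    also have "\<dots> \<le> ennreal (exp (- y n))"
    proof (rule ennreal_leI)
      have "c * (real N + 1) \<le> c * ((R + 2) * y n)"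
        using dim(3) rate(1) c by (intro mult_left_mono) (auto simp: algebra_simps)
      moreover have "(G + c * (R + 2) + 1) * y n \<le> c\<^sub>1 / 2 * m\<^sup>2 * y n"
        using gain rate(1) by (intro mult_right_mono) auto
      ultimately have "- (c\<^sub>1 / 2 * m\<^sup>2) * y n + G * y n + c * (real N + 1) \<le> - y n"
        by (simp add: algebra_simps)
      moreover have "exp (- (c\<^sub>1 / 2 * m\<^sup>2) * y n) / (exp (- G * y n) * exp (- c * (real N + 1)))
          = exp (- (c\<^sub>1 / 2 * m\<^sup>2) * y n + G * y n + c * (real N + 1))"
        by (simp only: exp_add[symmetric] exp_diff[symmetric]) (simp add: algebra_simps)
      ultimately show "exp (- (c\<^sub>1 / 2 * m\<^sup>2) * (real n * (e n)\<^sup>2))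
          / (exp (- G * (real n * (e n)\<^sup>2)) * exp (- c * (real N + 1))) \<le> exp (- y n)"
        unfolding rate(4) by simp
    qed
    finally show ?thesis .
  qed
  have lim: "(\<lambda>n. ennreal (exp (- y n))) \<longlonglongrightarrow> 0"
  proof -
    have "(\<lambda>n. exp (- y n)) \<longlonglongrightarrow> 0"
      unfolding y_def by (rule summable_LIMSEQ_zero[OF summable_exp_neg_rate])
    from tendsto_ennrealI[OF this] show ?thesis by simp
  qed
  show ?thesis
  proof (intro exI[of _ M\<^sub>0] conjI allI impI M\<^sub>0(1))
    fix M assume M: "M\<^sub>0 \<le> M"
    show "AE X in Pi\<^sub>M (UNIV :: nat set) (\<lambda>_. Ptheta \<theta>\<^sub>0).
      (\<lambda>n. posterior p Q n X
             {Ptheta \<theta> | \<theta>. \<theta> \<in> ellipsoid p Q \<and>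
                hellinger_dist (dens \<theta>\<^sub>0) (dens \<theta>) > M * real n powr (- (real p / real (2 * p + 1)))})
      \<longlonglongrightarrow> 0"
      using ae
    proof eventually_elim
      case (elim X)
      have "\<forall>\<^sub>F n in sequentially. posterior p Q n X {Ptheta \<theta> | \<theta>. \<theta> \<in> ellipsoid p Q \<and>
          hellinger_dist (dens \<theta>\<^sub>0) (dens \<theta>) > M * e n} \<le> ennreal (exp (- y n))"
        using elim eventually_gt_at_top[of 0] by eventually_elim (rule main[OF M])
      then show ?case
        unfolding e_def by (intro tendsto_sandwich[OF _ _ tendsto_const lim]) auto
    qed
  qed
qed

end
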